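(* Let $A=\{a^{(1)},\dots,a^{(N)}\}\subseteq\mathbb{Z}^n$ generate $\mathbb{Z}^n$ as an abelian group and let $\alpha\in\mathbb{C}^n$. If $\alpha$ is nonresonant for $A$, then there is an isomorphism of $\mathcal{D}$-modules $$\mathcal{M}_\alpha\cong H^n(\Omega^\bullet_{R'/\mathbb{C}[\lambda]},\nabla_\alpha).$$
   Context: Write $a^{(j)}=(a^{(j)}_1,\dots,a^{(j)}_n)$, $\alpha=(\alpha_1,\dots,\alpha_n)$, and $L=\{(l_1,\dots,l_N)\in\mathbb{Z}^N\mid \sum_{j=1}^N l_ja^{(j)}=0\}$. Hypergeometric module. Let $\mathcal{D}=\mathbb{C}\langle\lambda_1,\dots,\lambda_N,\partial_1,\dots,\partial_N\rangle$ be the Weyl algebra of differential operators in $\lambda_1,\dots,\lambda_N$, $\partial_j=\partial/\partial\lambda_j$. For $l\in L$ put $\Box_l=\prod_{l_j>0}\partial_j^{l_j}-\prod_{l_j<0}\partial_j^{-l_j}$, and for $i=1,\dots,n$ put $Z_{i,\alpha}=\sum_{j=1}^N a^{(j)}_i\lambda_j\partial_j-\alpha_i$. Define the left $\mathcal{D}$-module $\mathcal{M}_\alpha=\mathcal{D}/(\sum_{l\in L}\mathcal{D}\Box_l+\sum_{i=1}^n\mathcal{D}Z_{i,\alpha})$. Nonresonance. Let $C(A)\subseteq\mathbb{R}^n$ be the real cone generated by $A$, and let $\ell_1,\dots,\ell_s\in\mathbb{Z}[u_1,\dots,u_n]$ be the homogeneous linear forms defining the codimension-one faces of $C(A)$,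 normalized so that the coefficients of each $\ell_i$ are relatively prime and $\ell_i\ge 0$ on $C(A)$. Then $\alpha$ is nonresonant for $A$ if $\ell_i(\alpha)\notin\mathbb{Z}$ for all $i$. Complex. Let $\mathbb{C}[\lambda]=\mathbb{C}[\lambda_1,\dots,\lambda_N]$, $R'=\mathbb{C}[\lambda][x_1^{\pm1},\dots,x_n^{\pm1}]$, $f=\sum_{j=1}^N\lambda_jx^{a^{(j)}}\in R'$. Let $\Omega^k_{R'/\mathbb{C}[\lambda]}$ be the module of relative $k$-forms, a free $R'$-module with basis the forms $\frac{dx_{i_1}}{x_{i_1}}\wedge\cdots\wedge\frac{dx_{i_k}}{x_{i_k}}$, $1\le i_1<\dots<i_k\le n$. The differential $\nabla_\alpha:\Omega^k_{R'/\mathbb{C}[\lambda]}\to\Omega^{k+1}_{R'/\mathbb{C}[\lambda]}$ is $\nabla_\alpha(\omega)=d\omega+\sum_{i=1}^n\alpha_i\frac{dx_i}{x_i}\wedge\omega+df\wedge\omega$, where $d$ is the relative exterior derivative (the $\lambda_j$ are constants). $\mathcal{D}$ acts on this complex, commuting with $\nabla_\alpha$: $\lambda_j$ acts by multiplication, and $\partial_j$ acts on coefficients with respect to the basis forms $\frac{dx_{i_1}}{x_{i_1}}\wedge\cdots\wedge\frac{dx_{i_k}}{x_{i_k}}$ ($1\le i_1<\dots<i_k\le n$) as $D_j=\partial_j+x^{a^{(j)}}$ (where $\partial_j$ differentiates with respect to $\lambda_j$ with $x_1,\dots,x_n$ constant). Thus the cohomology groups are $\mathcal{D}$-modules.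
   Formalization: With the given signs the claim is false (n = N = 1, a = 1, α = 1/3: Euler eigenvalues lie in 1/3+ℤ on one side and −1/3+ℤ on the other), so the cohomology is taken for ∇_{-α}: M_α ≅ H^n(Ω, ∇_{-α}). *)

theory Defs
  imports
    "HOL-Analysis.Analysis"
    "HOL-Algebra.Module"
    "HOL-Library.Poly_Mapping"
    "HOL-Computational_Algebra.Group_Closure"
begin

section \<open>Polynomials and Laurent polynomials\<close>

type_synonym 'v cpoly = "('v \<Rightarrow>\<^sub>0 nat) \<Rightarrow>\<^sub>0 complex"

text \<open>The ring \<open>R'\<close>: the group algebra of the exponent lattice over the polynomial ring in
  the \<open>\<lambda>\<close>-variables; the key \<open>u\<close> stands for the monomial \<open>x\<^sup>u\<close>.\<close>

type_synonym ('v, 'n) laurent = "(int ^ 'n) \<Rightarrow>\<^sub>0 'v cpoly"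

text \<open>The coefficient of \<open>\<lambda>\<^sup>u\<close> in \<open>\<partial>p/\<partial>\<lambda>\<^sub>j\<close> is \<open>u\<^sub>j + 1\<close> times that of \<open>\<lambda>\<^sup>u \<lambda>\<^sub>j\<close> in \<open>p\<close>.\<close>

lift_definition lam_deriv :: "'v \<Rightarrow> 'v cpoly \<Rightarrow> 'v cpoly" is
  "\<lambda>j (p :: ('v \<Rightarrow>\<^sub>0 nat) \<Rightarrow> complex) u.
     of_nat (Poly_Mapping.lookup u j + 1) * p (u + Poly_Mapping.single j 1)"
proof -
  fix j :: 'v and p :: "('v \<Rightarrow>\<^sub>0 nat) \<Rightarrow> complex"
  assume fin: "finite {u. p u \<noteq> 0}"
  have "inj (\<lambda>u. u + Poly_Mapping.single j (1::nat))"
    by (simp add: inj_on_def)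
  from finite_vimageI[OF fin this]
  have "finite {u. p (u + Poly_Mapping.single j 1) \<noteq> 0}"
    by (simp add: vimage_def)
  then show "finite {u. of_nat (Poly_Mapping.lookup u j + 1) * p (u + Poly_Mapping.single j 1) \<noteq> 0}"
    by (rule rev_finite_subset) auto
qed

definition lconst :: "complex \<Rightarrow> ('v, 'n::finite) laurent"
  where "lconst c = Poly_Mapping.single 0 (Poly_Mapping.single 0 c)"

definition lam :: "'v \<Rightarrow> ('v, 'n::finite) laurent"
  where "lam j = Poly_Mapping.single 0 (Poly_Mapping.single (Poly_Mapping.single j 1) 1)"

definition xmon :: "int ^ 'n \<Rightarrow> ('v, 'n::finite) laurent"
  where "xmon u = Poly_Mapping.single u 1"

definition lpartial :: "'v \<Rightarrow> ('v, 'n::finite) laurent \<Rightarrow> ('v, 'n) laurent"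
  where "lpartial j r = Poly_Mapping.map (lam_deriv j) r"

text \<open>\<open>x\<^sub>i \<partial>/\<partial>x\<^sub>i\<close>, which multiplies \<open>x\<^sup>u\<close> by \<open>u\<^sub>i\<close>.\<close>

definition xeuler :: "'n \<Rightarrow> ('v, 'n::finite) laurent \<Rightarrow> ('v, 'n) laurent"
  where "xeuler i r = Poly_Mapping.mapp (\<lambda>u c. of_int (u $ i) * c) r"

definition fpoly :: "('v::finite \<Rightarrow> int ^ 'n) \<Rightarrow> ('v, 'n::finite) laurent"
  where "fpoly a = (\<Sum>j\<in>UNIV. lam j * xmon (a j))"


section \<open>The Weyl algebra\<close>

text \<open>The free associative algebra on the symbols \<open>\<lambda>\<^sub>j\<close>, \<open>\<partial>\<^sub>j\<close> is the monoid algebra of the free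
  monoid of words, and the Weyl algebra is its quotient by the two-sided ideal generated by
  the canonical commutation relations.\<close>

datatype 'v weyl_gen = Var 'v | Der 'v

datatype 'g free_monoid = Wd (letters: "'g list")

instantiation free_monoid :: (type) monoid_add
begin
definition "0 = Wd []"
definition "v + w = Wd (letters v @ letters w)"
instance by standard (simp_all add: zero_free_monoid_def plus_free_monoid_def)
end

type_synonym 'v free_weyl = "'v weyl_gen free_monoid \<Rightarrow>\<^sub>0 complex"

definition fgen :: "'v weyl_gen \<Rightarrow> 'v free_weyl"
  where "fgen g = Poly_Mapping.single (Wd [g]) 1"

inductive_set weyl_rels :: "'v free_weyl set" where
  "fgen (Var i) * fgen (Var j) - fgen (Var j) * fgen (Var i) \<in> weyl_rels"
| "fgen (Der i) * fgen (Der j) - fgen (Der j) * fgen (Der i) \<in> weyl_rels"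
| "fgen (Der i) * fgen (Var j) - fgen (Var j) * fgen (Der i) - (if i = j then 1 else 0) \<in> weyl_rels"

inductive_set weyl_ideal :: "'v free_weyl set" where
  zero: "0 \<in> weyl_ideal"
| add: "p \<in> weyl_ideal \<Longrightarrow> q \<in> weyl_ideal \<Longrightarrow> p + q \<in> weyl_ideal"
| rel: "r \<in> weyl_rels \<Longrightarrow> p * r * q \<in> weyl_ideal"

lemma weyl_ideal_mult_left: "p \<in> weyl_ideal \<Longrightarrow> q * p \<in> weyl_ideal"
proof (induction rule: weyl_ideal.induct)
  case (rel r p q')
  then show ?case using weyl_ideal.rel[of r "q * p" q'] by (simp add: mult.assoc)
qed (auto simp: distrib_left intro: weyl_ideal.intros)

lemma weyl_ideal_mult_right: "p \<in> weyl_ideal \<Longrightarrow> p * q \<in> weyl_ideal"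
proof (induction rule: weyl_ideal.induct)
  case (rel r p q')
  then show ?case using weyl_ideal.rel[of r p "q' * q"] by (simp add: mult.assoc)
qed (auto simp: distrib_right intro: weyl_ideal.intros)

lemma weyl_ideal_uminus: "p \<in> weyl_ideal \<Longrightarrow> - p \<in> weyl_ideal"
  using weyl_ideal_mult_left[of p "-1"] by simp

lemma weyl_ideal_diff: "p \<in> weyl_ideal \<Longrightarrow> q \<in> weyl_ideal \<Longrightarrow> p - q \<in> weyl_ideal"
  using weyl_ideal.add[of p "- q"] weyl_ideal_uminus[of q] by simp

text \<open>The action on \<open>R'\<close>: \<open>\<lambda>\<^sub>j\<close> multiplies, and \<open>\<partial>\<^sub>j\<close> acts as \<open>D\<^sub>j = \<partial>\<^sub>j + x\<^bsup>a(j)\<^esup>\<close>.\<close>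

fun gen_act :: "('v \<Rightarrow> int ^ 'n) \<Rightarrow> 'v weyl_gen \<Rightarrow> ('v, 'n::finite) laurent \<Rightarrow> ('v, 'n) laurent" where
  "gen_act a (Var j) r = lam j * r"
| "gen_act a (Der j) r = lpartial j r + xmon (a j) * r"

definition free_act :: "('v \<Rightarrow> int ^ 'n) \<Rightarrow> 'v free_weyl \<Rightarrow> ('v, 'n::finite) laurent \<Rightarrow> ('v, 'n) laurent"
  where "free_act a p r =
    (\<Sum>w\<in>Poly_Mapping.keys p. lconst (Poly_Mapping.lookup p w) * foldr (gen_act a) (letters w) r)"

lemma pm_induct [case_names zero add single]:
  assumes "P 0" "\<And>p q. P p \<Longrightarrow> P q \<Longrightarrow> P (p + q)" "\<And>k c. P (Poly_Mapping.single k c)"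
  shows "P (p :: 'a \<Rightarrow>\<^sub>0 'b::comm_monoid_add)"
proof -
  have "P (\<Sum>k\<in>K. Poly_Mapping.single k (Poly_Mapping.lookup p k))" if "finite K" for K
    using that by (induction K) (auto intro: assms)
  moreover have "(\<Sum>k\<in>Poly_Mapping.keys p. Poly_Mapping.single k (Poly_Mapping.lookup p k)) = p"
    by (rule poly_mapping_eqI)
      (simp add: lookup_sum lookup_single when_def in_keys_iff cong: if_cong)
  ultimately show ?thesis
    by (metis finite_keys)
qed

lemma lam_deriv_0 [simp]: "lam_deriv j 0 = 0"
  by (transfer; simp)

lemma lam_deriv_add: "lam_deriv j (p + q) = lam_deriv j p + lam_deriv j q"
  by (rule poly_mapping_eqI) (simp add: lam_deriv.rep_eq lookup_add algebra_simps)

lemma lpartial_add: "lpartial j (p + q) = lpartial j p + lpartial j q"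
  unfolding lpartial_def
  by (rule poly_mapping_eqI) (simp add: lookup_add Poly_Mapping.map.rep_eq when_def lam_deriv_add
      , metis add.right_neutral add_0 lam_deriv_0 lam_deriv_add)

lemma lpartial_0 [simp]: "lpartial j 0 = 0"
  unfolding lpartial_def
  by (rule poly_mapping_eqI) (simp add: Poly_Mapping.map.rep_eq)

lemma lpartial_single: "lpartial j (Poly_Mapping.single u p) = Poly_Mapping.single u (lam_deriv j p)"
  unfolding lpartial_def
  by (rule poly_mapping_eqI) (simp add: Poly_Mapping.map.rep_eq lookup_single when_def)

lemma lam_deriv_single:
  "lam_deriv j (Poly_Mapping.single u c) =
    Poly_Mapping.single (u - Poly_Mapping.single j 1) (of_nat (Poly_Mapping.lookup u j) * c)"
proof (rule poly_mapping_eqI)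
  fix v
  let ?e = "Poly_Mapping.single j (1::nat)"
  show "Poly_Mapping.lookup (lam_deriv j (Poly_Mapping.single u c)) v =
    Poly_Mapping.lookup (Poly_Mapping.single (u - ?e) (of_nat (Poly_Mapping.lookup u j) * c)) v"
  proof (cases "u = v + ?e")
    case True
    then show ?thesis by (simp add: lam_deriv.rep_eq lookup_add)
  next
    case False
    have "Poly_Mapping.lookup u j = 0" if "u - ?e = v"
    proof (rule ccontr)
      assume "Poly_Mapping.lookup u j \<noteq> 0"
      then have "u = (u - ?e) + ?e"
        by (intro poly_mapping_eqI) (auto simp: lookup_add lookup_minus lookup_single when_def)
      with that False show False by simp
    qed
    with False show ?thesis by (auto simp: lam_deriv.rep_eq lookup_single when_def)
  qed
qed

lemma lam_deriv_monom_mult: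
  "lam_deriv i (Poly_Mapping.single (Poly_Mapping.single j 1) 1 * p) =
    Poly_Mapping.single (Poly_Mapping.single j 1) 1 * lam_deriv i p + (if i = j then p else 0)"
proof (induction p rule: pm_induct)
  case zero
  then show ?case by simp
next
  case (add p q)
  then show ?case by (simp add: distrib_left lam_deriv_add algebra_simps)
next
  case (single u c)
  have eq: "Poly_Mapping.single j 1 + (u - Poly_Mapping.single i 1) =
      (Poly_Mapping.single j 1 + u) - Poly_Mapping.single i (1::nat)"
    if "Poly_Mapping.lookup u i \<noteq> 0"
    using that by (intro poly_mapping_eqI) (auto simp: lookup_add lookup_minus lookup_single when_def)
  show ?case
  proof (cases "i = j")
    case True
    show ?thesis
    proof (cases "Poly_Mapping.lookup u j = 0")
      case True
      with \<open>i = j\<close> show ?thesis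
        by (simp add: mult_single lam_deriv_single lookup_add)
    next
      case False
      with \<open>i = j\<close> eq show ?thesis
        by (simp add: mult_single lam_deriv_single lookup_add single_add[symmetric] algebra_simps)
    qed
  next
    case False
    then show ?thesis
      using eq
      by (cases "Poly_Mapping.lookup u i = 0")
        (simp_all add: mult_single lam_deriv_single lookup_add lookup_single)
  qed
qed

lemma lpartial_lam_mult:
  "lpartial i (lam j * r) = lam j * lpartial i r + (if i = j then r else 0)"
proof (induction r rule: pm_induct)
  case (single u c)
  show ?case unfolding lam_def
    by (simp add: mult_single lpartial_single lam_deriv_monom_mult[simplified] single_add)
qed (simp_all add: distrib_left lpartial_add algebra_simps)

lemma lam_deriv_const_mult:
  "lam_deriv i (Poly_Mapping.single 0 c * p) = Poly_Mapping.single 0 c * lam_deriv i p"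
  by (induction p rule: pm_induct)
    (simp_all add: distrib_left lam_deriv_add mult_single lam_deriv_single algebra_simps)

lemma lpartial_lconst_mult: "lpartial i (lconst c * r) = lconst c * lpartial i r"
  unfolding lconst_def
  by (induction r rule: pm_induct)
    (simp_all add: distrib_left lpartial_add mult_single lpartial_single lam_deriv_const_mult)

lemma lpartial_xmon_mult: "lpartial i (xmon u * r) = xmon u * lpartial i r"
  unfolding xmon_def
  by (induction r rule: pm_induct)
    (simp_all add: distrib_left lpartial_add mult_single lpartial_single)

lemma lam_deriv_commute: "lam_deriv i (lam_deriv j p) = lam_deriv j (lam_deriv i p)"
proof (cases "i = j")
  case False
  then show ?thesis
    by (intro poly_mapping_eqI)
      (simp add: lam_deriv.rep_eq lookup_add lookup_single ac_simps)
qed simp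

lemma lpartial_commute: "lpartial i (lpartial j r) = lpartial j (lpartial i r)"
  by (induction r rule: pm_induct)
    (simp_all add: lpartial_add lpartial_single lam_deriv_commute[of i j])

lemma gen_act_add: "gen_act a g (r + s) = gen_act a g r + gen_act a g s"
  by (cases g) (simp_all add: lpartial_add algebra_simps)

lemma gen_act_0 [simp]: "gen_act a g 0 = 0"
  by (cases g) simp_all

lemma gen_act_lconst: "gen_act a g (lconst c * r) = lconst c * gen_act a g r"
  by (cases g) (simp_all add: lpartial_lconst_mult distrib_left mult.left_commute)

lemma foldr_gen_act_add:
  "foldr (gen_act a) gs (r + s) = foldr (gen_act a) gs r + foldr (gen_act a) gs s"
  by (induction gs) (simp_all add: gen_act_add)

lemma foldr_gen_act_lconst:
  "foldr (gen_act a) gs (lconst c * r) = lconst c * foldr (gen_act a) gs r"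
  by (induction gs) (simp_all add: gen_act_lconst)

lemma foldr_gen_act_0 [simp]: "foldr (gen_act a) gs 0 = 0"
  by (induction gs) simp_all

lemma lconst_add: "lconst (c + d) = lconst c + lconst d"
  by (simp add: lconst_def single_add)

lemma lconst_mult: "lconst (c * d) = lconst c * lconst d"
  by (simp add: lconst_def mult_single)

lemma lconst_0 [simp]: "lconst 0 = 0"
  by (simp add: lconst_def)

lemma lconst_1 [simp]: "lconst 1 = 1"
  by (simp add: lconst_def)

lemma free_act_superset:
  assumes "finite K" "Poly_Mapping.keys p \<subseteq> K"
  shows "free_act a p r = (\<Sum>w\<in>K. lconst (Poly_Mapping.lookup p w) * foldr (gen_act a) (letters w) r)"
  unfolding free_act_def using assms
  by (intro sum.mono_neutral_left) (auto simp: in_keys_iff)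

lemma free_act_add_left: "free_act a (p + q) r = free_act a p r + free_act a q r"
proof -
  let ?K = "Poly_Mapping.keys p \<union> Poly_Mapping.keys q"
  have "Poly_Mapping.keys (p + q) \<subseteq> ?K" by (rule Poly_Mapping.keys_add)
  then show ?thesis
    by (simp add: free_act_superset[of ?K] lookup_add lconst_add distrib_right sum.distrib)
qed

lemma free_act_0_left [simp]: "free_act a 0 r = 0"
  by (simp add: free_act_def)

lemma free_act_single:
  "free_act a (Poly_Mapping.single w c) r = lconst c * foldr (gen_act a) (letters w) r"
  by (subst free_act_superset[of "{w}"]) auto

lemma free_act_add_right: "free_act a p (r + s) = free_act a p r + free_act a p s"
  by (simp add: free_act_def foldr_gen_act_add distrib_left sum.distrib)

lemma free_act_0_right [simp]: "free_act a p 0 = 0"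
  by (simp add: free_act_def)

lemma free_act_mult: "free_act a (p * q) r = free_act a p (free_act a q r)"
proof (induction p rule: pm_induct)
  case (single v c)
  show ?case
    by (induction q rule: pm_induct)
      (simp_all add: distrib_left free_act_add_left free_act_add_right mult_single free_act_single
        plus_free_monoid_def foldr_gen_act_lconst lconst_mult mult.assoc)
qed (simp_all add: distrib_right free_act_add_left)

lemma free_act_1 [simp]: "free_act a 1 r = r"
  using free_act_single[of a 0 1 r] unfolding single_one by (simp add: zero_free_monoid_def)

lemma free_act_uminus_left: "free_act a (- p) r = - free_act a p r"
  using free_act_add_left[of a p "- p" r] by (simp add: eq_neg_iff_add_eq_0 add.commute)

lemma free_act_diff_left: "free_act a (p - q) r = free_act a p r - free_act a q r"
  using free_act_add_left[of a p "- q" r] by (simp add: free_act_uminus_left)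

lemma free_act_fgen: "free_act a (fgen g) r = gen_act a g r"
  by (simp add: fgen_def free_act_single)

lemma free_act_weyl_rels: "p \<in> weyl_rels \<Longrightarrow> free_act a p r = 0"
proof (induction rule: weyl_rels.induct)
  case (2 i j)
  show ?case
    by (simp add: free_act_diff_left free_act_mult free_act_fgen lpartial_add distrib_left
        lpartial_xmon_mult lpartial_commute[of i j] mult.left_commute[of "xmon (a i)"])
next
  case (3 i j)
  show ?case
    by (cases "i = j")
      (simp_all add: free_act_diff_left free_act_mult free_act_fgen lpartial_lam_mult distrib_left
        mult.left_commute)
qed (simp add: free_act_diff_left free_act_mult free_act_fgen mult.left_commute)

lemma free_act_weyl_ideal: "p \<in> weyl_ideal \<Longrightarrow> free_act a p r = 0"
  by (induction rule: weyl_ideal.induct)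
    (simp_all add: free_act_add_left free_act_mult free_act_weyl_rels)

quotient_type 'v weyl = "'v free_weyl" / "\<lambda>p q. p - q \<in> weyl_ideal"
proof (rule equivpI)
  show "reflp (\<lambda>p q :: 'v free_weyl. p - q \<in> weyl_ideal)"
    by (simp add: reflp_def weyl_ideal.zero)
  show "symp (\<lambda>p q :: 'v free_weyl. p - q \<in> weyl_ideal)"
    unfolding symp_def using weyl_ideal_uminus by fastforce
  show "transp (\<lambda>p q :: 'v free_weyl. p - q \<in> weyl_ideal)"
    unfolding transp_def using weyl_ideal.add by fastforce
qed

instantiation weyl :: (type) ring_1
begin

lift_definition zero_weyl :: "'a weyl" is 0 .
lift_definition one_weyl :: "'a weyl" is 1 .
lift_definition plus_weyl :: "'a weyl \<Rightarrow> 'a weyl \<Rightarrow> 'a weyl" is "(+)"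
  by (metis add_diff_add weyl_ideal.add)
lift_definition uminus_weyl :: "'a weyl \<Rightarrow> 'a weyl" is uminus
  by (metis minus_diff_minus weyl_ideal_uminus)
lift_definition minus_weyl :: "'a weyl \<Rightarrow> 'a weyl \<Rightarrow> 'a weyl" is "(-)"
proof -
  fix p p' q q' :: "'a free_weyl"
  assume "p - p' \<in> weyl_ideal" "q - q' \<in> weyl_ideal"
  from weyl_ideal_diff[OF this] show "p - q - (p' - q') \<in> weyl_ideal"
    by (simp add: algebra_simps)
qed
lift_definition times_weyl :: "'a weyl \<Rightarrow> 'a weyl \<Rightarrow> 'a weyl" is "(*)"
proof -
  fix p p' q q' :: "'a free_weyl"
  assume "p - p' \<in> weyl_ideal" "q - q' \<in> weyl_ideal"
  then have "(p - p') * q + p' * (q - q') \<in> weyl_ideal"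
    by (intro weyl_ideal.add weyl_ideal_mult_left weyl_ideal_mult_right)
  then show "p * q - p' * q' \<in> weyl_ideal"
    by (simp add: algebra_simps)
qed

instance
proof
  have "(0 :: 'a free_weyl) - 1 \<notin> weyl_ideal"
  proof
    assume "(0 :: 'a free_weyl) - 1 \<in> weyl_ideal"
    then have "(1 :: 'a free_weyl) \<in> weyl_ideal"
      using weyl_ideal_uminus by fastforce
    from free_act_weyl_ideal[OF this, of "\<lambda>_. 0 :: int ^ 1" 1] show False
      by simp
  qed
  then show "(0 :: 'a weyl) \<noteq> 1"
    by transfer
qed (transfer; simp add: algebra_simps weyl_ideal.zero)+

end

lift_definition weyl_const :: "complex \<Rightarrow> 'v weyl" is "Poly_Mapping.single 0" .
lift_definition weyl_lam :: "'v \<Rightarrow> 'v weyl" is "\<lambda>j. fgen (Var j)" .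
lift_definition weyl_del :: "'v \<Rightarrow> 'v weyl" is "\<lambda>j. fgen (Der j)" .

lift_definition weyl_act ::
    "('v \<Rightarrow> int ^ 'n) \<Rightarrow> 'v weyl \<Rightarrow> ('v, 'n::finite) laurent \<Rightarrow> ('v, 'n) laurent" is free_act
proof
  fix a :: "'v \<Rightarrow> int ^ 'n" and p q :: "'v free_weyl" and r :: "('v, 'n) laurent"
  assume "p - q \<in> weyl_ideal"
  from free_act_weyl_ideal[OF this, of a r] show "free_act a p r = free_act a q r"
    by (simp add: free_act_diff_left)
qed

lemma weyl_act_simps:
  "weyl_act a (P + Q) r = weyl_act a P r + weyl_act a Q r"
  "weyl_act a P (r + s) = weyl_act a P r + weyl_act a P s"
  "weyl_act a (P * Q) r = weyl_act a P (weyl_act a Q r)"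
  "weyl_act a 1 r = r"
  "weyl_act a (weyl_const c) r = lconst c * r"
  "weyl_act a (weyl_lam j) r = lam j * r"
  "weyl_act a (weyl_del j) r = lpartial j r + xmon (a j) * r"
  by (transfer; simp add: free_act_add_left free_act_add_right free_act_mult free_act_fgen
      free_act_single zero_free_monoid_def)+


section \<open>Left modules and subquotients\<close>

text \<open>The locale \<^locale>\<open>module\<close> of HOL-Algebra requires a commutative ring of scalars.\<close>

locale left_module = abelian_group M for M :: "('r::ring_1, 'm) module" (structure) +
  assumes smult_closed: "x \<in> carrier M \<Longrightarrow> r \<odot>\<^bsub>M\<^esub> x \<in> carrier M"
    and smult_l_distr: "x \<in> carrier M \<Longrightarrow> (r + s) \<odot>\<^bsub>M\<^esub> x = r \<odot>\<^bsub>M\<^esub> x \<oplus>\<^bsub>M\<^esub> s \<odot>\<^bsub>M\<^esub> x"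
    and smult_r_distr: "x \<in> carrier M \<Longrightarrow> y \<in> carrier M \<Longrightarrow>
          r \<odot>\<^bsub>M\<^esub> (x \<oplus>\<^bsub>M\<^esub> y) = r \<odot>\<^bsub>M\<^esub> x \<oplus>\<^bsub>M\<^esub> r \<odot>\<^bsub>M\<^esub> y"
    and smult_assoc: "x \<in> carrier M \<Longrightarrow> (r * s) \<odot>\<^bsub>M\<^esub> x = r \<odot>\<^bsub>M\<^esub> (s \<odot>\<^bsub>M\<^esub> x)"
    and smult_one: "x \<in> carrier M \<Longrightarrow> 1 \<odot>\<^bsub>M\<^esub> x = x"

definition left_module_iso ::
    "('r::ring_1, 'm) module \<Rightarrow> ('r, 'k) module \<Rightarrow> ('m \<Rightarrow> 'k) \<Rightarrow> bool"
  where "left_module_iso M N h \<longleftrightarrow>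
    left_module M \<and> left_module N \<and> bij_betw h (carrier M) (carrier N) \<and>
    (\<forall>x\<in>carrier M. \<forall>y\<in>carrier M. h (x \<oplus>\<^bsub>M\<^esub> y) = h x \<oplus>\<^bsub>N\<^esub> h y) \<and>
    (\<forall>r. \<forall>x\<in>carrier M. h (r \<odot>\<^bsub>M\<^esub> x) = r \<odot>\<^bsub>N\<^esub> h x)"

text \<open>The quotient \<open>Z/B\<close>, with cosets as elements; the fields \<open>mult\<close> and \<open>one\<close>
  of the record play no role for modules.\<close>

definition subquotient ::
    "('r \<Rightarrow> 'v::ab_group_add \<Rightarrow> 'v) \<Rightarrow> 'v set \<Rightarrow> 'v set \<Rightarrow> ('r, 'v set) module"
  where "subquotient act Z B =
    \<lparr>carrier = (\<lambda>v. (+) v ` B) ` Z, mult = undefined, one = undefined, zero = B,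
     add = (\<lambda>X Y. {x + y | x y. x \<in> X \<and> y \<in> Y}),
     smult = (\<lambda>r X. {act r x + b | x b. x \<in> X \<and> b \<in> B})\<rparr>"

lemma left_module_subquotient:
  fixes act :: "'r::ring_1 \<Rightarrow> 'v::ab_group_add \<Rightarrow> 'v"
  assumes act: "\<And>r s v. act (r + s) v = act r v + act s v" "\<And>r v w. act r (v + w) = act r v + act r w"
      "\<And>r s v. act (r * s) v = act r (act s v)" "\<And>v. act 1 v = v"
    and Z: "\<And>r v w. v \<in> Z \<Longrightarrow> w \<in> Z \<Longrightarrow> v + w \<in> Z" "\<And>r v. v \<in> Z \<Longrightarrow> act r v \<in> Z"
    and B: "0 \<in> B" "\<And>r v w. v \<in> B \<Longrightarrow> w \<in> B \<Longrightarrow> v + w \<in> B" "\<And>r v. v \<in> B \<Longrightarrow> act r v \<in> B"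
    and "B \<subseteq> Z"
  shows "left_module (subquotient act Z B)"
proof -
  let ?c = "\<lambda>v. (+) v ` B"
  have act0: "act 0 v = 0" for v
    using act(1)[of 0 0 v] by simp
  have actm: "act (-1) v = - v" for v
    using act(1)[of 1 "-1" v] act0 by (simp add: act(4) eq_neg_iff_add_eq_0 add.commute)
  have minus: "- v \<in> Z" if "v \<in> Z" for v using Z(2)[OF that, of "-1"] by (simp add: actm)
  have zero: "0 \<in> Z" using B(1) \<open>B \<subseteq> Z\<close> by blast
  have sum: "{x + y | x y. x \<in> ?c v \<and> y \<in> ?c w} = ?c (v + w)" for v w
  proof (intro equalityI subsetI)
    fix z assume "z \<in> {x + y | x y. x \<in> ?c v \<and> y \<in> ?c w}"
    then obtain b b' where "b \<in> B" "b' \<in> B" "z = (v + b) + (w + b')" by blast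
    then show "z \<in> ?c (v + w)"
      using B(2) by (intro image_eqI[of _ _ "b + b'"]) (auto simp: algebra_simps)
  next
    fix z assume "z \<in> ?c (v + w)"
    then obtain b where "b \<in> B" "z = (v + b) + (w + 0)" by (auto simp: algebra_simps)
    then show "z \<in> {x + y | x y. x \<in> ?c v \<and> y \<in> ?c w}" using B(1) by blast
  qed
  have smul: "{act r x + b | x b. x \<in> ?c v \<and> b \<in> B} = ?c (act r v)" for r v
  proof (intro equalityI subsetI)
    fix z assume "z \<in> {act r x + b | x b. x \<in> ?c v \<and> b \<in> B}"
    then obtain b b' where "b \<in> B" "b' \<in> B" "z = act r (v + b) + b'" by blast
    then show "z \<in> ?c (act r v)"
      using B(2,3) by (intro image_eqI[of _ _ "act r b + b'"]) (auto simp: act algebra_simps)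
  next
    fix z assume "z \<in> ?c (act r v)"
    then obtain b where "b \<in> B" "z = act r (v + 0) + b" by auto
    then show "z \<in> {act r x + b | x b. x \<in> ?c v \<and> b \<in> B}" using B(1) by blast
  qed
  have c0: "?c 0 = B" by simp
  have sub: "carrier (subquotient act Z B) = ?c ` Z" "\<zero>\<^bsub>subquotient act Z B\<^esub> = ?c 0"
    "?c v \<oplus>\<^bsub>subquotient act Z B\<^esub> ?c w = ?c (v + w)"
    "r \<odot>\<^bsub>subquotient act Z B\<^esub> ?c v = ?c (act r v)" for v w r
    by (simp_all only: subquotient_def partial_object.simps ring.simps module.simps monoid.simps
        sum smul c0)
  have ag: "abelian_group (subquotient act Z B)"
  proof (rule abelian_groupI)
    fix x assume "x \<in> carrier (subquotient act Z B)"
    then obtain v where "x = ?c v" "v \<in> Z" by (auto simp: sub)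
    then show "\<exists>y\<in>carrier (subquotient act Z B). y \<oplus>\<^bsub>subquotient act Z B\<^esub> x = \<zero>\<^bsub>subquotient act Z B\<^esub>"
      using minus by (intro bexI[of _ "?c (- v)"]) (auto simp only: sub left_minus)
  next
    fix x y assume "x \<in> carrier (subquotient act Z B)" "y \<in> carrier (subquotient act Z B)"
    then show "x \<oplus>\<^bsub>subquotient act Z B\<^esub> y \<in> carrier (subquotient act Z B)"
      by (force simp only: sub image_iff intro: Z)
  qed (use zero in \<open>auto simp only: sub image_iff add_0_left add_0_right ac_simps\<close>)
  interpret abelian_group "subquotient act Z B" by (rule ag)
  show ?thesis
    by unfold_locales (auto simp only: sub image_iff act, blast intro: Z(2))
qed


section \<open>The hypergeometric module\<close>

text \<open>The order of the indices only serves to write down products in the noncommutative ring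
  \<^typ>\<open>'v weyl\<close>; the factors \<open>\<partial>\<^sub>j\<close> commute.\<close>

definition del_monom :: "('v::{finite,linorder} \<Rightarrow> nat) \<Rightarrow> 'v weyl"
  where "del_monom u = prod_list (map (\<lambda>j. weyl_del j ^ u j) (sorted_list_of_set UNIV))"

definition relation_lattice :: "('v::finite \<Rightarrow> int ^ 'n) \<Rightarrow> ('v \<Rightarrow> int) set"
  where "relation_lattice a = {l. (\<Sum>j\<in>UNIV. l j *s a j) = 0}"

text \<open>\<open>nat\<close> sends negative integers to \<open>0\<close>, so only the factors with \<open>l\<^sub>j > 0\<close>,
  respectively \<open>l\<^sub>j < 0\<close>, remain.\<close>

definition box_op :: "('v::{finite,linorder} \<Rightarrow> int) \<Rightarrow> 'v weyl"
  where "box_op l = del_monom (\<lambda>j. nat (l j)) - del_monom (\<lambda>j. nat (- l j))"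

definition euler_op :: "('v::finite \<Rightarrow> int ^ 'n) \<Rightarrow> complex ^ 'n \<Rightarrow> 'n \<Rightarrow> 'v weyl"
  where "euler_op a \<alpha> i =
    (\<Sum>j\<in>UNIV. of_int (a j $ i) * weyl_lam j * weyl_del j) - weyl_const (\<alpha> $ i)"

definition left_ideal :: "'r::ring_1 set \<Rightarrow> 'r set"
  where "left_ideal S = {\<Sum>s\<in>F. p s * s | F p. finite F \<and> F \<subseteq> S}"

definition hypergeometric_module ::
    "('v::{finite,linorder} \<Rightarrow> int ^ 'n::finite) \<Rightarrow> complex ^ 'n \<Rightarrow> ('v weyl, 'v weyl set) module"
  where "hypergeometric_module a \<alpha> =
    subquotient (*) UNIV (left_ideal (box_op ` relation_lattice a \<union> range (euler_op a \<alpha>)))"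


section \<open>The twisted relative de Rham complex\<close>

text \<open>A form is the vector of its coefficients with respect to the basis
  \<open>dlog x\<^sub>I = dx\<^bsub>i1\<^esub>/x\<^bsub>i1\<^esub> \<and> \<dots> \<and> dx\<^bsub>ik\<^esub>/x\<^bsub>ik\<^esub>\<close>, \<open>I = {i1 < \<dots> < ik}\<close>.\<close>

type_synonym ('v, 'n) form = "('v, 'n) laurent ^ ('n set)"

definition forms :: "nat \<Rightarrow> ('v, 'n::finite) form set"
  where "forms k = {\<omega>. \<forall>I. card I \<noteq> k \<longrightarrow> \<omega> $ I = 0}"

text \<open>\<open>dlog x\<^sub>I \<and> dlog x\<^sub>J = shuffle_sign I J \<cdot> dlog x\<^bsub>I \<union> J\<^esub>\<close> for disjoint \<open>I\<close> and \<open>J\<close>.\<close>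

definition shuffle_sign :: "'n::linorder set \<Rightarrow> 'n set \<Rightarrow> 'a::ring_1"
  where "shuffle_sign I J = (-1) ^ card {(i, j). i \<in> I \<and> j \<in> J \<and> j < i}"

definition wedge ::
    "('v, 'n::{finite,linorder}) form \<Rightarrow> ('v, 'n) form \<Rightarrow> ('v, 'n) form" (infixr \<open>\<and>\<^sub>F\<close> 75)
  where "\<omega> \<and>\<^sub>F \<eta> = (\<chi> K. \<Sum>I\<in>Pow K. shuffle_sign I (K - I) * \<omega> $ I * \<eta> $ (K - I))"

definition dlog :: "'n::finite \<Rightarrow> ('v, 'n) form"
  where "dlog i = axis {i} 1"

text \<open>The relative differential of a function: \<open>dr = \<Sum>\<^sub>i \<partial>r/\<partial>x\<^sub>i dx\<^sub>i = \<Sum>\<^sub>i (x\<^sub>i \<partial>r/\<partial>x\<^sub>i) dx\<^sub>i/x\<^sub>i\<close>.\<close>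

definition dfun :: "('v, 'n::finite) laurent \<Rightarrow> ('v, 'n) form"
  where "dfun r = (\<Sum>i\<in>UNIV. xeuler i r *s dlog i)"

text \<open>The basis forms are closed, so \<open>d (\<Sum>\<^sub>I \<omega>\<^sub>I dlog x\<^sub>I) = \<Sum>\<^sub>I d\<omega>\<^sub>I \<and> dlog x\<^sub>I\<close>.\<close>

definition ext_deriv :: "('v, 'n::{finite,linorder}) form \<Rightarrow> ('v, 'n) form"
  where "ext_deriv \<omega> = (\<Sum>I\<in>UNIV. dfun (\<omega> $ I) \<and>\<^sub>F axis I 1)"

definition nabla ::
    "('v::finite \<Rightarrow> int ^ 'n::{finite,linorder}) \<Rightarrow> complex ^ 'n::{finite,linorder} \<Rightarrow> ('v, 'n) form \<Rightarrow> ('v, 'n) form"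
  where "nabla a \<alpha> \<omega> =
    ext_deriv \<omega> + (\<Sum>i\<in>UNIV. lconst (\<alpha> $ i) *s (dlog i \<and>\<^sub>F \<omega>)) + dfun (fpoly a) \<and>\<^sub>F \<omega>"

definition form_act ::
    "('v \<Rightarrow> int ^ 'n) \<Rightarrow> 'v weyl \<Rightarrow> ('v, 'n::finite) form \<Rightarrow> ('v, 'n) form"
  where "form_act a P \<omega> = (\<chi> I. weyl_act a P (\<omega> $ I))"

definition cocycles ::
    "('v::finite \<Rightarrow> int ^ 'n::{finite,linorder}) \<Rightarrow> complex ^ 'n::{finite,linorder} \<Rightarrow> nat \<Rightarrow> ('v, 'n) form set"
  where "cocycles a \<alpha> k = {\<omega> \<in> forms k. nabla a \<alpha> \<omega> = 0}"

definition coboundaries ::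
    "('v::finite \<Rightarrow> int ^ 'n::{finite,linorder}) \<Rightarrow> complex ^ 'n::{finite,linorder} \<Rightarrow> nat \<Rightarrow> ('v, 'n) form set"
  where "coboundaries a \<alpha> k = (if k = 0 then {0} else nabla a \<alpha> ` forms (k - 1))"

definition cohomology ::
    "('v::finite \<Rightarrow> int ^ 'n::{finite,linorder}) \<Rightarrow> complex ^ 'n::{finite,linorder} \<Rightarrow> nat
      \<Rightarrow> ('v weyl, ('v, 'n) form set) module"
  where "cohomology a \<alpha> k = subquotient (form_act a) (cocycles a \<alpha> k) (coboundaries a \<alpha> k)"


section \<open>Both sides are left modules over the Weyl algebra\<close>

text \<open>The coefficient operators \<open>x\<^sub>i \<partial>/\<partial>x\<^sub>i + \<alpha>\<^sub>i + x\<^sub>i \<partial>f/\<partial>x\<^sub>i\<close>, out of which \<open>\<nabla>\<^sub>\<alpha>\<close> is built.\<close>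

definition nabla_comp ::
    "('v::finite \<Rightarrow> int ^ 'n::finite) \<Rightarrow> complex ^ 'n::finite \<Rightarrow> 'n \<Rightarrow> ('v, 'n) laurent \<Rightarrow> ('v, 'n) laurent"
  where "nabla_comp a \<alpha> i r = xeuler i r + lconst (\<alpha> $ i) * r + xeuler i (fpoly a) * r"

lemma wedge_add_left: "(\<omega> + \<omega>') \<and>\<^sub>F \<eta> = \<omega> \<and>\<^sub>F \<eta> + \<omega>' \<and>\<^sub>F \<eta>"
  by (vector wedge_def algebra_simps sum.distrib)

lemma wedge_scale_left: "(r *s \<omega>) \<and>\<^sub>F \<eta> = r *s (\<omega> \<and>\<^sub>F \<eta>)"
  by (vector wedge_def sum_distrib_left ac_simps)

lemma wedge_0_left: "0 \<and>\<^sub>F \<eta> = 0"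
  by (vector wedge_def)

lemma wedge_sum_left: "(\<Sum>i\<in>I. f i) \<and>\<^sub>F \<eta> = (\<Sum>i\<in>I. f i \<and>\<^sub>F \<eta>)"
  by (induction I rule: infinite_finite_induct) (simp_all add: wedge_add_left wedge_0_left)

lemma dlog_wedge:
  "(dlog i \<and>\<^sub>F \<omega>) $ K = (if i \<in> K then shuffle_sign {i} (K - {i}) * \<omega> $ (K - {i}) else 0)"
proof -
  have "(dlog i \<and>\<^sub>F \<omega>) $ K = (\<Sum>I\<in>Pow K. if I = {i} then shuffle_sign {i} (K - {i}) * \<omega> $ (K - {i}) else 0)"
    unfolding wedge_def dlog_def vec_lambda_beta by (rule sum.cong) (auto simp: axis_def)
  then show ?thesis by (simp add: sum.delta)
qed

lemma xeuler_add: "xeuler i (r + s) = xeuler i r + xeuler i s"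
  unfolding xeuler_def
  by (rule poly_mapping_eqI)
   (simp add: lookup_add lookup_mapp when_def in_keys_iff distrib_left,
    metis distrib_left mult_zero_right)

lemma xeuler_single: "xeuler i (Poly_Mapping.single u c) = Poly_Mapping.single u (of_int (u $ i) * c)"
  unfolding xeuler_def
  by (rule poly_mapping_eqI) (auto simp: lookup_mapp when_def in_keys_iff lookup_single)

lemma xeuler_0[simp]: "xeuler i 0 = 0"
  by (rule poly_mapping_eqI) (auto simp: xeuler_def lookup_mapp)

lemma xeuler_mult: "xeuler i (r * s) = xeuler i r * s + r * xeuler i s"
proof (induction r rule: pm_induct)
  case (single u c)
  show ?case
    by (induction s rule: pm_induct)
     (simp_all add: xeuler_single mult_single xeuler_add single_add[symmetric] algebra_simps)
qed (simp_all add: distrib_right xeuler_add)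

lemma nabla_alt: fixes a :: "'v::finite \<Rightarrow> int ^ 'n::{finite,linorder}"
  shows "nabla a \<alpha> \<omega> = (\<Sum>i\<in>UNIV. dlog i \<and>\<^sub>F (\<chi> I. nabla_comp a \<alpha> i (\<omega> $ I)))"
proof -
  have 1: "dfun r \<and>\<^sub>F \<eta> = (\<Sum>i\<in>UNIV. xeuler i r *s (dlog i \<and>\<^sub>F \<eta>))" for r :: "('v::finite,'n::{finite,linorder}) laurent" and \<eta>
    by (simp add: dfun_def wedge_sum_left wedge_scale_left)
  have 2: "ext_deriv \<omega> = (\<Sum>i\<in>UNIV. dlog i \<and>\<^sub>F (\<chi> I. xeuler i (\<omega> $ I)))" 
  proof -
    have "(\<Sum>I\<in>UNIV. xeuler i (\<omega> $ I) *s (dlog i \<and>\<^sub>F axis I 1)) = dlog i \<and>\<^sub>F (\<chi> I. xeuler i (\<omega> $ I))" for i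
    proof (rule vec_eq_iff[THEN iffD2], rule allI)
      fix K
      have "(\<Sum>I\<in>UNIV. xeuler i (\<omega> $ I) *s (dlog i \<and>\<^sub>F axis I 1)) $ K =
        (\<Sum>I\<in>UNIV. if I = K - {i} then (if i \<in> K then shuffle_sign {i} (K - {i}) * xeuler i (\<omega> $ I) else 0) else 0)"
        by (simp add: dlog_wedge axis_def if_distrib[of "(*) _"] cong: if_cong)
      then show "(\<Sum>I\<in>UNIV. xeuler i (\<omega> $ I) *s (dlog i \<and>\<^sub>F axis I 1)) $ K = (dlog i \<and>\<^sub>F (\<chi> I. xeuler i (\<omega> $ I))) $ K"
        by (simp add: dlog_wedge)
    qed
    then show ?thesis unfolding ext_deriv_def 1 by (subst sum.swap) simp
  qed
  have 3: "dlog i \<and>\<^sub>F (\<chi> I. nabla_comp a \<alpha> i (\<omega> $ I)) = dlog i \<and>\<^sub>F (\<chi> I. xeuler i (\<omega> $ I))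
     + lconst (\<alpha> $ i) *s (dlog i \<and>\<^sub>F \<omega>) + xeuler i (fpoly a) *s (dlog i \<and>\<^sub>F \<omega>)" for i
    by (simp add: vec_eq_iff dlog_wedge nabla_comp_def algebra_simps)
  show ?thesis unfolding 3 by (simp add: nabla_def 1 2 sum.distrib)
qed

lemma weyl_gen_induct:
  assumes "\<And>c. P (weyl_const c)" "\<And>j. P (weyl_lam j)" "\<And>j. P (weyl_del j)"
    "\<And>p q. P p \<Longrightarrow> P q \<Longrightarrow> P (p + q)" "\<And>p q. P p \<Longrightarrow> P q \<Longrightarrow> P (p * q)"
  shows "P (p :: 'v weyl)"
proof -
  have abs_plus: "abs_weyl (p + q) = abs_weyl p + abs_weyl q" for p q :: "'v free_weyl"
    by (simp add: plus_weyl.abs_eq)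
  have abs_times: "abs_weyl (p * q) = abs_weyl p * abs_weyl q" for p q :: "'v free_weyl"
    by (simp add: times_weyl.abs_eq)
  have g: "P (abs_weyl (Poly_Mapping.single (Wd gs) c))" for gs and c :: complex
  proof (induction gs)
    case Nil
    show ?case using assms(1)[of c] by (simp add: weyl_const.abs_eq zero_free_monoid_def)
  next
    case (Cons g gs)
    have "Poly_Mapping.single (Wd (g # gs)) c = fgen g * Poly_Mapping.single (Wd gs) c"
      by (simp add: fgen_def mult_single plus_free_monoid_def)
    moreover have "P (abs_weyl (fgen g))"
      using assms(2,3) by (cases g) (simp_all add: weyl_lam.abs_eq weyl_del.abs_eq)
    ultimately show ?case using Cons assms(5) by (simp add: abs_times)
  qed
  have "P (abs_weyl q)" for q
  proof (induction q rule: pm_induct)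
    case zero
    show ?case using g[of "[]" 0] by simp
  next
    case (single k c)
    show ?case using g[of "letters k" c] by simp
  qed (simp add: abs_plus assms)
  then show ?thesis by (metis Quotient_abs_rep Quotient_weyl)
qed

lemma xeuler_lpartial: "xeuler i (lpartial j r) = lpartial j (xeuler i r)"
proof (induction r rule: pm_induct)
  case (single u c)
  have "of_int k * lam_deriv j c = lam_deriv j (of_int k * c)" for k
    by (metis lam_deriv_const_mult single_of_int)
  then show ?case by (simp add: xeuler_single lpartial_single)
qed (simp_all add: xeuler_add lpartial_add)

lemma xeuler_lam: "xeuler i (lam j) = 0" by (simp add: lam_def xeuler_single)

lemma xeuler_lconst: "xeuler i (lconst c) = 0" by (simp add: lconst_def xeuler_single)

lemma xeuler_xmon: "xeuler i (xmon u) = of_int (u $ i) * xmon u" 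
  by (simp add: xmon_def xeuler_single mult_single flip: single_of_int)

lemma xeuler_sum: "xeuler i (sum g A) = (\<Sum>x\<in>A. xeuler i (g x))"
  by (induction A rule: infinite_finite_induct) (simp_all add: xeuler_add)

lemma lpartial_sum: "lpartial i (sum g A) = (\<Sum>x\<in>A. lpartial i (g x))"
  by (induction A rule: infinite_finite_induct) (simp_all add: lpartial_add)

lemma xeuler_fpoly: "xeuler i (fpoly a) = (\<Sum>j\<in>UNIV. lam j * (of_int (a j $ i) * xmon (a j)))"
  by (simp add: fpoly_def xeuler_sum xeuler_mult xeuler_lam xeuler_xmon)

lemma lpartial_of_int_mult: fixes r :: "('v,'n::finite) laurent" shows "lpartial j (of_int k * r) = of_int k * lpartial j r"
proof -
  have "(of_int k :: ('v,'n) laurent) = lconst (of_int k)" by (simp add: lconst_def)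
  then show ?thesis by (simp add: lpartial_lconst_mult)
qed

lemma lpartial_xeuler_f: "lpartial j (xeuler i (fpoly a) * r) = xeuler i (fpoly a) * lpartial j r + of_int (a j $ i) * xmon (a j) * r"
  by (simp add: xeuler_fpoly sum_distrib_right lpartial_sum mult.assoc lpartial_lam_mult
    lpartial_of_int_mult lpartial_xmon_mult sum.distrib)

lemma nabla_comp_act: fixes a :: "'v::finite \<Rightarrow> int ^ 'n::{finite,linorder}"
  shows "nabla_comp a \<alpha> i (weyl_act a P r) = weyl_act a P (nabla_comp a \<alpha> i r)"
proof (induction P arbitrary: r rule: weyl_gen_induct)
  case (1 c)
  show ?case by (simp add: nabla_comp_def weyl_act_simps xeuler_mult xeuler_lconst algebra_simps)
next
  case (2 j)
  show ?case by (simp add: nabla_comp_def weyl_act_simps xeuler_mult xeuler_lam algebra_simps)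
next
  case (3 j)
  show ?case unfolding nabla_comp_def weyl_act_simps lpartial_add lpartial_xeuler_f lpartial_lconst_mult
    by (simp add: xeuler_mult xeuler_xmon xeuler_add xeuler_lpartial  algebra_simps)
next
  case (4 p q)
  have "nabla_comp a \<alpha> i (r + s) = nabla_comp a \<alpha> i r + nabla_comp a \<alpha> i s" for r s :: "('v::finite,'n::{finite,linorder}) laurent"
   by (simp add: nabla_comp_def xeuler_add algebra_simps)
  with 4 show ?case by (simp add: weyl_act_simps)
next
  case (5 p q)
  then show ?case by (simp add: weyl_act_simps)
qed

lemma weyl_act_0: "weyl_act a P 0 = 0"
  using weyl_act_simps(2)[of a P 0 0] by simp

lemma weyl_act_uminus: "weyl_act a P (- r) = - weyl_act a P r"
  using weyl_act_simps(2)[of a P r "- r"] by (simp add: weyl_act_0 add_eq_0_iff)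

lemma weyl_act_sgn: "weyl_act a P (shuffle_sign I J * r) = shuffle_sign I J * weyl_act a P r"
  by (auto simp: shuffle_sign_def minus_one_power_iff weyl_act_uminus)

lemma weyl_act_sum: "weyl_act a P (sum g A) = (\<Sum>x\<in>A. weyl_act a P (g x))"
  by (induction A rule: infinite_finite_induct) (simp_all add: weyl_act_0 weyl_act_simps)

lemma nabla_form_act: fixes a :: "'v::finite \<Rightarrow> int ^ 'n::{finite,linorder}"
  shows "nabla a \<alpha> (form_act a P \<omega>) = form_act a P (nabla a \<alpha> \<omega>)"
  by (simp add: vec_eq_iff nabla_alt form_act_def dlog_wedge nabla_comp_act weyl_act_sum weyl_act_sgn weyl_act_0
    if_distrib[of "weyl_act a P"] cong: if_cong)

lemma nabla_add: "nabla a \<alpha> (\<omega> + \<eta>) = nabla a \<alpha> \<omega> + nabla a \<alpha> \<eta>"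
  by (simp add: vec_eq_iff nabla_alt dlog_wedge nabla_comp_def xeuler_add algebra_simps flip: sum.distrib)
    (auto intro!: sum.cong simp: algebra_simps)

lemma nabla_forms: assumes "\<omega> \<in> forms k" shows "nabla a \<alpha> \<omega> \<in> forms (Suc k)"
proof -
  have "\<omega> $ (K - {i}) = 0" if "card K \<noteq> Suc k" "i \<in> K" for K i
  proof -
    have "card K = Suc (card (K - {i}))" using that by (intro card.remove) auto
    then show ?thesis using assms that by (auto simp: forms_def)
  qed
  then show ?thesis by (auto simp: forms_def nabla_alt dlog_wedge nabla_comp_def intro!: sum.neutral)
qed

lemma nabla_comp_commute: fixes a :: "'v::finite \<Rightarrow> int ^ 'n::{finite,linorder}"
  shows "nabla_comp a \<alpha> i (nabla_comp a \<alpha> j r) = nabla_comp a \<alpha> j (nabla_comp a \<alpha> i r)"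
proof -
  have "xeuler i (xeuler j r) = xeuler j (xeuler i r)" for r :: "('v::finite,'n::{finite,linorder}) laurent"
    by (induction r rule: pm_induct) (simp_all add: xeuler_add xeuler_single ac_simps)
  then show ?thesis 
   by (simp add: nabla_comp_def xeuler_add xeuler_mult xeuler_lconst algebra_simps)
qed

lemma nabla_nabla: fixes a :: "'v::finite \<Rightarrow> int ^ 'n::{finite,linorder}"
  shows "nabla a \<alpha> (nabla a \<alpha> \<omega>) = 0"
proof (rule vec_eq_iff[THEN iffD2], rule allI)
  fix K
  let ?n = "nabla_comp a \<alpha>"
  have n0: "?n i 0 = 0" for i by (simp add: nabla_comp_def)
  have nadd: "?n i (r + s) = ?n i r + ?n i s" for i r s by (simp add: nabla_comp_def xeuler_add algebra_simps)
  have nm: "?n i (- r) = - ?n i r" for i r using nadd[of i r "- r"] n0 by (simp add: add_eq_0_iff)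
  have nsgn: "?n i (shuffle_sign I J * r) = shuffle_sign I J * ?n i r" for i I J r
    by (auto simp: shuffle_sign_def minus_one_power_iff nm)
  have nsum: "?n i (sum g A) = (\<Sum>x\<in>A. ?n i (g x))" for i g and A :: "'x set"
    by (induction A rule: infinite_finite_induct) (simp_all add: n0 nadd)
  define T where "T i j = (if i \<in> K \<and> j \<in> K \<and> i \<noteq> j then
     shuffle_sign {i} (K - {i}) * shuffle_sign {j} (K - {i} - {j}) * ?n i (?n j (\<omega> $ (K - {i} - {j}))) else 0)" for i j
  have eq: "nabla a \<alpha> (nabla a \<alpha> \<omega>) $ K = (\<Sum>i\<in>UNIV. \<Sum>j\<in>UNIV. T i j)"
    unfolding T_def
    apply (simp add: nabla_alt dlog_wedge nsum nsgn n0 sum_distrib_left if_distrib[of "?n _"] cong: if_cong)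
    apply (rule sum.cong, simp)
    apply (auto simp: n0 sum_distrib_left mult.assoc intro!: sum.cong)
    done
  have anti: "T i j = - T j i" for i j
  proof (cases "i \<in> K \<and> j \<in> K \<and> i \<noteq> j")
    case True
    have sg: "(shuffle_sign {i} J :: ('v::finite,'n::{finite,linorder}) laurent) = (-1) ^ card {j\<in>J. j < i}" for i J
    proof -
      have "{(i', j). i' \<in> {i} \<and> j \<in> J \<and> j < i'} = Pair i ` {j\<in>J. j < i}" by auto
      then show ?thesis by (simp add: shuffle_sign_def card_image inj_on_def)
    qed
    have one: "(shuffle_sign {i} (K - {i}) * shuffle_sign {j} (K - {i} - {j}) :: ('v::finite,'n::{finite,linorder}) laurent) =
        - (shuffle_sign {j} (K - {j}) * shuffle_sign {i} (K - {j} - {i}))" if "i < j" "i \<in> K" "j \<in> K" for i j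
    proof -
      have a: "{k \<in> K - {i}. k < i} = {k \<in> K - {j} - {i}. k < i}" using that by auto
      have b: "{k \<in> K - {j}. k < j} = insert i {k \<in> K - {i} - {j}. k < j}" using that by auto
      show ?thesis unfolding sg a b by (subst card_insert_disjoint) (auto simp: ac_simps)
    qed
    have "i < j \<or> j < i" using True by auto
    with one[of i j] one[of j i] True have 
    "(shuffle_sign {i} (K - {i}) * shuffle_sign {j} (K - {i} - {j}) :: ('v::finite,'n::{finite,linorder}) laurent) =
        - (shuffle_sign {j} (K - {j}) * shuffle_sign {i} (K - {j} - {i}))" by auto
    moreover have "K - {i} - {j} = K - {j} - {i}" by auto
    ultimately show ?thesis using True by (auto simp add: T_def nabla_comp_commute[of a \<alpha> i j])
  qed (auto simp: T_def)
  have "(\<Sum>i\<in>UNIV. \<Sum>j\<in>UNIV. T i j) = - (\<Sum>i\<in>UNIV. \<Sum>j\<in>UNIV. T i j)"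
    by (subst (2) sum.swap) (simp add: sum_negf[symmetric] anti[symmetric])
  then have "(\<Sum>i\<in>UNIV. \<Sum>j\<in>UNIV. T i j) + (\<Sum>i\<in>UNIV. \<Sum>j\<in>UNIV. T i j) = 0" by (simp add: eq_neg_iff_add_eq_0)
  then have t: "2 * (\<Sum>i\<in>UNIV. \<Sum>j\<in>UNIV. T i j) = 0" by (simp only: mult_2)
  have l: "lconst (1/2) * (2 :: ('v,'n) laurent) = 1"
  proof -
    have "(2 :: ('v,'n) laurent) = lconst 2" by (metis lconst_add lconst_1 one_add_one)
    moreover have "lconst (1/2) * lconst 2 = (1 :: ('v,'n) laurent)" by (simp flip: lconst_mult)
    ultimately show ?thesis by (simp only:)
  qed
  have "(\<Sum>i\<in>UNIV. \<Sum>j\<in>UNIV. T i j) = lconst (1/2) * (2 * (\<Sum>i\<in>UNIV. \<Sum>j\<in>UNIV. T i j))"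
    by (simp only: mult.assoc[symmetric] l mult_1_left)
  then have "(\<Sum>i\<in>UNIV. \<Sum>j\<in>UNIV. T i j) = 0" by (simp only: t mult_zero_right)
  then show "nabla a \<alpha> (nabla a \<alpha> \<omega>) $ K = 0 $ K" using eq by simp
qed

lemma left_module_cohomology: fixes a :: "'v::finite \<Rightarrow> int ^ 'n::{finite,linorder}"
  shows "left_module (cohomology a \<alpha> k)"
proof -
  have f0: "form_act a P 0 = 0" for P by (simp add: form_act_def vec_eq_iff weyl_act_0)
  have n0: "nabla a \<alpha> 0 = 0" using nabla_add[of a \<alpha> 0 0] by simp
  have z: "(0::('v::finite,'n::{finite,linorder}) form) \<in> forms k" "v \<in> forms k \<Longrightarrow> w \<in> forms k \<Longrightarrow> v + w \<in> forms k"
   "v \<in> forms k \<Longrightarrow> form_act a P v \<in> forms k" for v w :: "('v::finite,'n::{finite,linorder}) form" and k P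
    by (auto simp: forms_def form_act_def weyl_act_0)
  show ?thesis unfolding cohomology_def
  proof (rule left_module_subquotient)
    show "coboundaries a \<alpha> k \<subseteq> cocycles a \<alpha> k"
      using nabla_forms[of _ "k - 1"] by (auto simp: coboundaries_def cocycles_def nabla_nabla n0 z)
    fix v w P assume v: "v \<in> coboundaries a \<alpha> k" 
    show "form_act a P v \<in> coboundaries a \<alpha> k" using v z(3) f0
       by (auto simp: coboundaries_def simp flip: nabla_form_act split: if_splits)
    assume w: "w \<in> coboundaries a \<alpha> k"
    show "v + w \<in> coboundaries a \<alpha> k" using v w z(2)
       by (auto simp: coboundaries_def simp flip: nabla_add split: if_splits)
  next
    show "0 \<in> coboundaries a \<alpha> k"
      using z(1)[of "k - 1"] n0 by (force simp: coboundaries_def)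
    show "v \<in> cocycles a \<alpha> k \<Longrightarrow> form_act a r v \<in> cocycles a \<alpha> k" for r v
      by (simp add: cocycles_def z nabla_form_act f0)
  qed (auto simp: form_act_def vec_eq_iff weyl_act_simps cocycles_def nabla_add z)
qed

lemma left_module_hyper: "left_module (hypergeometric_module a \<alpha>)"
proof -
  let ?S = "box_op ` relation_lattice a \<union> range (euler_op a \<alpha>)"
  show ?thesis unfolding hypergeometric_module_def
  proof (rule left_module_subquotient)
    show "0 \<in> left_ideal ?S" unfolding left_ideal_def by (intro CollectI exI[of _ "{}"]) auto
    fix v w r assume v: "v \<in> left_ideal ?S" 
    then obtain F p where F: "finite F" "F \<subseteq> ?S" "v = (\<Sum>s\<in>F. p s * s)" by (auto simp: left_ideal_def)
    then have "r * v = (\<Sum>s\<in>F. (r * p s) * s)" by (simp add: sum_distrib_left mult.assoc)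
    with F show "r * v \<in> left_ideal ?S" by (auto simp: left_ideal_def) 
    assume w: "w \<in> left_ideal ?S" 
    then obtain G q where G: "finite G" "G \<subseteq> ?S" "w = (\<Sum>s\<in>G. q s * s)" by (auto simp: left_ideal_def)
    have "v = (\<Sum>s\<in>F\<union>G. (if s\<in>F then p s else 0) * s)" "w = (\<Sum>s\<in>F\<union>G. (if s\<in>G then q s else 0) * s)"
      unfolding F G using F G by (auto intro!: sum.mono_neutral_cong_left)
    then have "v + w = (\<Sum>s\<in>F\<union>G. ((if s\<in>F then p s else 0) + (if s\<in>G then q s else 0)) * s)"
      by (simp add: sum.distrib distrib_right)
    then show "v + w \<in> left_ideal ?S" using F G unfolding left_ideal_def
      by (intro CollectI exI[of _ "F \<union> G"] exI conjI) auto
  qed (auto simp: algebra_simps)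
qed

lemma weyl_const_of_int: "of_int k = weyl_const (of_int k)"
proof -
  have a: "weyl_const (x + y) = weyl_const x + weyl_const y" for x y :: complex
    by (transfer; simp add: single_add weyl_ideal.zero)
  have o: "weyl_const 1 = 1" by (transfer; simp add: weyl_ideal.zero)
  have z: "weyl_const 0 = 0" by (transfer; simp add: weyl_ideal.zero)
  have m: "weyl_const (- x) = - weyl_const x" for x :: complex
    using a[of x "- x"] z by (metis add.right_inverse add_eq_0_iff)
  have n: "weyl_const (of_nat n) = of_nat n" for n by (induction n) (simp_all add: a o z)
  show ?thesis by (cases k rule: int_cases2) (simp_all add: m n)
qed

text \<open>The sign of the parameter: in the top cohomology of \<open>\<nabla>\<^sub>\<alpha>\<close> the Euler operator with
  parameter \<open>-\<alpha>\<close> (not \<open>\<alpha>\<close>) sends the class of \<open>dlog x\<^sub>1 \<and> \<dots> \<and> dlog x\<^sub>n\<close> to that of an exact form.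
  So \<open>\<M>\<^sub>\<alpha>\<close> corresponds to \<open>\<nabla>\<^bsub>-\<alpha>\<^esub>\<close>. With \<open>\<nabla>\<^sub>\<alpha>\<close> the two modules differ in general: for
  \<open>n = N = 1\<close>, \<open>a = 1\<close>, \<open>\<alpha> = 1/3\<close> the eigenvalues of \<open>\<lambda>\<partial>\<close> lie in \<open>1/3 + \<int>\<close> and \<open>-1/3 + \<int>\<close>.\<close>

lemma euler_sign: fixes a :: "'v::finite \<Rightarrow> int ^ 'n::{finite,linorder}"
  shows "weyl_act a (euler_op a (-\<alpha>) i) 1 = nabla_comp a \<alpha> i 1"
proof -
  have w0: "weyl_act a 0 r = 0" for r using weyl_act_simps(1)[of a 0 0 r] by simp
  have ws: "weyl_act a (sum g A) r = (\<Sum>x\<in>A. weyl_act a (g x) r)" for g r and A :: "'v set"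
    by (induction A rule: infinite_finite_induct) (simp_all add: weyl_act_simps w0)
  have wm: "weyl_act a (P - Q) r + weyl_act a Q r = weyl_act a P r" for P Q r
    by (simp flip: weyl_act_simps(1))
  have wm: "weyl_act a (P - Q) r = weyl_act a P r - weyl_act a Q r" for P Q r
    using wm[of P Q r] by (simp add: algebra_simps)
  have l1: "lpartial j 1 = 0" for j
    by (simp add: lpartial_single lam_deriv_single flip: single_one)
  have x1: "xeuler i 1 = 0" using xeuler_lconst[of i 1] by simp
  have lm: "lconst (- c) = - lconst c" for c :: complex by (simp add: lconst_def single_uminus)
  have li: "lconst (of_int k) = of_int k" for k by (simp add: lconst_def)
  show ?thesis
    by (simp add: euler_op_def wm ws weyl_act_simps weyl_const_of_int nabla_comp_def l1 x1 lm li xeuler_fpoly ac_simps)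
qed


section \<open>Nonresonance\<close>

definition real_cone :: "('v \<Rightarrow> int ^ 'n::finite) \<Rightarrow> (real ^ 'n) set"
  where "real_cone a = convex_cone hull (range (\<lambda>j. \<chi> i. of_int (a j $ i)))"

definition lin_form :: "int ^ 'n::finite \<Rightarrow> 'a::comm_ring_1 ^ 'n \<Rightarrow> 'a"
  where "lin_form l u = (\<Sum>i\<in>UNIV. of_int (l $ i) * u $ i)"

definition facet_form :: "('v \<Rightarrow> int ^ 'n::finite) \<Rightarrow> int ^ 'n \<Rightarrow> bool"
  where "facet_form a l \<longleftrightarrow>
    Gcd (range (($) l)) = 1 \<and>
    (\<forall>u\<in>real_cone a. lin_form l u \<ge> 0) \<and>
    {u \<in> real_cone a. lin_form l u = 0} facet_of real_cone a"

definition nonresonant :: "('v \<Rightarrow> int ^ 'n::finite) \<Rightarrow> complex ^ 'n \<Rightarrow> bool"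
  where "nonresonant a \<alpha> \<longleftrightarrow> (\<forall>l. facet_form a l \<longrightarrow> lin_form l \<alpha> \<notin> \<int>)"

end

theory Submission
  imports Defs
begin

text \<open>Let \<open>D\<^sub>i\<close> be the coefficient operators of \<open>\<nabla>\<close>, so that the top cohomology is
  \<open>R' / \<Sum> D\<^sub>i R'\<close>, and for a subset \<open>T\<close> of the lattice let \<open>R\<^sub>T\<close> be spanned by the \<open>x\<^sup>u\<close> with
  \<open>u \<in> T\<close>. Let \<open>S\<close> be the semigroup generated by \<open>A\<close>. The annihilator of \<open>1 \<in> R\<^sub>S\<close> in \<open>\<D>\<close> is
  generated by the box operators, and the Euler operators act on \<open>1\<close> as the \<open>D\<^sub>i\<close>, which commute
  with \<open>\<D>\<close>; so \<open>P \<mapsto> P \<cdot> 1\<close> identifies \<open>\<M>\<^sub>\<alpha>\<close> with \<open>R\<^sub>S / \<Sum> D\<^sub>i R\<^sub>S\<close>.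

  To pass from \<open>S\<close> to the whole lattice, enlarge \<open>S\<close> step by step to \<open>S\<close>-stable sets \<open>T\<close> without
  changing the quotient. If \<open>T\<close> is not everything, some translate \<open>u + S\<close> with \<open>u \<notin> T\<close> leaves \<open>T\<close>
  only in bounded distance from a facet with form \<open>\<ell>\<close>. On \<open>R\<^bsub>T \<union> (u + S)\<^esub> / R\<^sub>T\<close> the operator
  \<open>\<Sum> \<ell>\<^sub>i D\<^sub>i\<close> is triangular with respect to \<open>\<ell>\<close> with diagonal entries \<open>\<ell>(v) - \<ell>(\<alpha>)\<close>, which are nonzero by
  nonresonance. It is therefore invertible, and commutes with the \<open>D\<^sub>i\<close>, so the quotient complex is
  acyclic.\<close>

section \<open>The semigroup and its cone\<close>

definition ncomb :: "('v::finite \<Rightarrow> int ^ 'n) \<Rightarrow> ('v \<Rightarrow> nat) \<Rightarrow> int ^ 'n"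
  where "ncomb a v = (\<Sum>j\<in>UNIV. int (v j) *s a j)"

definition semigrp :: "('v::finite \<Rightarrow> int ^ 'n) \<Rightarrow> (int ^ 'n) set"
  where "semigrp a = range (ncomb a)"

lemma ncomb_add: "ncomb a (\<lambda>j. u j + v j) = ncomb a u + ncomb a v"
  by (simp add: ncomb_def vec_eq_iff sum.distrib algebra_simps)

lemma ncomb_zero: "ncomb a (\<lambda>_. 0) = 0"
  by (simp add: ncomb_def vec_eq_iff)

lemma ncomb_mult: "ncomb a (\<lambda>j. k * v j) = int k *s ncomb a v"
  by (simp add: ncomb_def vec_eq_iff sum_distrib_left algebra_simps)

lemma ncomb_indicator: "ncomb a (\<lambda>j. if j \<in> J then 1 else 0) = (\<Sum>j\<in>J. a j)"
proof -
  have "ncomb a (\<lambda>j. if j \<in> J then 1 else 0) = (\<Sum>j\<in>UNIV. if j \<in> J then a j else 0)"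
    unfolding ncomb_def by (intro sum.cong) (auto simp: vec_eq_iff)
  then show ?thesis
    by (simp add: sum.inter_restrict[symmetric])
qed

lemma ncomb_single: "ncomb a (\<lambda>j. if j = i then 1 else 0) = a i"
  using ncomb_indicator[of a "{i}"] by simp

lemma semigrp_zero: "0 \<in> semigrp a"
  unfolding semigrp_def by (rule range_eqI) (rule ncomb_zero[symmetric])

lemma semigrp_add: "u \<in> semigrp a \<Longrightarrow> v \<in> semigrp a \<Longrightarrow> u + v \<in> semigrp a"
  by (auto simp: semigrp_def simp flip: ncomb_add)

lemma semigrp_gen: "a i \<in> semigrp a"
  unfolding semigrp_def by (rule range_eqI) (rule ncomb_single[symmetric])

lemma semigrp_mult: "u \<in> semigrp a \<Longrightarrow> int k *s u \<in> semigrp a"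
  by (auto simp: semigrp_def simp flip: ncomb_mult)

lemma group_closure_int_comb:
  assumes "u \<in> group_closure (range a)"
  shows "\<exists>m :: 'v::finite \<Rightarrow> int. u = (\<Sum>j\<in>UNIV. m j *s (a j :: int ^ 'n))"
  using assms
proof (induction rule: group_closure.induct)
  case (base s)
  then consider "s = 0" | i where "s = a i"
    by auto
  then show ?case
  proof cases
    case 1
    then show ?thesis by (intro exI[of _ "\<lambda>_. 0"]) (simp add: vec_eq_iff)
  next
    case 2
    have "(\<Sum>j\<in>UNIV. (if j = i then 1 else 0) *s a j) = (\<Sum>j\<in>UNIV. if j = i then a j else 0)"
      by (intro sum.cong) (auto simp: vec_eq_iff)
    with 2 show ?thesis by (intro exI[of _ "\<lambda>j. if j = i then 1 else 0"]) simp
  qed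
next
  case (diff s t)
  then obtain m k where "s = (\<Sum>j\<in>UNIV. m j *s a j)" "t = (\<Sum>j\<in>UNIV. k j *s a j)"
    by blast
  then show ?case
    by (intro exI[of _ "\<lambda>j. m j - k j"])
      (simp add: vec_eq_iff sum_subtractf algebra_simps)
qed

text \<open>An integer combination of the generators becomes a nonnegative one once the sum of all
  generators has been added often enough. The claim covers all large \<open>k\<close>, so that one
  bound can serve finitely many vectors at once.\<close>

lemma translate_into_semigrp:
  fixes a :: "'v::finite \<Rightarrow> int ^ 'n"
  assumes "group_closure (range a) = UNIV"
  shows "\<exists>K. \<forall>k\<ge>K. u + int k *s (\<Sum>j\<in>UNIV. a j) \<in> semigrp a"
proof -
  obtain m :: "'v \<Rightarrow> int" where u: "u = (\<Sum>j\<in>UNIV. m j *s a j)"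
    using group_closure_int_comb[of u a] assms by auto
  have "u + int k *s (\<Sum>j\<in>UNIV. a j) \<in> semigrp a" if k: "k \<ge> nat (\<Sum>j\<in>UNIV. \<bar>m j\<bar>)" for k
  proof -
    have "m j + int k \<ge> 0" for j
    proof -
      have "\<bar>m j\<bar> \<le> (\<Sum>j\<in>UNIV. \<bar>m j\<bar>)"
        by (intro member_le_sum) auto
      with k show ?thesis by linarith
    qed
    then have "ncomb a (\<lambda>j. nat (m j + int k)) = u + int k *s (\<Sum>j\<in>UNIV. a j)"
      by (simp add: u ncomb_def vec_eq_iff sum_distrib_left sum.distrib algebra_simps)
    then show ?thesis
      unfolding semigrp_def by (intro range_eqI) (rule sym)
  qed
  then show ?thesis by blast
qed

lemma finite_bounded_int_vec: "finite {u :: int ^ 'n::finite. \<forall>i. \<bar>u $ i\<bar> \<le> B}"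
proof -
  have "{u :: int ^ 'n. \<forall>i. \<bar>u $ i\<bar> \<le> B} \<subseteq> vec_lambda ` (UNIV \<rightarrow>\<^sub>E {- B..B})"
  proof
    fix u :: "int ^ 'n" assume "u \<in> {u. \<forall>i. \<bar>u $ i\<bar> \<le> B}"
    then have "($) u \<in> UNIV \<rightarrow>\<^sub>E {- B..B}"
      by (auto simp: abs_le_iff minus_le_iff)
    then show "u \<in> vec_lambda ` (UNIV \<rightarrow>\<^sub>E {- B..B})"
      by (intro image_eqI[of u vec_lambda "($) u"]) (simp_all add: vec_nth_inverse)
  qed
  then show ?thesis
    by (rule finite_subset) (intro finite_imageI finite_PiE, auto)
qed

section \<open>The real cone and its lattice points\<close>

definition rvec :: "int ^ 'n \<Rightarrow> real ^ 'n"
  where "rvec u = (\<chi> i. of_int (u $ i))"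

lemma rvec_add: "rvec (u + v) = rvec u + rvec v"
  and rvec_scale: "rvec (k *s u) = of_int k *\<^sub>R rvec u"
  and rvec_zero: "rvec 0 = 0"
  by (simp_all add: rvec_def vec_eq_iff)

lemma rvec_sum: "rvec (sum f A) = (\<Sum>x\<in>A. rvec (f x))"
  by (induction A rule: infinite_finite_induct) (simp_all add: rvec_add rvec_zero)

lemma lin_form_rvec: "lin_form l (rvec u) = of_int (lin_form l u)"
  by (simp add: lin_form_def rvec_def)

lemma lin_form_inner: "lin_form l x = rvec l \<bullet> x"
  by (simp add: lin_form_def rvec_def inner_vec_def)

lemma real_cone_rvec: "real_cone a = convex_cone hull (range (\<lambda>j. rvec (a j)))"
  by (simp add: real_cone_def rvec_def)

lemma rvec_in_real_cone: "rvec (a j) \<in> real_cone a"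
  unfolding real_cone_rvec by (intro hull_inc) simp

lemma convex_cone_real_cone: "convex_cone (real_cone a)"
  unfolding real_cone_rvec by (rule convex_cone_convex_cone_hull)

lemma real_cone_comb:
  assumes "x \<in> real_cone a"
  obtains c :: "'v::finite \<Rightarrow> real" where "\<And>j. c j \<ge> 0" "x = (\<Sum>j\<in>UNIV. c j *\<^sub>R rvec (a j))"
proof -
  let ?S = "{\<Sum>j\<in>UNIV. c j *\<^sub>R rvec (a j) | c :: 'v \<Rightarrow> real. \<forall>j. c j \<ge> 0}"
  have "convex_cone hull (range (\<lambda>j. rvec (a j))) \<subseteq> ?S"
  proof (rule hull_minimal)
    have "rvec (a i) \<in> ?S" for i
    proof -
      have "(\<Sum>j\<in>UNIV. (if j = i then 1 else 0) *\<^sub>R rvec (a j)) = (\<Sum>j\<in>UNIV. if j = i then rvec (a j) else 0)"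
        by (intro sum.cong) auto
      then show ?thesis
        by (intro CollectI exI[of _ "\<lambda>j. if j = i then 1 else 0"]) simp
    qed
    then show "range (\<lambda>j. rvec (a j)) \<subseteq> ?S" by blast
    show "convex_cone ?S"
      unfolding convex_cone_iff
    proof (intro conjI ballI allI impI)
      show "0 \<in> ?S" by (intro CollectI exI[of _ "\<lambda>_. 0"]) simp
      fix x assume "x \<in> ?S"
      then obtain c where c: "\<forall>j. c j \<ge> 0" "x = (\<Sum>j\<in>UNIV. c j *\<^sub>R rvec (a j))" by blast
      show "t *\<^sub>R x \<in> ?S" if "t \<ge> 0" for t
        using c that by (intro CollectI exI[of _ "\<lambda>j. t * c j"]) (simp add: scaleR_sum_right)
      fix y assume "y \<in> ?S"
      then obtain d where d: "\<forall>j. d j \<ge> 0" "y = (\<Sum>j\<in>UNIV. d j *\<^sub>R rvec (a j))" by blast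
      show "x + y \<in> ?S"
        using c d by (intro CollectI exI[of _ "\<lambda>j. c j + d j"]) (simp add: scaleR_add_left sum.distrib)
    qed
  qed
  with assms that show ?thesis unfolding real_cone_rvec by blast
qed

lemma span_rvec:
  fixes a :: "'v::finite \<Rightarrow> int ^ 'n::finite"
  assumes "group_closure (range a) = UNIV"
  shows "span (range (\<lambda>j. rvec (a j))) = UNIV"
proof -
  let ?V = "span (range (\<lambda>j. rvec (a j)))"
  have V: "rvec u \<in> ?V" for u
  proof -
    obtain m :: "'v \<Rightarrow> int" where u: "u = (\<Sum>j\<in>UNIV. m j *s a j)"
      using group_closure_int_comb[of u a] assms by auto
    show ?thesis unfolding u rvec_sum rvec_scale
      by (intro span_sum span_scale span_base) auto
  qed
  have "axis i 1 \<in> ?V" for i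
    using V[of "axis i 1"] by (simp add: rvec_def axis_def if_distrib[of real_of_int] cong: if_cong)
  then have "(Basis :: (real ^ 'n) set) \<subseteq> ?V"
    by (auto simp: Basis_vec_def)
  then show ?thesis
    using span_minimal[of Basis ?V] by (simp add: span_Basis top.extremum_unique)
qed

text \<open>The semigroup may miss lattice points of its cone, but the defect stays bounded along
  the multiples of \<open>u\<close>: one \<open>K\<close> works for every \<open>k\<close>, so
  \<open>k\<close> can be chosen after \<open>K\<close>.\<close>

lemma semigrp_of_cone:
  fixes a :: "'v::finite \<Rightarrow> int ^ 'n::finite"
  assumes gen: "group_closure (range a) = UNIV" and u: "rvec u \<in> real_cone a"
  shows "\<exists>K. \<forall>k. int k *s u + int K *s (\<Sum>j\<in>UNIV. a j) \<in> semigrp a"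
proof -
  obtain c where c: "\<And>j. c j \<ge> 0" and uc: "rvec u = (\<Sum>j\<in>UNIV. c j *\<^sub>R rvec (a j))"
    using real_cone_comb[OF u] by blast
  \<comment> \<open>After rounding down the coefficients of \<open>k u\<close>, only finitely many remainders occur.\<close>
  define v where "v k j = nat \<lfloor>real k * c j\<rfloor>" for k j
  \<comment> \<open>Bounds the coordinates of every combination of generators with coefficients of
    absolute value at most 1, and the remainders are such combinations.\<close>
  define B where "B = (\<Sum>i\<in>UNIV. \<Sum>j\<in>UNIV. \<bar>a j $ i\<bar>)"
  define R where "R = {u :: int ^ 'n. \<forall>i. \<bar>u $ i\<bar> \<le> B}"
  have "finite R" unfolding R_def by (rule finite_bounded_int_vec)
  obtain L where L: "\<And>r k. k \<ge> L r \<Longrightarrow> r + int k *s (\<Sum>j\<in>UNIV. a j) \<in> semigrp a"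
    using translate_into_semigrp[OF gen] by metis
  have rem: "int k *s u - ncomb a (v k) \<in> R" for k
  proof -
    have "\<bar>(int k *s u - ncomb a (v k)) $ i\<bar> \<le> B" for i
    proof -
      have ui: "real_of_int (u $ i) = (\<Sum>j\<in>UNIV. c j * real_of_int (a j $ i))"
        using arg_cong[OF uc, of "\<lambda>x. x $ i"] by (simp add: rvec_def)
      have "real_of_int ((int k *s u - ncomb a (v k)) $ i) =
          (\<Sum>j\<in>UNIV. (real k * c j - real (v k j)) * real_of_int (a j $ i))"
        by (simp add: ui ncomb_def sum_distrib_left sum_subtractf algebra_simps)
      also have "\<bar>\<dots>\<bar> \<le> (\<Sum>j\<in>UNIV. \<bar>(real k * c j - real (v k j)) * real_of_int (a j $ i)\<bar>)"
        by (rule sum_abs)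
      also have "\<dots> \<le> (\<Sum>j\<in>UNIV. real_of_int \<bar>a j $ i\<bar>)"
      proof (rule sum_mono)
        fix j
        have "real k * c j \<ge> 0" using c[of j] by simp
        then have "real (v k j) = of_int \<lfloor>real k * c j\<rfloor>"
          unfolding v_def by simp
        then have "\<bar>real k * c j - real (v k j)\<bar> \<le> 1"
          by linarith
        then show "\<bar>(real k * c j - real (v k j)) * real_of_int (a j $ i)\<bar> \<le> real_of_int \<bar>a j $ i\<bar>"
          by (simp add: abs_mult mult_left_le_one_le)
      qed
      also have "\<dots> = of_int (\<Sum>j\<in>UNIV. \<bar>a j $ i\<bar>)" by simp
      also have "\<dots> \<le> of_int B"
        unfolding B_def of_int_le_iff
        by (rule member_le_sum[of i UNIV "\<lambda>i. \<Sum>j\<in>UNIV. \<bar>a j $ i\<bar>"]) (auto intro: sum_nonneg)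
      finally show ?thesis by linarith
    qed
    then show ?thesis by (simp add: R_def)
  qed
  let ?K = "Max (L ` R)"
  have "int k *s u + int ?K *s (\<Sum>j\<in>UNIV. a j) \<in> semigrp a" for k
  proof -
    have "L (int k *s u - ncomb a (v k)) \<le> ?K"
      using \<open>finite R\<close> rem by simp
    then have "(int k *s u - ncomb a (v k)) + int ?K *s (\<Sum>j\<in>UNIV. a j) \<in> semigrp a"
      by (rule L)
    moreover have "ncomb a (v k) \<in> semigrp a" by (simp add: semigrp_def)
    ultimately show ?thesis
      using semigrp_add by fastforce
  qed
  then show ?thesis by blast
qed


section \<open>Facets\<close>

text \<open>The reals form a vector space over the rationals; extend \<open>b\<close> to a basis and
  take the coordinate that belongs to \<open>b\<close>.\<close>

lemma rational_linear_functional: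
  fixes b :: real
  assumes "b \<noteq> 0"
  obtains \<phi> :: "real \<Rightarrow> rat"
  where "\<And>x y. \<phi> (x + y) = \<phi> x + \<phi> y" "\<And>q x. \<phi> (of_rat q * x) = q * \<phi> x" "\<phi> b = 1"
proof -
  interpret Q: vector_space "\<lambda>(q::rat) (x::real). of_rat q * x"
    by unfold_locales (simp_all add: algebra_simps of_rat_add of_rat_mult)
  have ind: "Q.independent {b}"
    using assms by (simp add: Q.independent_insert)
  let ?B = "Q.extend_basis {b}"
  have B: "Q.independent ?B" "Q.span ?B = UNIV" "b \<in> ?B"
    using Q.independent_extend_basis[OF ind] Q.span_extend_basis[OF ind]
      Q.extend_basis_superset[OF ind] by auto
  show ?thesis
  proof (rule that[of "\<lambda>x. Q.representation ?B x b"])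
    show "Q.representation ?B (x + y) b = Q.representation ?B x b + Q.representation ?B y b" for x y
      using B by (simp add: Q.representation_add)
    show "Q.representation ?B (of_rat q * x) b = q * Q.representation ?B x b" for q x
      using B by (simp add: Q.representation_scale)
    show "Q.representation ?B b b = 1"
      using B by (simp add: Q.representation_basis)
  qed
qed

text \<open>Clear the denominators and divide by the greatest common divisor, which is nonzero
  because of \<open>q i0\<close>. A positive \<open>r\<close> preserves the side of the
  hyperplane.\<close>

lemma primitive_multiple:
  fixes q :: "'n::finite \<Rightarrow> rat"
  assumes "q i0 \<noteq> 0"
  obtains l :: "int ^ 'n" and r :: rat
  where "r > 0" "\<And>i. of_int (l $ i) = r * q i" "Gcd (range (($) l)) = 1"
proof -
  define d where "d = (\<Prod>i\<in>UNIV. snd (quotient_of (q i)))"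
  have d: "d > 0"
    unfolding d_def by (intro prod_pos) (simp add: quotient_of_denom_pos')
  have "\<exists>k. of_int d * q i = of_int k" for i
  proof -
    have "snd (quotient_of (q i)) dvd d"
      unfolding d_def by (rule dvd_prodI) auto
    then obtain e where e: "d = snd (quotient_of (q i)) * e" by (rule dvdE)
    have "q i = of_int (fst (quotient_of (q i))) / of_int (snd (quotient_of (q i)))"
      by (metis prod.collapse quotient_of_div)
    moreover have "snd (quotient_of (q i)) \<noteq> 0"
      using quotient_of_denom_pos'[of "q i"] by simp
    ultimately have "q i * of_int (snd (quotient_of (q i))) = of_int (fst (quotient_of (q i)))"
      by (metis nonzero_eq_divide_eq of_int_eq_0_iff)
    then have "of_int d * q i = of_int (fst (quotient_of (q i)) * e)"
      by (simp add: e mult.commute mult.left_commute)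
    then show ?thesis by blast
  qed
  then obtain k where k: "\<And>i. of_int d * q i = of_int (k i)" by metis
  define g where "g = Gcd (range k)"
  have "k i0 \<noteq> 0"
    using k[of i0] assms d by auto
  then have g0: "g > 0"
    unfolding g_def using Gcd_0_iff[of "range k"] Gcd_int_greater_eq_0[of "range k"]
    by (auto simp: order_le_less)
  have kg: "k i = g * (k i div g)" for i
    unfolding g_def by simp
  show ?thesis
  proof (rule that[of "of_int d / of_int g" "\<chi> i. k i div g"])
    show "of_int d / of_int g > (0 :: rat)" using d g0 by simp
    show "of_int ((\<chi> i. k i div g) $ i) = of_int d / of_int g * q i" for i
    proof -
      have "of_int d * q i = of_int g * of_int (k i div g)"
        unfolding k of_int_mult[symmetric] kg[symmetric] ..
      then show ?thesis using g0 by (simp add: field_simps)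
    qed
    have "range k = (*) g ` range (\<lambda>i. k i div g)"
      unfolding image_image kg[symmetric] ..
    with g_def have "g = Gcd ((*) g ` range (\<lambda>i. k i div g))"
      by (rule trans[OF _ arg_cong])
    also have "\<dots> = g * Gcd (range (\<lambda>i. k i div g))"
      using g0 by (simp add: Gcd_mult abs_mult)
    finally have "g = g * Gcd (range (\<lambda>i. k i div g))" .
    moreover have "range (($) (\<chi> i. k i div g)) = range (\<lambda>i. k i div g)"
      by auto
    ultimately show "Gcd (range (($) (\<chi> i. k i div g))) = 1"
      using g0 by simp
  qed
qed

text \<open>By dimension, \<open>S\<close> spans the hyperplane orthogonal to \<open>g\<close>. The
  component of \<open>h\<close> orthogonal to \<open>g\<close> lies in that span, so it is
  orthogonal to \<open>h\<close> as well, and hence to itself.\<close>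

lemma orthogonal_to_hyperplane:
  fixes g h :: "'a::euclidean_space"
  assumes g: "g \<noteq> 0" and S: "\<And>x. x \<in> S \<Longrightarrow> g \<bullet> x = 0 \<and> h \<bullet> x = 0"
    and dim: "dim S \<ge> DIM('a) - 1"
  obtains t where "h = t *\<^sub>R g"
proof -
  have "span S \<subseteq> {x. g \<bullet> x = 0}"
    using S by (intro span_minimal) (auto simp: subspace_hyperplane)
  moreover have "dim {x. g \<bullet> x = 0} \<le> dim (span S)"
    using dim by (simp add: dim_hyperplane[OF g])
  ultimately have eq: "span S = {x. g \<bullet> x = 0}"
    by (intro subspace_dim_equal) (auto simp: subspace_hyperplane)
  have sub: "span S \<subseteq> {x. h \<bullet> x = 0}"
    using S by (intro span_minimal) (auto simp: subspace_hyperplane)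
  define x where "x = h - ((g \<bullet> h) / (g \<bullet> g)) *\<^sub>R g"
  have "g \<bullet> x = 0" using g by (simp add: x_def inner_diff_right)
  moreover from this have "h \<bullet> x = 0" using eq sub by blast
  ultimately have "x \<bullet> x = 0"
    by (subst (1) x_def) (simp add: inner_diff_left)
  then have "h = ((g \<bullet> h) / (g \<bullet> g)) *\<^sub>R g" by (simp add: x_def)
  then show ?thesis by (rule that)
qed

text \<open>The cone is a full-dimensional polyhedron, so its boundary points lie on facets. The
  main work is to replace the real normal vector of a facet by a primitive integral one.\<close>

lemma facet_form_exists:
  fixes a :: "'v::finite \<Rightarrow> int ^ 'n::finite"
  assumes gen: "group_closure (range a) = UNIV"
    and c: "c \<in> real_cone a" "c \<notin> interior (real_cone a)"
  obtains l where "facet_form a l" "lin_form l c = 0"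
proof -
  let ?C = "real_cone a"
  have poly: "polyhedron ?C"
    unfolding real_cone_rvec by (intro polyhedron_convex_cone_hull) simp
  have C0: "0 \<in> ?C"
    using convex_cone_contains_0[OF convex_cone_real_cone] .
  have "span ?C = UNIV"
  proof -
    have "range (\<lambda>j. rvec (a j)) \<subseteq> ?C" by (intro image_subsetI rvec_in_real_cone)
    from span_mono[OF this] show ?thesis using span_rvec[OF gen] by auto
  qed
  then have aff: "affine hull ?C = UNIV"
    using affine_hull_span_0[of ?C] C0 by (simp add: hull_inc)
  have "c \<in> rel_frontier ?C"
    using c closure_subset[of ?C] by (auto simp: rel_frontier_def rel_interior_interior[OF aff])
  then obtain F where F: "F facet_of ?C" "c \<in> F"
    unfolding rel_frontier_of_polyhedron[OF poly] by blast
  obtain g' b where g': "g' \<noteq> 0" "?C \<subseteq> {x. g' \<bullet> x \<le> b}" "F = ?C \<inter> {x. g' \<bullet> x = b}"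
    using facet_of_polyhedron[OF poly F(1)] .
  \<comment> \<open>The supporting hyperplane passes through the origin: \<open>0\<close> lies in
    the cone, so \<open>b \<ge> 0\<close>, while twice \<open>c\<close> lies in it too, so
    \<open>2 * b \<le> b\<close>.\<close>
  have "b \<ge> 0" using g'(2) C0 by auto
  moreover have "g' \<bullet> (2 *\<^sub>R c) \<le> b"
    using g'(2) convex_cone_scaleR[OF convex_cone_real_cone _ c(1), of 2] by auto
  ultimately have b: "b = 0" using F(2) g'(3) by auto
  define g where "g = - g'"
  have g: "g \<noteq> 0" "\<And>x. x \<in> ?C \<Longrightarrow> g \<bullet> x \<ge> 0" "F = {x \<in> ?C. g \<bullet> x = 0}"
    using g' unfolding b g_def by auto
  obtain i0 where i0: "g $ i0 \<noteq> 0" using g(1) by (auto simp: vec_eq_iff)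
  obtain \<phi> :: "real \<Rightarrow> rat" where \<phi>: "\<And>x y. \<phi> (x + y) = \<phi> x + \<phi> y"
      "\<And>q x. \<phi> (of_rat q * x) = q * \<phi> x" "\<phi> (g $ i0) = 1"
    using rational_linear_functional[OF i0] by blast
  have \<phi>0: "\<phi> 0 = 0" using \<phi>(2)[of 0 0] by simp
  have \<phi>sum: "\<phi> (sum f A) = (\<Sum>x\<in>A. \<phi> (f x))" for f :: "'n \<Rightarrow> real" and A
    by (induction A rule: infinite_finite_induct) (simp_all add: \<phi>0 \<phi>(1))
  \<comment> \<open>A rational functional applied to the coordinates of \<open>g\<close> keeps the linear relations with
    integer coefficients, hence gives a rational normal vector of the same facet.\<close>
  define h :: "real ^ 'n" where "h = (\<chi> i. of_rat (\<phi> (g $ i)))"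
  have ha: "h \<bullet> rvec u = 0" if "g \<bullet> rvec u = 0" for u
  proof -
    have "h \<bullet> rvec u = of_rat (\<Sum>i\<in>UNIV. of_int (u $ i) * \<phi> (g $ i))"
      by (simp add: h_def rvec_def inner_vec_def of_rat_sum of_rat_mult mult.commute)
    also have "(\<Sum>i\<in>UNIV. of_int (u $ i) * \<phi> (g $ i)) = \<phi> (g \<bullet> rvec u)"
      using \<phi>(2)[of "of_int _"] by (simp add: rvec_def inner_vec_def \<phi>sum mult.commute[of "g $ _"])
    finally show ?thesis using that \<phi>0 by simp
  qed
  have hF: "h \<bullet> x = 0" if "x \<in> F" for x
  proof -
    have x: "x \<in> ?C" "g \<bullet> x = 0" using that g(3) by auto
    obtain d where d: "\<And>j. d j \<ge> 0" "x = (\<Sum>j\<in>UNIV. d j *\<^sub>R rvec (a j))"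
      using real_cone_comb[OF x(1)] by blast
    \<comment> \<open>In a vanishing sum of nonnegative terms every generator with positive
      coefficient must be orthogonal to \<open>g\<close>; then \<open>ha\<close> makes it orthogonal
      to \<open>h\<close>.\<close>
    have "(\<Sum>j\<in>UNIV. d j * (g \<bullet> rvec (a j))) = 0"
      using x(2) unfolding d(2) by (simp add: inner_sum_right)
    then have "d j * (g \<bullet> rvec (a j)) = 0" for j
      by (subst (asm) sum_nonneg_eq_0_iff) (auto intro: mult_nonneg_nonneg d(1) g(2) rvec_in_real_cone)
    then have "d j * (h \<bullet> rvec (a j)) = 0" for j
      using ha by auto
    then show ?thesis unfolding d(2) by (simp only: inner_sum_right inner_scaleR_right sum.neutral_const)
  qed
  have "dim F \<ge> DIM(real ^ 'n) - 1"
  proof -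
    have "0 \<in> F" using g(3) C0 by simp
    then have "aff_dim F = int (dim F)" by (intro aff_dim_zero hull_inc)
    moreover have "aff_dim ?C = int DIM(real ^ 'n)"
      using aff aff_dim_affine_hull[of ?C] by simp
    ultimately show ?thesis using F(1) unfolding facet_of_def by linarith
  qed
  then obtain t where t: "h = t *\<^sub>R g"
    using orthogonal_to_hyperplane[OF g(1), of F h] g(3) hF by blast
  have "t * g $ i0 = 1"
    using arg_cong[OF t, of "\<lambda>x. x $ i0"] \<phi>(3) by (simp add: h_def)
  then have t0: "t \<noteq> 0" by auto
  \<comment> \<open>\<open>h\<close> may be a negative multiple of \<open>g\<close>; the sign makes
    the resulting form nonnegative on the cone.\<close>
  define s :: rat where "s = (if t > 0 then 1 else - 1)"
  have st: "of_rat s * t > 0" using t0 by (simp add: s_def)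
  obtain l :: "int ^ 'n" and r :: rat where l: "r > 0" "\<And>i. of_int (l $ i) = r * (s * \<phi> (g $ i))"
      "Gcd (range (($) l)) = 1"
  proof -
    have "s * \<phi> (g $ i0) \<noteq> 0" using \<phi>(3) by (simp add: s_def)
    from primitive_multiple[of "\<lambda>i. s * \<phi> (g $ i)", OF this] that show ?thesis by blast
  qed
  define p where "p = of_rat r * (of_rat s * t)"
  have p: "p > 0" using l(1) st by (simp add: p_def)
  have lg: "rvec l = p *\<^sub>R g"
  proof -
    have "real_of_int (l $ i) = of_rat (r * (s * \<phi> (g $ i)))" for i
      by (metis l(2) of_rat_of_int_eq)
    moreover have "of_rat (\<phi> (g $ i)) = t * g $ i" for i
      using arg_cong[OF t, of "\<lambda>x. x $ i"] by (simp add: h_def)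
    ultimately show ?thesis
      by (simp add: vec_eq_iff rvec_def of_rat_mult p_def)
  qed
  have lx: "lin_form l x = p * (g \<bullet> x)" for x
    by (simp add: lin_form_inner lg)
  have "{u \<in> ?C. lin_form l u = 0} = F"
    using p g(3) by (simp add: lx)
  then have "facet_form a l"
    unfolding facet_form_def using l(3) F(1) p g(2) by (simp add: lx)
  moreover have "lin_form l c = 0"
    using F(2) g(3) by (simp add: lx)
  ultimately show ?thesis by (rule that)
qed

text \<open>The sum of the generators in \<open>J\<close> is either interior to the cone or on a
  facet. Around an interior point there is room to subtract a small multiple of the sum of all
  generators; on a facet, nonnegativity of the form on each generator forces all of \<open>J\<close>
  onto it.\<close>

lemma interior_or_facet:
  fixes a :: "'v::finite \<Rightarrow> int ^ 'n::finite"
  assumes gen: "group_closure (range a) = UNIV"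
  obtains (interior) m where "int m *s (\<Sum>j\<in>J. a j) - (\<Sum>j\<in>UNIV. a j) \<in> semigrp a"
  | (facet) l where "facet_form a l" "\<And>j. j \<in> J \<Longrightarrow> lin_form l (a j) = (0 :: int)"
proof -
  let ?C = "real_cone a" and ?c = "\<Sum>j\<in>J. a j" and ?w = "\<Sum>j\<in>UNIV. a j"
  have c: "rvec ?c \<in> ?C"
    unfolding rvec_sum
    by (induction J rule: infinite_finite_induct)
      (simp_all add: convex_cone_contains_0 convex_cone_add convex_cone_real_cone rvec_in_real_cone)
  show ?thesis
  proof (cases "rvec ?c \<in> interior ?C")
    case True
    then obtain e where e: "e > 0" "ball (rvec ?c) e \<subseteq> ?C"
      by (auto simp: mem_interior)
    obtain M :: nat where M: "M > 0" "norm (rvec ?w) < real M * e"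
    proof -
      obtain M :: nat where M: "norm (rvec ?w) < real M * e"
        using reals_Archimedean3[OF e(1)] by blast
      moreover from this have "M > 0"
        by (cases "M = 0") auto
      ultimately show ?thesis using that by blast
    qed
    have "rvec ?c - (1 / real M) *\<^sub>R rvec ?w \<in> ball (rvec ?c) e"
      using M by (simp add: dist_norm field_simps)
    with e(2) have "rvec ?c - (1 / real M) *\<^sub>R rvec ?w \<in> ?C" by blast
    then have "real M *\<^sub>R (rvec ?c - (1 / real M) *\<^sub>R rvec ?w) \<in> ?C"
      using convex_cone_real_cone by (intro convex_cone_scaleR) auto
    also have "real M *\<^sub>R (rvec ?c - (1 / real M) *\<^sub>R rvec ?w) = rvec (int M *s ?c - ?w)"
      using M(1) by (simp add: rvec_def vec_eq_iff field_simps)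
    finally obtain K where "\<And>k. int k *s (int M *s ?c - ?w) + int K *s ?w \<in> semigrp a"
      using semigrp_of_cone[OF gen] by blast
    \<comment> \<open>With \<open>k = K + 1\<close>, the \<open>K + 1\<close> subtracted copies of
      the total sum and the \<open>K\<close> added ones leave exactly one subtracted copy.\<close>
    from this[of "K + 1"] have "int (K + 1) *s (int M *s ?c - ?w) + int K *s ?w \<in> semigrp a" .
    also have "int (K + 1) *s (int M *s ?c - ?w) + int K *s ?w = int ((K + 1) * M) *s ?c - ?w"
      by (simp add: vec_eq_iff algebra_simps)
    finally show ?thesis by (rule interior)
  next
    case False
    obtain l where l: "facet_form a l" "lin_form l (rvec ?c) = 0"
      using facet_form_exists[OF gen c False] by blast
    have nn: "lin_form l (rvec (a j)) \<ge> 0" for j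
      using l(1) rvec_in_real_cone[of a j] by (auto simp: facet_form_def)
    have "(\<Sum>j\<in>J. lin_form l (rvec (a j))) = 0"
      using l(2) by (simp add: lin_form_inner rvec_sum inner_sum_right)
    then have "lin_form l (rvec (a j)) = 0" if "j \<in> J" for j
      using nn that by (subst (asm) sum_nonneg_eq_0_iff) auto
    then have "lin_form l (a j) = (0 :: int)" if "j \<in> J" for j
      using that by (simp add: lin_form_rvec)
    with l(1) show ?thesis by (rule facet)
  qed
qed


section \<open>Exactness across one facet\<close>

definition supported :: "(int ^ 'n) set \<Rightarrow> ('v, 'n::finite) laurent set"
  where "supported T = {r. Poly_Mapping.keys r \<subseteq> T}"

definition semigrp_closed :: "('v \<Rightarrow> int ^ 'n) \<Rightarrow> (int ^ 'n) set \<Rightarrow> bool"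
  where "semigrp_closed a T \<longleftrightarrow> (\<forall>u\<in>T. \<forall>j. u + a j \<in> T)"

text \<open>For \<open>T = UNIV\<close> this corresponds to the top-degree coboundaries, see
  \<open>coboundaries_top\<close>. The parameter \<open>\<beta>\<close> is later
  \<open>- \<alpha>\<close>.\<close>

definition nabla_sums ::
    "('v::finite \<Rightarrow> int ^ 'n::finite) \<Rightarrow> complex ^ 'n \<Rightarrow> (int ^ 'n) set \<Rightarrow> ('v, 'n) laurent set"
  where "nabla_sums a \<beta> T = {\<Sum>i\<in>UNIV. nabla_comp a \<beta> i (q i) | q. \<forall>i. q i \<in> supported T}"

definition nabla_lin ::
    "('v::finite \<Rightarrow> int ^ 'n::finite) \<Rightarrow> complex ^ 'n \<Rightarrow> int ^ 'n \<Rightarrow> ('v, 'n) laurent \<Rightarrow> ('v, 'n) laurent"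
  where "nabla_lin a \<beta> l r = (\<Sum>i\<in>UNIV. of_int (l $ i) * nabla_comp a \<beta> i r)"

section \<open>Laurent polynomials with restricted support\<close>

lemma supported_iff: "r \<in> supported T \<longleftrightarrow> (\<forall>v. v \<notin> T \<longrightarrow> Poly_Mapping.lookup r v = 0)"
  by (auto simp: supported_def in_keys_iff)

lemma supported_0: "0 \<in> supported T"
  by (simp add: supported_iff)

lemma supported_add: "r \<in> supported T \<Longrightarrow> s \<in> supported T \<Longrightarrow> r + s \<in> supported T"
  by (simp add: supported_iff lookup_add)

lemma supported_diff: "r \<in> supported T \<Longrightarrow> s \<in> supported T \<Longrightarrow> r - s \<in> supported T"
  by (simp add: supported_iff lookup_minus)

lemma supported_sum: "(\<And>x. x \<in> A \<Longrightarrow> f x \<in> supported T) \<Longrightarrow> sum f A \<in> supported T"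
  by (induction A rule: infinite_finite_induct) (simp_all add: supported_0 supported_add)

lemma supported_single: "u \<in> T \<Longrightarrow> Poly_Mapping.single u p \<in> supported T"
  by (auto simp: supported_iff lookup_single when_def)

lemma supported_mono: "T \<subseteq> T' \<Longrightarrow> supported T \<subseteq> supported T'"
  by (auto simp: supported_def)

lemma supported_UNIV: "supported UNIV = UNIV"
  by (simp add: supported_def)

lemma supported_induct [consumes 1, case_names zero add single]:
  assumes "r \<in> supported T" "P 0" "\<And>r s. P r \<Longrightarrow> P s \<Longrightarrow> P (r + s)"
    "\<And>u p. u \<in> T \<Longrightarrow> P (Poly_Mapping.single u p)"
  shows "P r"
proof -
  have "P (\<Sum>u\<in>K. Poly_Mapping.single u (Poly_Mapping.lookup r u))" if "finite K" "K \<subseteq> T" for K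
    using that by (induction K) (auto intro: assms)
  moreover have "(\<Sum>u\<in>Poly_Mapping.keys r. Poly_Mapping.single u (Poly_Mapping.lookup r u)) = r"
    by (rule poly_mapping_eqI)
      (simp add: lookup_sum lookup_single when_def in_keys_iff cong: if_cong)
  moreover have "Poly_Mapping.keys r \<subseteq> T"
    using assms(1) by (simp add: supported_def)
  ultimately show ?thesis
    by (metis finite_keys)
qed

section \<open>Coefficient formulas for the operators\<close>

lemma lookup_single_mult:
  "Poly_Mapping.lookup (Poly_Mapping.single u c * r) v = c * Poly_Mapping.lookup r (v - u)"
  for u v :: "'g::ab_group_add" and c :: "'c::comm_semiring_1"
proof (induction r rule: pm_induct)
  case (single w d)
  have "u + w = v \<longleftrightarrow> w = v - u" by auto
  then show ?case by (simp add: mult_single lookup_single when_def)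
qed (simp_all add: distrib_left lookup_add)

lemma lookup_of_int_mult:
  "Poly_Mapping.lookup (of_int k * r) v = of_int k * Poly_Mapping.lookup r v"
  for r :: "'g::ab_group_add \<Rightarrow>\<^sub>0 'c::comm_ring_1"
  by (simp add: lookup_single_mult flip: single_of_int)

lemma lookup_xeuler:
  "Poly_Mapping.lookup (xeuler i r) v = of_int (v $ i) * Poly_Mapping.lookup r v"
  by (induction r rule: pm_induct) (auto simp: xeuler_add lookup_add xeuler_single lookup_single when_def distrib_left)

lemma lookup_nabla_comp:
  fixes a :: "'v::finite \<Rightarrow> int ^ 'n::finite"
  shows "Poly_Mapping.lookup (nabla_comp a \<beta> i r) v =
    Poly_Mapping.single 0 (of_int (v $ i) + \<beta> $ i) * Poly_Mapping.lookup r v +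
    (\<Sum>j\<in>UNIV. Poly_Mapping.single (Poly_Mapping.single j 1) (of_int (a j $ i)) * Poly_Mapping.lookup r (v - a j))"
proof -
  have "lam j * (of_int k * xmon u) = Poly_Mapping.single u (Poly_Mapping.single (Poly_Mapping.single j 1) (of_int k))"
    for j :: 'v and k and u :: "int ^ 'n"
    by (simp add: lam_def xmon_def mult_single flip: single_of_int)
  then show ?thesis
    by (simp add: nabla_comp_def xeuler_fpoly lookup_add lookup_xeuler lconst_def lookup_single_mult
        sum_distrib_right lookup_sum single_add distrib_right)
qed

text \<open>This is the triangular shape: the diagonal entry at \<open>v\<close> is the value of
  \<open>l\<close> at \<open>v\<close> plus its value at \<open>\<beta>\<close>. If \<open>l\<close>
  is nonnegative on the generators, every other contribution with nonzero factor comes from an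
  exponent with smaller value of \<open>l\<close>.\<close>

lemma lookup_nabla_lin:
  "Poly_Mapping.lookup (nabla_lin a \<beta> l r) v =
    Poly_Mapping.single 0 (of_int (lin_form l v) + lin_form l \<beta>) * Poly_Mapping.lookup r v +
    (\<Sum>j\<in>UNIV. Poly_Mapping.single (Poly_Mapping.single j 1) (of_int (lin_form l (a j))) * Poly_Mapping.lookup r (v - a j))"
proof -
  have 1: "of_int k * Poly_Mapping.single m c = Poly_Mapping.single m (of_int k * c)" for k and m :: "'a \<Rightarrow>\<^sub>0 nat" and c :: complex
    by (simp add: mult_single flip: single_of_int)
  have 2: "Poly_Mapping.single m (sum g A) = (\<Sum>x\<in>A. Poly_Mapping.single m (g x))"
    for m :: "'a \<Rightarrow>\<^sub>0 nat" and g :: "'b \<Rightarrow> complex" and A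
    by (induction A rule: infinite_finite_induct) (simp_all add: single_add)
  have "Poly_Mapping.lookup (nabla_lin a \<beta> l r) v =
    (\<Sum>i\<in>UNIV. Poly_Mapping.single 0 (of_int (l $ i) * (of_int (v $ i) + \<beta> $ i)) * Poly_Mapping.lookup r v) +
    (\<Sum>i\<in>UNIV. \<Sum>j\<in>UNIV. Poly_Mapping.single (Poly_Mapping.single j 1) (of_int (l $ i) * of_int (a j $ i)) * Poly_Mapping.lookup r (v - a j))"
    unfolding nabla_lin_def
    by (simp add: lookup_sum lookup_of_int_mult lookup_nabla_comp sum.distrib[symmetric] distrib_left
        mult.assoc[symmetric] 1 sum_distrib_left)
  also have "(\<Sum>i\<in>UNIV. \<Sum>j\<in>UNIV. Poly_Mapping.single (Poly_Mapping.single j 1) (of_int (l $ i) * of_int (a j $ i)) * Poly_Mapping.lookup r (v - a j))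
    = (\<Sum>j\<in>UNIV. Poly_Mapping.single (Poly_Mapping.single j 1) (of_int (lin_form l (a j))) * Poly_Mapping.lookup r (v - a j))"
    by (subst sum.swap) (simp add: lin_form_def 2 sum_distrib_right)
  also have "(\<Sum>i\<in>UNIV. Poly_Mapping.single 0 (of_int (l $ i) * (of_int (v $ i) + \<beta> $ i)) * Poly_Mapping.lookup r v)
    = Poly_Mapping.single 0 (of_int (lin_form l v) + lin_form l \<beta>) * Poly_Mapping.lookup r v"
    by (simp add: lin_form_def 2[symmetric] sum_distrib_right[symmetric] distrib_left sum.distrib)
  finally show ?thesis .
qed

section \<open>Linearity, commutation and supports\<close>

lemma nabla_comp_0: "nabla_comp a \<beta> i 0 = 0"
  by (simp add: nabla_comp_def)

lemma nabla_comp_add: "nabla_comp a \<beta> i (r + s) = nabla_comp a \<beta> i r + nabla_comp a \<beta> i s"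
  by (simp add: nabla_comp_def xeuler_add algebra_simps)

lemma nabla_comp_uminus: "nabla_comp a \<beta> i (- r) = - nabla_comp a \<beta> i r"
  using nabla_comp_add[of a \<beta> i r "- r"] by (simp add: nabla_comp_0 add_eq_0_iff)

lemma nabla_comp_sum: "nabla_comp a \<beta> i (sum g A) = (\<Sum>x\<in>A. nabla_comp a \<beta> i (g x))"
  by (induction A rule: infinite_finite_induct) (simp_all add: nabla_comp_0 nabla_comp_add)

lemma nabla_comp_of_int_mult:
  fixes a :: "'v::finite \<Rightarrow> int ^ 'n::finite"
  shows "nabla_comp a \<beta> i (of_int k * r) = of_int k * nabla_comp a \<beta> i r"
proof -
  have "xeuler i (of_int k :: ('v, 'n) laurent) = 0"
    using xeuler_lconst[of i "of_int k"] by (simp add: lconst_def)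
  then show ?thesis by (simp add: nabla_comp_def xeuler_mult algebra_simps)
qed

lemma nabla_lin_0: "nabla_lin a \<beta> l 0 = 0"
  by (simp add: nabla_lin_def nabla_comp_0)

lemma nabla_lin_add: "nabla_lin a \<beta> l (r + s) = nabla_lin a \<beta> l r + nabla_lin a \<beta> l s"
  by (simp add: nabla_lin_def nabla_comp_add distrib_left sum.distrib)

lemma nabla_lin_uminus: "nabla_lin a \<beta> l (- r) = - nabla_lin a \<beta> l r"
  using nabla_lin_add[of a \<beta> l r "- r"] by (simp add: nabla_lin_0 add_eq_0_iff)

lemma nabla_lin_comp:
  fixes a :: "'v::finite \<Rightarrow> int ^ 'n::{finite,linorder}"
  shows "nabla_lin a \<beta> l (nabla_comp a \<beta> i r) = nabla_comp a \<beta> i (nabla_lin a \<beta> l r)"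
  by (simp add: nabla_lin_def nabla_comp_sum nabla_comp_of_int_mult nabla_comp_commute[of a \<beta> i])

lemma nabla_comp_supported:
  assumes "semigrp_closed a T" "r \<in> supported T"
  shows "nabla_comp a \<beta> i r \<in> supported T"
  unfolding supported_iff
proof (intro allI impI)
  fix v assume v: "v \<notin> T"
  have "v - a j \<notin> T" for j
    using assms(1) v by (auto simp: semigrp_closed_def) (metis diff_add_cancel)
  then show "Poly_Mapping.lookup (nabla_comp a \<beta> i r) v = 0"
    using assms(2) v by (simp add: lookup_nabla_comp supported_iff)
qed

section \<open>Sums of images of the operators\<close>

lemma nabla_sums_mono: "T \<subseteq> T' \<Longrightarrow> nabla_sums a \<beta> T \<subseteq> nabla_sums a \<beta> T'"
  using supported_mono unfolding nabla_sums_def by blast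

lemma nabla_sums_0: "0 \<in> nabla_sums a \<beta> T"
  unfolding nabla_sums_def
  by (intro CollectI exI[of _ "\<lambda>_. 0"]) (simp add: nabla_comp_0 supported_0)

lemma nabla_sums_add: "x \<in> nabla_sums a \<beta> T \<Longrightarrow> y \<in> nabla_sums a \<beta> T \<Longrightarrow> x + y \<in> nabla_sums a \<beta> T"
  unfolding nabla_sums_def
  by clarify (rule_tac x="\<lambda>i. q i + qa i" in exI, simp add: nabla_comp_add sum.distrib supported_add)

lemma nabla_sums_comp:
  fixes a :: "'v::finite \<Rightarrow> int ^ 'n::finite"
  assumes "r \<in> supported T"
  shows "nabla_comp a \<beta> i r \<in> nabla_sums a \<beta> T"
proof -
  have "(\<Sum>k\<in>UNIV. nabla_comp a \<beta> k (if k = i then r else 0)) = (\<Sum>k\<in>UNIV. if k = i then nabla_comp a \<beta> k r else 0)"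
    by (intro sum.cong) (auto simp: nabla_comp_0)
  then show ?thesis
    unfolding nabla_sums_def using assms
    by (intro CollectI exI[of _ "\<lambda>k. if k = i then r else 0"]) (simp add: supported_0)
qed

lemma nabla_lin_in_nabla_sums:
  assumes "r \<in> supported T"
  shows "nabla_lin a \<beta> l r \<in> nabla_sums a \<beta> T"
  unfolding nabla_sums_def using assms
  by (intro CollectI exI[of _ "\<lambda>i. of_int (l $ i) * r"])
    (simp add: nabla_lin_def nabla_comp_of_int_mult supported_iff lookup_of_int_mult)

section \<open>Invertibility modulo a closed support\<close>

lemma single_0_mult_cancel:
  fixes p :: "'v cpoly"
  assumes "c \<noteq> 0"
  shows "Poly_Mapping.single 0 (1 / c) * (Poly_Mapping.single 0 c * p) = p"
  using assms by (simp add: mult_single flip: mult.assoc)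

text \<open>Take a term of \<open>r\<close> outside \<open>T\<close> with minimal value of
  \<open>l\<close>. No other term contributes to the image at its exponent \<open>v\<close>: since
  \<open>T\<close> is closed, \<open>v - a j\<close> is outside \<open>T\<close>, and there either
  \<open>r\<close> has no term by minimality or the factor \<open>lin_form l (a j)\<close> is zero.
  Only the diagonal entry is left, and it is nonzero because the value at \<open>\<beta>\<close> is
  not an integer.\<close>

lemma nabla_lin_inj:
  fixes a :: "'v::finite \<Rightarrow> int ^ 'n::finite"
  assumes closed: "semigrp_closed a T"
    and pos: "\<And>j. lin_form l (a j) \<ge> (0 :: int)" and nonint: "lin_form l \<beta> \<notin> \<int>"
    and r: "nabla_lin a \<beta> l r \<in> supported T"
  shows "r \<in> supported T"
proof (rule ccontr)
  let ?K = "Poly_Mapping.keys r - T"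
  assume "r \<notin> supported T"
  then have "?K \<noteq> {}" by (auto simp: supported_def)
  then obtain v where v: "v \<in> ?K" and min: "\<And>w. w \<in> ?K \<Longrightarrow> lin_form l v \<le> (lin_form l w :: int)"
    using arg_min_if_finite[of ?K "lin_form l :: _ \<Rightarrow> int"]
    by (meson finite_Diff finite_keys not_less)
  have other: "Poly_Mapping.single (Poly_Mapping.single j 1) (of_int (lin_form l (a j))) * Poly_Mapping.lookup r (v - a j) = 0" for j
  proof (cases "lin_form l (a j) = (0 :: int)")
    case False
    have "lin_form l (v - a j) = lin_form l v - (lin_form l (a j) :: int)"
      by (simp add: lin_form_def right_diff_distrib sum_subtractf)
    with False pos[of j] min[of "v - a j"] have "v - a j \<notin> ?K" by fastforce
    moreover have "v - a j \<notin> T"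
      using closed v by (auto simp: semigrp_closed_def) (metis diff_add_cancel)
    ultimately show ?thesis by (simp add: in_keys_iff)
  qed simp
  have "Poly_Mapping.lookup (nabla_lin a \<beta> l r) v = 0"
    using r v by (simp add: supported_iff)
  then have "Poly_Mapping.single 0 (of_int (lin_form l v) + lin_form l \<beta>) * Poly_Mapping.lookup r v = 0"
    by (simp only: lookup_nabla_lin other sum.neutral_const add_0_right)
  moreover have "of_int (lin_form l v) + lin_form l \<beta> \<noteq> 0"
    using nonint by (metis Ints_minus Ints_of_int add_eq_0_iff minus_minus)
  ultimately have "Poly_Mapping.lookup r v = 0"
    using single_0_mult_cancel by (metis mult_zero_right)
  with v show False by (simp add: in_keys_iff)
qed

text \<open>Dividing by the diagonal entry solves the equation for a monomial up to terms with
  strictly larger \<open>l\<close>. As \<open>l\<close> is at most \<open>b\<close> on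
  \<open>T1 - T\<close>, the recursion ends inside \<open>T\<close>.\<close>

lemma nabla_lin_surj:
  fixes a :: "'v::finite \<Rightarrow> int ^ 'n::finite"
  assumes closed: "semigrp_closed a T1" and "T \<subseteq> T1"
    and pos: "\<And>j. lin_form l (a j) \<ge> (0 :: int)" and nonint: "lin_form l \<beta> \<notin> \<int>"
    and bound: "\<And>v. v \<in> T1 \<Longrightarrow> v \<notin> T \<Longrightarrow> lin_form l v \<le> (b :: int)"
    and r: "r \<in> supported T1"
  shows "\<exists>s\<in>supported T1. r - nabla_lin a \<beta> l s \<in> supported T"
proof -
  define P where "P r \<longleftrightarrow> (\<exists>s\<in>supported T1. r - nabla_lin a \<beta> l s \<in> supported T)"
    for r :: "('v, 'n) laurent"
  have PT: "P r" if "r \<in> supported T" for r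
    unfolding P_def using that by (intro bexI[of _ 0]) (simp_all add: nabla_lin_0 supported_0)
  have PE: "P (nabla_lin a \<beta> l s)" if "s \<in> supported T1" for s
    unfolding P_def using that by (intro bexI[of _ s]) (simp_all add: supported_0)
  have Padd: "P (r + s)" if rs: "P r" "P s" for r s
  proof -
    obtain r' s' where r': "r' \<in> supported T1" "r - nabla_lin a \<beta> l r' \<in> supported T"
      and s': "s' \<in> supported T1" "s - nabla_lin a \<beta> l s' \<in> supported T"
      using rs unfolding P_def by blast
    have "(r - nabla_lin a \<beta> l r') + (s - nabla_lin a \<beta> l s') = r + s - nabla_lin a \<beta> l (r' + s')"
      by (simp add: nabla_lin_add)
    then show ?thesis
      unfolding P_def using supported_add[OF r'(1) s'(1)] supported_add[OF r'(2) s'(2)] by metis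
  qed
  have Pneg: "P (- r)" if r: "P r" for r
  proof -
    obtain r' where r': "r' \<in> supported T1" "r - nabla_lin a \<beta> l r' \<in> supported T"
      using r unfolding P_def by blast
    then show ?thesis
      unfolding P_def by (intro bexI[of _ "- r'"]) (auto simp: nabla_lin_uminus supported_iff lookup_minus)
  qed
  have Psum: "P (sum f A)" if "\<And>x. x \<in> A \<Longrightarrow> P (f x)" for f :: "'v \<Rightarrow> ('v, 'n) laurent" and A
    using that by (induction A rule: infinite_finite_induct) (auto simp: Padd PT supported_0)
  have single: "P (Poly_Mapping.single v p)" if "v \<in> T1" for v p
    using that
  proof (induction "nat (b - lin_form l v)" arbitrary: v p rule: less_induct)
    case less
    show ?case
    proof (cases "v \<in> T")
      case True
      then show ?thesis by (intro PT supported_single)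
    next
      case False
      let ?d = "of_int (lin_form l v) + lin_form l \<beta>"
      let ?c = "\<lambda>j. Poly_Mapping.single (Poly_Mapping.single j 1) (of_int (lin_form l (a j)))"
      have d: "?d \<noteq> 0"
        using nonint by (metis Ints_minus Ints_of_int add_eq_0_iff minus_minus)
      define q where "q = Poly_Mapping.single 0 (1 / ?d) * p"
      have p: "Poly_Mapping.single 0 ?d * q = p"
        using d by (simp add: q_def mult_single flip: mult.assoc)
      have E: "nabla_lin a \<beta> l (Poly_Mapping.single v q) =
          Poly_Mapping.single v p + (\<Sum>j\<in>UNIV. Poly_Mapping.single (v + a j) (?c j * q))"
      proof (rule poly_mapping_eqI)
        fix w
        have eq: "v = w - a j \<longleftrightarrow> v + a j = w" for j by auto
        show "Poly_Mapping.lookup (nabla_lin a \<beta> l (Poly_Mapping.single v q)) w = Poly_Mapping.lookup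
            (Poly_Mapping.single v p + (\<Sum>j\<in>UNIV. Poly_Mapping.single (v + a j) (?c j * q))) w"
          using p by (cases "v = w")
            (simp_all add: lookup_nabla_lin lookup_add lookup_sum lookup_single eq when_def if_distrib[of "(*) _"] cong: if_cong)
      qed
      have "P (Poly_Mapping.single (v + a j) (?c j * q))" for j
      proof (cases "lin_form l (a j) = (0 :: int)")
        case True
        then show ?thesis by (simp add: PT supported_0)
      next
        case nz: False
        have "lin_form l (v + a j) = lin_form l v + (lin_form l (a j) :: int)"
          by (simp add: lin_form_def distrib_left sum.distrib)
        moreover have "lin_form l v \<le> b" using bound less.prems False by blast
        \<comment> \<open>The truncated measure does not drop when \<open>l\<close> already equals
          \<open>b\<close> at \<open>v\<close>; in that case \<open>l\<close> exceeds
          \<open>b\<close> at \<open>v + a j\<close>, which therefore lies in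
          \<open>T\<close>.\<close>
        ultimately have "nat (b - lin_form l (v + a j)) < nat (b - lin_form l v) \<or> lin_form l (v + a j) > b"
          using nz pos[of j] by linarith
        moreover have v': "v + a j \<in> T1" using closed less.prems by (simp add: semigrp_closed_def)
        ultimately show ?thesis
          using less.hyps bound[OF v'] PT[OF supported_single] by fastforce
      qed
      then have "P (nabla_lin a \<beta> l (Poly_Mapping.single v q) + - (\<Sum>j\<in>UNIV. Poly_Mapping.single (v + a j) (?c j * q)))"
        by (intro Padd Pneg Psum PE supported_single less.prems)
      then show ?thesis by (simp add: E)
    qed
  qed
  from r have "P r"
    by (induction rule: supported_induct) (auto intro: PT supported_0 Padd single)
  then show ?thesis unfolding P_def .
qed

text \<open>The image of \<open>nabla_lin\<close> consists of elements of \<open>nabla_sums\<close>,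
  so its surjectivity modulo \<open>supported T\<close> gives the first claim. The second says that
  no new relations arise on \<open>supported T\<close>; it combines surjectivity, injectivity and
  the commutation with the \<open>D\<^sub>i\<close>.\<close>

lemma nabla_exact_step:
  fixes a :: "'v::finite \<Rightarrow> int ^ 'n::{finite,linorder}"
  assumes closed: "semigrp_closed a T" "semigrp_closed a T1" and sub: "T \<subseteq> T1"
    and pos: "\<And>j. lin_form l (a j) \<ge> (0 :: int)" and nonint: "lin_form l \<beta> \<notin> \<int>"
    and bound: "\<And>v. v \<in> T1 \<Longrightarrow> v \<notin> T \<Longrightarrow> lin_form l v \<le> (b :: int)"
  shows "r \<in> supported T1 \<Longrightarrow> \<exists>s\<in>supported T. r - s \<in> nabla_sums a \<beta> T1"
    and "r \<in> supported T \<Longrightarrow> r \<in> nabla_sums a \<beta> T1 \<Longrightarrow> r \<in> nabla_sums a \<beta> T"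
proof -
  have surj: "\<exists>s\<in>supported T1. r - nabla_lin a \<beta> l s \<in> supported T" if "r \<in> supported T1" for r
    using nabla_lin_surj[OF closed(2) sub pos nonint _ that] bound by blast
  note inj = nabla_lin_inj[OF closed(1) pos nonint]
  show "\<exists>s\<in>supported T. r - s \<in> nabla_sums a \<beta> T1" if r: "r \<in> supported T1"
  proof -
    obtain s where s: "s \<in> supported T1" "r - nabla_lin a \<beta> l s \<in> supported T"
      using surj[OF r] by blast
    moreover have "r - (r - nabla_lin a \<beta> l s) \<in> nabla_sums a \<beta> T1"
      using nabla_lin_in_nabla_sums[OF s(1)] by simp
    ultimately show ?thesis by blast
  qed
  assume r: "r \<in> supported T" "r \<in> nabla_sums a \<beta> T1"
  then obtain q where q: "\<And>i. q i \<in> supported T1" "r = (\<Sum>i\<in>UNIV. nabla_comp a \<beta> i (q i))"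
    unfolding nabla_sums_def by blast
  obtain s where s: "\<And>i. s i \<in> supported T1" "\<And>i. q i - nabla_lin a \<beta> l (s i) \<in> supported T"
    using surj[OF q(1)] by metis
  \<comment> \<open>Modulo \<open>supported T\<close> the element \<open>r\<close> is \<open>\<Sum> \<ell>\<^sub>i D\<^sub>i\<close> of \<open>y\<close>, and injectivity puts \<open>y\<close> into
    \<open>supported T\<close>.\<close>
  define t where "t i = q i - nabla_lin a \<beta> l (s i)" for i
  define y where "y = (\<Sum>i\<in>UNIV. nabla_comp a \<beta> i (s i))"
  have qt: "q i = nabla_lin a \<beta> l (s i) + t i" for i by (simp add: t_def)
  have lin_sum: "nabla_lin a \<beta> l (sum g A) = (\<Sum>x\<in>A. nabla_lin a \<beta> l (g x))" for g :: "'n \<Rightarrow> _" and A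
    by (induction A rule: infinite_finite_induct) (simp_all add: nabla_lin_0 nabla_lin_add)
  have rt: "r = nabla_lin a \<beta> l y + (\<Sum>i\<in>UNIV. nabla_comp a \<beta> i (t i))"
    by (simp add: q(2) qt nabla_comp_add sum.distrib y_def lin_sum nabla_lin_comp)
  have t: "t i \<in> supported T" for i using s(2) by (simp add: t_def)
  have "nabla_lin a \<beta> l y = r - (\<Sum>i\<in>UNIV. nabla_comp a \<beta> i (t i))" using rt by simp
  then have "nabla_lin a \<beta> l y \<in> supported T"
    using r(1) t closed(1) by (simp add: supported_diff supported_sum nabla_comp_supported)
  then have y: "y \<in> supported T" by (rule inj)
  have "r = (\<Sum>i\<in>UNIV. nabla_comp a \<beta> i (of_int (l $ i) * y + t i))"
    by (subst rt) (simp add: nabla_lin_def nabla_comp_add nabla_comp_of_int_mult sum.distrib)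
  moreover have "of_int (l $ i) * y + t i \<in> supported T" for i
    using y t[of i] by (simp add: supported_iff lookup_add lookup_of_int_mult)
  ultimately show "r \<in> nabla_sums a \<beta> T"
    unfolding nabla_sums_def
    by (intro CollectI exI[of _ "\<lambda>i. of_int (l $ i) * y + t i"] conjI allI)
qed


section \<open>Exhausting the lattice\<close>

lemma lin_form_add: "lin_form l (u + v) = lin_form l u + lin_form l v"
  by (simp add: lin_form_def distrib_left sum.distrib)

lemma lin_form_ncomb: "lin_form l (ncomb a s) = (\<Sum>j\<in>UNIV. int (s j) * lin_form l (a j))"
  unfolding lin_form_def ncomb_def
  by (simp add: sum_distrib_left, subst sum.swap) (simp add: mult.left_commute)

lemma semigrp_closed_semigrp: "semigrp_closed a (semigrp a)"
  by (auto simp: semigrp_closed_def intro: semigrp_add semigrp_gen)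

lemma semigrp_closed_ncomb:
  assumes "semigrp_closed a T" "u \<in> T"
  shows "u + ncomb a s \<in> T"
proof -
  have mult: "u + int k *s a j \<in> T" if "u \<in> T" for u k j
  proof (induction k)
    case (Suc k)
    have "u + int (Suc k) *s a j = (u + int k *s a j) + a j"
      by (simp add: vec_eq_iff algebra_simps)
    moreover have "(u + int k *s a j) + a j \<in> T"
      using Suc assms(1) unfolding semigrp_closed_def by blast
    ultimately show ?case by (simp only:)
  qed (use that in \<open>simp add: vec_eq_iff\<close>)
  have "u + (\<Sum>j\<in>A. int (s j) *s a j) \<in> T" if "finite A" for A
    using that
  proof (induction A)
    case (insert j A)
    then show ?case using mult[OF insert.IH, of "s j" j] by (simp add: ac_simps)
  qed (simp add: assms)
  then show ?thesis by (simp add: ncomb_def)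
qed

lemma exists_bounded_translate:
  fixes a :: "'v::finite \<Rightarrow> int ^ 'n::finite"
  assumes gen: "group_closure (range a) = UNIV"
    and T: "semigrp_closed a T" "semigrp a \<subseteq> T" "T \<noteq> UNIV"
  obtains u l b where "u \<notin> T" "facet_form a l"
    "\<And>s. u + ncomb a s \<notin> T \<Longrightarrow> lin_form l (u + ncomb a s) \<le> (b :: int)"
proof -
  \<comment> \<open>\<open>G u\<close> shrinks when \<open>u\<close> is translated by the semigroup. If it is minimal and \<open>J\<close> is a maximal
    member, then the coefficients outside \<open>J\<close> of an \<open>s\<close> with \<open>u + s \<notin> T\<close> are bounded.\<close>
  define G where "G u = {J. \<forall>s. (\<forall>j. j \<notin> J \<longrightarrow> s j = 0) \<longrightarrow> u + ncomb a s \<notin> T}" for u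
  obtain u0 where "u0 \<notin> T" using T(3) by blast
  then obtain u where u: "u \<notin> T" and min: "\<And>w. w \<notin> T \<Longrightarrow> card (G u) \<le> card (G w)"
    using ex_has_least_nat[of "\<lambda>u. u \<notin> T" u0 "\<lambda>u. card (G u)"] by blast
  have G_eq: "G (u + ncomb a s) = G u" if "u + ncomb a s \<notin> T" for s
  proof -
    have "G (u + ncomb a s) \<subseteq> G u"
    proof
      fix J assume J: "J \<in> G (u + ncomb a s)"
      show "J \<in> G u"
        unfolding G_def
      proof (intro CollectI allI impI notI)
        fix t assume "\<forall>j. j \<notin> J \<longrightarrow> t j = 0" "u + ncomb a t \<in> T"
        then have "u + ncomb a t + ncomb a s \<in> T" "u + ncomb a s + ncomb a t \<notin> T"
          using J semigrp_closed_ncomb[OF T(1)] by (auto simp: G_def)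
        then show False by (simp add: ac_simps)
      qed
    qed
    then show ?thesis
      using min[OF that] card_subset_eq[of "G u" "G (u + ncomb a s)"] card_mono[of "G u"]
      by (metis finite le_antisym)
  qed
  have "{} \<in> G u"
    using u by (simp add: G_def ncomb_zero flip: fun_eq_iff)
  then obtain J where J: "J \<in> G u" and max: "\<And>K. K \<in> G u \<Longrightarrow> J \<subseteq> K \<Longrightarrow> K = J"
    using finite_has_maximal[of "G u"] by (metis empty_iff finite)
  \<comment> \<open>Maximality of \<open>J\<close>: once one further direction \<open>j\<close> is
    allowed, some combination supported on \<open>insert j J\<close> carries \<open>u\<close> into
    \<open>T\<close>.\<close>
  have "\<exists>s. (\<forall>i. i \<noteq> j \<and> i \<notin> J \<longrightarrow> s i = 0) \<and> u + ncomb a s \<in> T" if "j \<notin> J" for j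
  proof -
    have "insert j J \<notin> G u" using max that by blast
    then show ?thesis unfolding G_def by auto
  qed
  then obtain s where s: "\<And>j i. j \<notin> J \<Longrightarrow> i \<noteq> j \<Longrightarrow> i \<notin> J \<Longrightarrow> s j i = 0"
    and sT: "\<And>j. j \<notin> J \<Longrightarrow> u + ncomb a (s j) \<in> T"
    by metis
  \<comment> \<open>Otherwise raise the coefficients of \<open>t\<close> in \<open>J\<close> by
    \<open>t'\<close>. The result dominates \<open>s j\<close>, so it carries \<open>u\<close> into
    \<open>T\<close>; but \<open>J\<close> also belongs to \<open>G\<close> at the translate of
    \<open>u\<close> by \<open>t\<close>, which keeps it outside.\<close>
  have coeff: "t j < s j j" if t: "u + ncomb a t \<notin> T" and j: "j \<notin> J" for t j
  proof (rule ccontr)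
    assume ge: "\<not> t j < s j j"
    define t' where "t' i = (if i \<in> J then s j i else 0)" for i
    have "J \<in> G (u + ncomb a t)" using J G_eq[OF t] by simp
    then have "u + ncomb a t + ncomb a t' \<notin> T" by (simp add: G_def t'_def)
    moreover have "s j i \<le> t i + t' i" for i
      using ge s[OF j, of i] by (cases "i = j"; cases "i \<in> J") (auto simp: t'_def)
    then have "(\<lambda>i. t i + t' i) = (\<lambda>i. s j i + (t i + t' i - s j i))"
      by simp
    then have "u + ncomb a t + ncomb a t' = u + ncomb a (s j) + ncomb a (\<lambda>i. t i + t' i - s j i)"
      by (metis ncomb_add add.assoc)
    ultimately show False
      using semigrp_closed_ncomb[OF T(1) sT[OF j]] by simp
  qed
  show ?thesis
  proof (rule interior_or_facet[OF gen, of J])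
    \<comment> \<open>This case is impossible: far enough along the sum over \<open>J\<close>, the
      point \<open>u\<close> enters the semigroup and hence \<open>T\<close>, although
      \<open>J \<in> G u\<close> keeps it outside.\<close>
    fix m assume m: "int m *s (\<Sum>j\<in>J. a j) - (\<Sum>j\<in>UNIV. a j) \<in> semigrp a"
    obtain k where "u + int k *s (\<Sum>j\<in>UNIV. a j) \<in> semigrp a"
      using translate_into_semigrp[OF gen] by blast
    from semigrp_add[OF this semigrp_mult[OF m, of k]]
    have "u + int (k * m) *s (\<Sum>j\<in>J. a j) \<in> semigrp a"
      by (simp add: vector_ssub_ldistrib vector_smult_assoc)
    moreover have "int (k * m) *s (\<Sum>j\<in>J. a j) = ncomb a (\<lambda>j. k * m * (if j \<in> J then 1 else 0))"
      unfolding ncomb_mult ncomb_indicator ..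
    moreover have "u + ncomb a (\<lambda>j. k * m * (if j \<in> J then 1 else 0)) \<notin> T"
      using J by (simp add: G_def)
    ultimately show ?thesis using T(2) by auto
  next
    fix l assume l: "facet_form a l" "\<And>j. j \<in> J \<Longrightarrow> lin_form l (a j) = (0 :: int)"
    have nn: "lin_form l (a j) \<ge> (0 :: int)" for j
      using l(1) rvec_in_real_cone[of a j] by (auto simp: facet_form_def lin_form_rvec)
    show ?thesis
    proof (rule that[OF u l(1)])
      fix t assume t: "u + ncomb a t \<notin> T"
      \<comment> \<open>For \<open>j\<close> in \<open>J\<close> the value \<open>s j j\<close> is
        unspecified, but there \<open>l\<close> vanishes on \<open>a j\<close>.\<close>
      have "int (t j) * lin_form l (a j) \<le> int (s j j) * lin_form l (a j)" for j
        using l(2)[of j] coeff[OF t, of j] nn[of j] by (cases "j \<in> J") (auto intro!: mult_right_mono)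
      then show "lin_form l (u + ncomb a t) \<le> lin_form l u + (\<Sum>j\<in>UNIV. int (s j j) * lin_form l (a j))"
        unfolding lin_form_add lin_form_ncomb by (intro add_left_mono sum_mono)
    qed
  qed
qed

text \<open>The two claims are surjectivity and injectivity of the map from
  \<open>R\<^sub>S / \<Sum> D\<^sub>i R\<^sub>S\<close> to the same quotient for the whole lattice.
  Zorn's lemma gives a maximal closed set for which both hold, and a bounded translate would enlarge
  it if it were proper.\<close>

lemma nabla_exact:
  fixes a :: "'v::finite \<Rightarrow> int ^ 'n::{finite,linorder}"
  assumes gen: "group_closure (range a) = UNIV"
    and nonres: "nonresonant a (- \<beta>)"
  shows "\<exists>s\<in>supported (semigrp a). r - s \<in> nabla_sums a \<beta> UNIV"
    and "r \<in> supported (semigrp a) \<Longrightarrow> r \<in> nabla_sums a \<beta> UNIV \<Longrightarrow> r \<in> nabla_sums a \<beta> (semigrp a)"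
proof -
  let ?S = "semigrp a"
  define \<T> where "\<T> = {T. ?S \<subseteq> T \<and> semigrp_closed a T \<and>
    (\<forall>r\<in>supported T. \<exists>s\<in>supported ?S. r - s \<in> nabla_sums a \<beta> T) \<and>
    (\<forall>r\<in>supported ?S. r \<in> nabla_sums a \<beta> T \<longrightarrow> r \<in> nabla_sums a \<beta> ?S)}"
  have "?S \<in> \<T>"
    unfolding \<T>_def using semigrp_closed_semigrp nabla_sums_0 by (auto intro!: bexI[of _ "_ :: ('v, 'n) laurent"])
  have "\<exists>M\<in>\<T>. \<forall>X\<in>\<T>. M \<subseteq> X \<longrightarrow> X = M"
  proof (rule subset_Zorn_nonempty)
    show "\<T> \<noteq> {}" using \<open>?S \<in> \<T>\<close> by blast
    fix C assume C: "C \<noteq> {}" "subset.chain \<T> C"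
    have CT: "C \<subseteq> \<T>" using C(2) by (simp add: subset_chain_def)
    have fin: "\<exists>T\<in>C. K \<subseteq> T" if "finite K" "K \<subseteq> \<Union>C" for K
      using finite_subset_Union_chain[OF that C] by blast
    \<comment> \<open>Finitely many Laurent polynomials involve finitely many exponents, so a single
      member of the chain contains them all.\<close>
    have supp: "\<exists>T\<in>C. \<forall>i. q i \<in> supported T" if "\<forall>i. q i \<in> supported (\<Union>C)" for q :: "'n \<Rightarrow> ('v, 'n) laurent"
    proof -
      have "\<exists>T\<in>C. (\<Union>i. Poly_Mapping.keys (q i)) \<subseteq> T"
        using that by (intro fin) (auto simp: supported_def)
      then show ?thesis by (auto simp: supported_def)
    qed
    show "\<Union>C \<in> \<T>"
      unfolding \<T>_def
    proof (intro CollectI conjI ballI impI)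
      show "?S \<subseteq> \<Union>C" using C(1) CT unfolding \<T>_def by blast
      show "semigrp_closed a (\<Union>C)" using CT unfolding \<T>_def semigrp_closed_def by blast
    next
      fix r :: "('v, 'n) laurent" assume "r \<in> supported (\<Union>C)"
      then obtain T where T: "T \<in> C" "r \<in> supported T" using supp[of "\<lambda>_. r"] by blast
      then obtain s where "s \<in> supported ?S" "r - s \<in> nabla_sums a \<beta> T" using CT unfolding \<T>_def by blast
      moreover have "nabla_sums a \<beta> T \<subseteq> nabla_sums a \<beta> (\<Union>C)" using T(1) by (intro nabla_sums_mono) blast
      ultimately show "\<exists>s\<in>supported ?S. r - s \<in> nabla_sums a \<beta> (\<Union>C)" by blast
    next
      fix r :: "('v, 'n) laurent" assume r: "r \<in> supported ?S" "r \<in> nabla_sums a \<beta> (\<Union>C)"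
      then obtain q where q: "\<forall>i. q i \<in> supported (\<Union>C)" "r = (\<Sum>i\<in>UNIV. nabla_comp a \<beta> i (q i))"
        unfolding nabla_sums_def by blast
      obtain T where T: "T \<in> C" "\<forall>i. q i \<in> supported T" using supp[OF q(1)] by blast
      then have "r \<in> nabla_sums a \<beta> T" unfolding nabla_sums_def q(2) by blast
      then show "r \<in> nabla_sums a \<beta> ?S" using T(1) CT r(1) unfolding \<T>_def by blast
    qed
  qed
  then obtain T where T: "T \<in> \<T>" and max: "\<And>X. X \<in> \<T> \<Longrightarrow> T \<subseteq> X \<Longrightarrow> X = T" by blast
  have ST: "?S \<subseteq> T" and closed: "semigrp_closed a T"
    and T1: "\<And>r. r \<in> supported T \<Longrightarrow> \<exists>s\<in>supported ?S. r - s \<in> nabla_sums a \<beta> T"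
    and T2: "\<And>r. r \<in> supported ?S \<Longrightarrow> r \<in> nabla_sums a \<beta> T \<Longrightarrow> r \<in> nabla_sums a \<beta> ?S"
    using T unfolding \<T>_def by auto
  have "T = UNIV"
  proof (rule ccontr)
    assume "T \<noteq> UNIV"
    then obtain u l b where u: "u \<notin> T" and l: "facet_form a l"
      and b: "\<And>s. u + ncomb a s \<notin> T \<Longrightarrow> lin_form l (u + ncomb a s) \<le> (b :: int)"
      using exists_bounded_translate[OF gen closed ST] by blast
    \<comment> \<open>Every new exponent lies in \<open>u + S\<close>, so outside \<open>T\<close>
      the form \<open>l\<close> is at most \<open>b\<close>, as the exactness step requires.\<close>
    define U where "U = T \<union> (+) u ` ?S"
    have TU: "T \<subseteq> U" by (simp add: U_def)
    have closedU: "semigrp_closed a U"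
      using closed semigrp_closed_semigrp[of a]
      by (fastforce simp: U_def semigrp_closed_def add.assoc)
    have pos: "lin_form l (a j) \<ge> (0 :: int)" for j
      using l rvec_in_real_cone[of a j] by (auto simp: facet_form_def lin_form_rvec)
    have nonint: "lin_form l \<beta> \<notin> \<int>"
    proof
      assume "lin_form l \<beta> \<in> \<int>"
      then have "- lin_form l \<beta> \<in> \<int>" by (rule Ints_minus)
      moreover have "lin_form l (- \<beta>) = - lin_form l \<beta>"
        by (simp add: lin_form_def sum_negf)
      ultimately show False using nonres l unfolding nonresonant_def by metis
    qed
    have bound: "lin_form l v \<le> b" if "v \<in> U" "v \<notin> T" for v
      using that b by (auto simp: U_def semigrp_def)
    note step = nabla_exact_step[OF closed closedU TU pos nonint bound]
    have "U \<in> \<T>"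
      unfolding \<T>_def
    proof (intro CollectI conjI ballI impI closedU)
      show "?S \<subseteq> U" using ST TU by blast
    next
      fix r :: "('v, 'n) laurent" assume "r \<in> supported U"
      then obtain s where s: "s \<in> supported T" "r - s \<in> nabla_sums a \<beta> U"
        using step(1) by blast
      obtain t where t: "t \<in> supported ?S" "s - t \<in> nabla_sums a \<beta> T"
        using T1[OF s(1)] by blast
      have "(r - s) + (s - t) \<in> nabla_sums a \<beta> U"
        using s(2) t(2) nabla_sums_mono[OF TU] by (intro nabla_sums_add) auto
      then show "\<exists>s\<in>supported ?S. r - s \<in> nabla_sums a \<beta> U"
        using t(1) by (intro bexI[of _ t]) simp_all
    next
      fix r :: "('v, 'n) laurent" assume r: "r \<in> supported ?S" "r \<in> nabla_sums a \<beta> U"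
      have "r \<in> supported T" using r(1) supported_mono[OF ST] by blast
      then have "r \<in> nabla_sums a \<beta> T" using step(2) r(2) by blast
      then show "r \<in> nabla_sums a \<beta> ?S" by (rule T2[OF r(1)])
    qed
    then have "U = T" using max TU by blast
    moreover have "u \<in> U" using semigrp_zero[of a] by (auto simp: U_def image_iff intro!: bexI[of _ 0])
    ultimately show False using u by blast
  qed
  then show "\<exists>s\<in>supported ?S. r - s \<in> nabla_sums a \<beta> UNIV"
    and "r \<in> supported ?S \<Longrightarrow> r \<in> nabla_sums a \<beta> UNIV \<Longrightarrow> r \<in> nabla_sums a \<beta> ?S"
    using T1[of r] T2[of r] by (simp_all add: supported_UNIV)
qed


section \<open>Normal forms in the Weyl algebra\<close>

abbreviation (input) pvar :: "'v \<Rightarrow> 'v cpoly"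
  where "pvar j \<equiv> Poly_Mapping.single (Poly_Mapping.single j 1) 1"

abbreviation (input) pconst :: "complex \<Rightarrow> 'v cpoly"
  where "pconst c \<equiv> Poly_Mapping.single 0 c"

section \<open>Commutation relations\<close>

lemma weyl_del_lam: "weyl_del i * weyl_lam j = weyl_lam j * weyl_del i + (if i = j then 1 else 0)"
proof -
  have "fgen (Der i) * fgen (Var j) - (fgen (Var j) * fgen (Der i) + (if i = j then 1 else 0)) \<in> weyl_ideal"
    using weyl_ideal.rel[OF weyl_rels.intros(3), of 1 i j 1] by (simp add: diff_diff_eq)
  then show ?thesis
    by (cases "i = j") (simp_all, (transfer; simp)+)
qed

lemma weyl_lam_commute: "weyl_lam i * weyl_lam j = weyl_lam j * weyl_lam i"
proof transfer
  fix i j :: 'a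
  show "fgen (Var i) * fgen (Var j) - fgen (Var j) * fgen (Var i) \<in> weyl_ideal"
    using weyl_ideal.rel[OF weyl_rels.intros(1), of 1 i j 1] by simp
qed

lemma weyl_del_commute: "weyl_del i * weyl_del j = weyl_del j * weyl_del i"
proof transfer
  fix i j :: 'a
  show "fgen (Der i) * fgen (Der j) - fgen (Der j) * fgen (Der i) \<in> weyl_ideal"
    using weyl_ideal.rel[OF weyl_rels.intros(2), of 1 i j 1] by simp
qed

lemma weyl_const_commute: "weyl_const c * P = P * weyl_const c"
proof transfer
  fix c and p :: "'a free_weyl"
  have "Poly_Mapping.single 0 c * p = p * Poly_Mapping.single 0 c"
    by (induction p rule: pm_induct) (simp_all add: distrib_left distrib_right mult_single mult.commute)
  then show "Poly_Mapping.single 0 c * p - p * Poly_Mapping.single 0 c \<in> weyl_ideal"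
    by (simp add: weyl_ideal.zero)
qed

lemma weyl_const_add: "weyl_const (c + d) = weyl_const c + weyl_const d"
  by transfer (simp add: single_add weyl_ideal.zero)

lemma weyl_const_mult: "weyl_const (c * d) = weyl_const c * weyl_const d"
  by transfer (simp add: mult_single weyl_ideal.zero)

lemma weyl_const_0: "weyl_const 0 = 0" and weyl_const_1: "weyl_const 1 = 1"
  by (transfer, simp add: weyl_ideal.zero)+

section \<open>Ordered monomials in commuting elements\<close>

definition monom_prod :: "('v::{finite,linorder} \<Rightarrow> 'a::monoid_mult) \<Rightarrow> ('v \<Rightarrow> nat) \<Rightarrow> 'a"
  where "monom_prod f u = prod_list (map (\<lambda>j. f j ^ u j) (sorted_list_of_set UNIV))"

lemma monom_prod_0: "monom_prod f (\<lambda>_. 0) = 1"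
proof -
  have "prod_list (map (\<lambda>j. f j ^ 0) xs) = 1" for xs
    by (induction xs) simp_all
  then show ?thesis by (simp add: monom_prod_def)
qed

lemma commute_prod_list:
  "(\<And>y. y \<in> set ys \<Longrightarrow> x * y = y * x) \<Longrightarrow> x * prod_list ys = prod_list ys * (x::'a::monoid_mult)"
proof (induction ys)
  case (Cons y ys)
  then have xy: "x * y = y * x" and IH: "x * prod_list ys = prod_list ys * x" by simp_all
  have "x * (y * prod_list ys) = y * (x * prod_list ys)"
    unfolding mult.assoc[symmetric] xy ..
  also have "\<dots> = y * prod_list ys * x"
    unfolding IH mult.assoc ..
  finally show ?case by simp
qed simp

lemma power_commute_power:
  "x * y = y * x \<Longrightarrow> x ^ m * y ^ k = y ^ k * (x::'a::monoid_mult) ^ m"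
  by (metis power_commuting_commutes)

lemma monom_prod_add:
  assumes comm: "\<And>i j. f i * f j = f j * f i"
  shows "monom_prod f (\<lambda>j. u j + v j) = monom_prod f u * monom_prod f v"
proof -
  have "prod_list (map (\<lambda>j. f j ^ (u j + v j)) xs) =
      prod_list (map (\<lambda>j. f j ^ u j) xs) * prod_list (map (\<lambda>j. f j ^ v j) xs)" for xs
  proof (induction xs)
    case (Cons x xs)
    let ?U = "prod_list (map (\<lambda>j. f j ^ u j) xs)" and ?V = "prod_list (map (\<lambda>j. f j ^ v j) xs)"
    have swap: "f x ^ v x * ?U = ?U * f x ^ v x"
      by (rule commute_prod_list) (auto intro: power_commute_power comm)
    have "f x ^ (u x + v x) * (?U * ?V) = f x ^ u x * (f x ^ v x * ?U) * ?V"
      by (simp only: power_add mult.assoc)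
    also have "\<dots> = (f x ^ u x * ?U) * (f x ^ v x * ?V)"
      by (simp only: swap mult.assoc)
    finally show ?case using Cons by simp
  qed simp
  then show ?thesis by (simp add: monom_prod_def)
qed

lemma monom_prod_single: "monom_prod f (\<lambda>j. if j = i then 1 else 0) = f i"
proof -
  have "prod_list (map (\<lambda>j. f j ^ (if j = i then 1 else 0)) xs) = (if i \<in> set xs then f i else 1)"
    if "distinct xs" for xs
    using that by (induction xs) auto
  from this[of "sorted_list_of_set UNIV"] show ?thesis by (simp add: monom_prod_def)
qed

lemma del_monom_monom_prod: "del_monom = monom_prod weyl_del"
  by (simp add: fun_eq_iff del_monom_def monom_prod_def)

lemmas del_monom_0 = monom_prod_0[of weyl_del, folded del_monom_monom_prod]
lemmas del_monom_add = monom_prod_add[of weyl_del, OF weyl_del_commute, folded del_monom_monom_prod]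
lemmas del_monom_single = monom_prod_single[of weyl_del, folded del_monom_monom_prod]

text \<open>All three sums are extended to the union of the key sets, where the additional terms
  vanish because \<open>f k 0 = 0\<close>. This serves the maps defined coefficientwise,
  \<open>weyl_poly\<close> and \<open>weyl_section\<close>.\<close>

lemma sum_keys_add:
  assumes "\<And>k. f k 0 = 0" "\<And>k x y. f k (x + y) = f k x + f k y"
  shows "(\<Sum>k\<in>Poly_Mapping.keys (p + q). f k (Poly_Mapping.lookup (p + q) k)) =
    (\<Sum>k\<in>Poly_Mapping.keys p. f k (Poly_Mapping.lookup p k)) +
    (\<Sum>k\<in>Poly_Mapping.keys q. (f k (Poly_Mapping.lookup q k) :: 'c::comm_monoid_add))"
proof -
  let ?K = "Poly_Mapping.keys p \<union> Poly_Mapping.keys q"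
  have eq: "(\<Sum>k\<in>Poly_Mapping.keys r. f k (Poly_Mapping.lookup r k)) = (\<Sum>k\<in>?K. f k (Poly_Mapping.lookup r k))"
    if "Poly_Mapping.keys r \<subseteq> ?K" for r
    using that by (intro sum.mono_neutral_left) (auto simp: in_keys_iff assms)
  show ?thesis
    unfolding eq[OF Poly_Mapping.keys_add] eq[OF Un_upper1] eq[OF Un_upper2]
    by (simp add: lookup_add assms sum.distrib)
qed

section \<open>Polynomials in \<open>\<lambda>\<close> as elements of the Weyl algebra\<close>

definition weyl_poly :: "'v::{finite,linorder} cpoly \<Rightarrow> 'v weyl"
  where "weyl_poly p = (\<Sum>m\<in>Poly_Mapping.keys p.
    weyl_const (Poly_Mapping.lookup p m) * monom_prod weyl_lam (Poly_Mapping.lookup m))"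

lemma weyl_poly_0: "weyl_poly 0 = 0"
  by (simp add: weyl_poly_def)

lemma weyl_poly_add: "weyl_poly (p + q) = weyl_poly p + weyl_poly q"
  unfolding weyl_poly_def
  by (rule sum_keys_add[of "\<lambda>m c. weyl_const c * monom_prod weyl_lam (Poly_Mapping.lookup m)"])
    (simp_all add: weyl_const_0 weyl_const_add distrib_right)

lemma weyl_poly_single:
  "weyl_poly (Poly_Mapping.single m c) = weyl_const c * monom_prod weyl_lam (Poly_Mapping.lookup m)"
  by (cases "c = 0") (simp_all add: weyl_poly_def weyl_const_0)

lemma weyl_poly_const: "weyl_poly (pconst c) = weyl_const c"
proof -
  have "Poly_Mapping.lookup (0 :: 'a \<Rightarrow>\<^sub>0 nat) = (\<lambda>_. 0)" by (simp add: fun_eq_iff)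
  then show ?thesis by (simp add: weyl_poly_single monom_prod_0)
qed

lemma weyl_poly_const_mult: "weyl_poly (pconst c * p) = weyl_const c * weyl_poly p"
  by (induction p rule: pm_induct)
    (simp_all add: weyl_poly_0 weyl_poly_add weyl_poly_single distrib_left mult_single weyl_const_mult mult.assoc)

lemma weyl_poly_var_mult: "weyl_poly (pvar j * p) = weyl_lam j * weyl_poly p"
proof (induction p rule: pm_induct)
  case (single m c)
  have eq: "Poly_Mapping.lookup (Poly_Mapping.single j 1 + m) = (\<lambda>i. (if i = j then 1 else 0) + Poly_Mapping.lookup m i)"
    by (auto simp: fun_eq_iff lookup_add lookup_single when_def)
  have "weyl_poly (pvar j * Poly_Mapping.single m c) =
      weyl_const c * (weyl_lam j * monom_prod weyl_lam (Poly_Mapping.lookup m))"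
    unfolding mult_single mult_1 weyl_poly_single eq
    by (simp only: monom_prod_add[OF weyl_lam_commute] monom_prod_single)
  also have "\<dots> = weyl_lam j * weyl_poly (Poly_Mapping.single m c)"
    unfolding weyl_poly_single mult.assoc[symmetric] weyl_const_commute[of c "weyl_lam j"] ..
  finally show ?case .
qed (simp_all add: weyl_poly_0 weyl_poly_add distrib_left)

text \<open>The cases match the rules available for \<open>weyl_poly\<close>: constants,
  multiplication by one variable, and sums.\<close>

lemma cpoly_induct [case_names const var add]:
  fixes p :: "'v cpoly"
  assumes const: "\<And>c. P (pconst c)" and var: "\<And>j p. P p \<Longrightarrow> P (pvar j * p)"
    and add: "\<And>p q. P p \<Longrightarrow> P q \<Longrightarrow> P (p + q)"
  shows "P p"
proof -
  have monom: "P p \<Longrightarrow> P (Poly_Mapping.single m 1 * p)" for m p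
  proof (induction m arbitrary: p rule: pm_induct)
    case (add m k)
    have "Poly_Mapping.single (m + k) 1 * p = Poly_Mapping.single m 1 * (Poly_Mapping.single k 1 * p)"
      by (simp add: mult_single flip: mult.assoc)
    with add show ?case by simp
  next
    case (single j k)
    show ?case
    proof (induction k)
      case (Suc k)
      have "Poly_Mapping.single (Poly_Mapping.single j (Suc k)) 1 * p =
          pvar j * (Poly_Mapping.single (Poly_Mapping.single j k) 1 * p)"
        by (simp add: mult_single single_add[symmetric] flip: mult.assoc)
      with Suc show ?case using var by simp
    qed (use single in simp)
  qed simp
  show ?thesis
  proof (induction p rule: pm_induct)
    case zero
    show ?case using const[of 0] by simp
  next
    case (single m c)
    show ?case using monom[OF const[of c], of m] by (simp add: mult_single)
  qed (rule add)
qed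

text \<open>The commutator of a partial derivative with a polynomial is multiplication by the
  derivative. This moves derivatives to the right of the coefficients.\<close>

lemma weyl_del_poly: "weyl_del j * weyl_poly p = weyl_poly p * weyl_del j + weyl_poly (lam_deriv j p)"
proof (induction p rule: cpoly_induct)
  case (const c)
  show ?case by (simp add: lam_deriv_single weyl_poly_const weyl_poly_0 weyl_const_commute)
next
  case (var i p)
  have "weyl_del j * weyl_poly (pvar i * p) = (weyl_lam i * weyl_del j + (if j = i then 1 else 0)) * weyl_poly p"
    by (simp only: weyl_poly_var_mult mult.assoc[symmetric] weyl_del_lam)
  also have "\<dots> = weyl_poly (pvar i * p) * weyl_del j + weyl_poly (lam_deriv j (pvar i * p))"
    unfolding lam_deriv_monom_mult weyl_poly_add
    by (simp only: weyl_poly_var_mult distrib_right mult.assoc var.IH distrib_left)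
      (simp add: weyl_poly_0 add.assoc)
  finally show ?case .
next
  case (add p q)
  then show ?case by (simp add: weyl_poly_add lam_deriv_add distrib_left distrib_right)
qed

section \<open>Action of polynomials and derivative monomials\<close>

lemma weyl_act_0_left: "weyl_act a 0 r = 0"
  using weyl_act_simps(1)[of a 0 0 r] by simp

lemma weyl_act_diff: "weyl_act a (P - Q) r = weyl_act a P r - weyl_act a Q r"
  using weyl_act_simps(1)[of a "P - Q" Q r] by simp

lemma weyl_act_sum_left: "weyl_act a (sum g A) r = (\<Sum>x\<in>A. weyl_act a (g x) r)"
  by (induction A rule: infinite_finite_induct) (simp_all add: weyl_act_simps weyl_act_0_left)

lemma weyl_act_weyl_poly: "weyl_act a (weyl_poly p) r = Poly_Mapping.single 0 p * r"
proof (induction p rule: cpoly_induct)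
  case (const c)
  then show ?case by (simp add: weyl_poly_const weyl_act_simps lconst_def)
next
  case (var j p)
  then show ?case by (simp only: weyl_poly_var_mult weyl_act_simps lam_def)
    (simp add: mult_single flip: mult.assoc)
next
  case (add p q)
  then show ?case by (simp add: weyl_poly_add weyl_act_simps single_add distrib_right)
qed

lemma weyl_act_del_xmon: "weyl_act a (weyl_del j) (xmon u) = xmon (u + a j)"
proof -
  have "lpartial j (xmon u) = 0"
    by (simp add: xmon_def lpartial_single lam_deriv_single flip: single_one)
  then show ?thesis by (simp add: weyl_act_simps xmon_def mult_single add.commute)
qed

lemma weyl_act_del_monom:
  fixes a :: "'v::{finite,linorder} \<Rightarrow> int ^ 'n::finite"
  shows "weyl_act a (del_monom v) (xmon u) = xmon (u + ncomb a v)"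
proof -
  have pow: "weyl_act a (weyl_del j ^ k) (xmon u) = xmon (u + int k *s a j)" for j k u
  proof (induction k)
    case 0
    show ?case by (simp add: weyl_act_simps)
  next
    case (Suc k)
    have eq: "u + int k *s a j + a j = u + int (Suc k) *s a j"
      by (simp add: vec_eq_iff algebra_simps)
    show ?case by (simp only: power_Suc weyl_act_simps(3) Suc weyl_act_del_xmon eq)
  qed
  have "weyl_act a (prod_list (map (\<lambda>j. weyl_del j ^ v j) xs)) (xmon u) =
      xmon (u + (\<Sum>j\<leftarrow>xs. int (v j) *s a j))" for xs
    by (induction xs) (simp_all add: weyl_act_simps pow ac_simps)
  from this[of "sorted_list_of_set UNIV"] show ?thesis
    by (simp add: del_monom_def ncomb_def sum_list_distinct_conv_sum_set)
qed

section \<open>Left ideals\<close>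

lemma left_ideal_0: "0 \<in> left_ideal S"
  unfolding left_ideal_def by (intro CollectI exI[of _ "{}"]) auto

lemma left_ideal_mult: "x \<in> left_ideal S \<Longrightarrow> r * x \<in> left_ideal S"
proof -
  assume "x \<in> left_ideal S"
  then obtain F p where F: "finite F" "F \<subseteq> S" "x = (\<Sum>s\<in>F. p s * s)" by (auto simp: left_ideal_def)
  then have "r * x = (\<Sum>s\<in>F. (r * p s) * s)" by (simp add: sum_distrib_left mult.assoc)
  with F show "r * x \<in> left_ideal S" by (auto simp: left_ideal_def)
qed

lemma left_ideal_add:
  assumes "x \<in> left_ideal S" "y \<in> left_ideal S"
  shows "x + y \<in> left_ideal S"
proof -
  obtain F p where F: "finite F" "F \<subseteq> S" "x = (\<Sum>s\<in>F. p s * s)" using assms(1) by (auto simp: left_ideal_def)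
  obtain G q where G: "finite G" "G \<subseteq> S" "y = (\<Sum>s\<in>G. q s * s)" using assms(2) by (auto simp: left_ideal_def)
  have "x = (\<Sum>s\<in>F\<union>G. (if s\<in>F then p s else 0) * s)" "y = (\<Sum>s\<in>F\<union>G. (if s\<in>G then q s else 0) * s)"
    unfolding F G using F G by (auto intro!: sum.mono_neutral_cong_left)
  then have "x + y = (\<Sum>s\<in>F\<union>G. ((if s\<in>F then p s else 0) + (if s\<in>G then q s else 0)) * s)"
    by (simp add: sum.distrib distrib_right)
  then show ?thesis using F G unfolding left_ideal_def
    by (intro CollectI exI[of _ "F \<union> G"] exI conjI) auto
qed

lemma left_ideal_gen: "s \<in> S \<Longrightarrow> s \<in> left_ideal S"
  unfolding left_ideal_def by (intro CollectI exI[of _ "{s}"] exI[of _ "\<lambda>_. 1"]) auto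

lemma left_ideal_sum: "(\<And>x. x \<in> A \<Longrightarrow> f x \<in> left_ideal S) \<Longrightarrow> sum f A \<in> left_ideal S"
  by (induction A rule: infinite_finite_induct) (auto intro: left_ideal_0 left_ideal_add)

lemma left_ideal_mono: "S \<subseteq> S' \<Longrightarrow> left_ideal S \<subseteq> left_ideal S'"
  unfolding left_ideal_def by blast

lemma left_ideal_induct [consumes 1, case_names zero add mult]:
  assumes "x \<in> left_ideal S" "P 0" "\<And>x y. P x \<Longrightarrow> P y \<Longrightarrow> P (x + y)"
    "\<And>r s. s \<in> S \<Longrightarrow> P (r * s)"
  shows "P x"
proof -
  obtain F p where F: "finite F" "F \<subseteq> S" "x = (\<Sum>s\<in>F. p s * s)" using assms(1) by (auto simp: left_ideal_def)
  from F(1,2) show ?thesis unfolding F(3) by (induction F) (auto intro: assms)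
qed

section \<open>The annihilator of \<open>1\<close>\<close>

lemma del_monom_diff_in_box_ideal:
  assumes "ncomb a u = ncomb a v"
  shows "del_monom u - del_monom v \<in> left_ideal (box_op ` relation_lattice a)"
proof -
  let ?l = "\<lambda>j. int (u j) - int (v j)"
  have "(\<Sum>j\<in>UNIV. ?l j *s a j) = ncomb a u - ncomb a v"
    by (simp add: vec_eq_iff ncomb_def sum_subtractf algebra_simps)
  then have "?l \<in> relation_lattice a" using assms by (simp add: relation_lattice_def)
  \<comment> \<open>Splitting off the common factor leaves the positive and negative parts of the
    difference of exponents, which are the two monomials of the box operator.\<close>
  then have "del_monom (\<lambda>j. min (u j) (v j)) * box_op ?l \<in> left_ideal (box_op ` relation_lattice a)"
    by (intro left_ideal_mult left_ideal_gen imageI)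
  moreover have "(\<lambda>j. min (u j) (v j) + nat (?l j)) = u" "(\<lambda>j. min (u j) (v j) + nat (- ?l j)) = v"
    by (auto simp: fun_eq_iff min_def)
  then have "del_monom (\<lambda>j. min (u j) (v j)) * box_op ?l = del_monom u - del_monom v"
    unfolding box_op_def right_diff_distrib del_monom_add[symmetric] by simp
  ultimately show ?thesis by simp
qed

text \<open>The choice is arbitrary: exponent vectors with the same image give derivative monomials
  that agree modulo the box operators.\<close>

definition exponent_rep :: "('v::finite \<Rightarrow> int ^ 'n) \<Rightarrow> int ^ 'n \<Rightarrow> 'v \<Rightarrow> nat"
  where "exponent_rep a u = (SOME v. ncomb a v = u)"

lemma ncomb_exponent_rep: "u \<in> semigrp a \<Longrightarrow> ncomb a (exponent_rep a u) = u"
  unfolding semigrp_def exponent_rep_def by (metis (mono_tags) imageE someI)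

text \<open>A right inverse of \<open>P \<mapsto> P \<cdot> 1\<close> over \<open>R\<^sub>S\<close>,
  with values in normal form: polynomial coefficients to the left of derivative monomials.\<close>

definition weyl_section ::
    "('v::{finite,linorder} \<Rightarrow> int ^ 'n::finite) \<Rightarrow> ('v, 'n) laurent \<Rightarrow> 'v weyl"
  where "weyl_section a r =
    (\<Sum>u\<in>Poly_Mapping.keys r. weyl_poly (Poly_Mapping.lookup r u) * del_monom (exponent_rep a u))"

lemma weyl_section_0: "weyl_section a 0 = 0"
  by (simp add: weyl_section_def)

lemma weyl_section_add: "weyl_section a (r + s) = weyl_section a r + weyl_section a s"
  unfolding weyl_section_def
  by (rule sum_keys_add[of "\<lambda>u p. weyl_poly p * del_monom (exponent_rep a u)"])
    (simp_all add: weyl_poly_0 weyl_poly_add distrib_right)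

lemma weyl_section_single:
  "weyl_section a (Poly_Mapping.single u p) = weyl_poly p * del_monom (exponent_rep a u)"
  by (cases "p = 0") (simp_all add: weyl_section_def weyl_poly_0)

lemma weyl_act_weyl_section:
  fixes a :: "'v::{finite,linorder} \<Rightarrow> int ^ 'n::finite"
  assumes "r \<in> supported (semigrp a)"
  shows "weyl_act a (weyl_section a r) 1 = r"
  using assms
proof (induction rule: supported_induct)
  case (single u p)
  have "weyl_act a (del_monom (exponent_rep a u)) (xmon 0) = xmon u"
    using single by (simp add: weyl_act_del_monom ncomb_exponent_rep)
  then show ?case
    by (simp add: weyl_section_single weyl_act_simps(3) weyl_act_weyl_poly xmon_def mult_single)
qed (simp_all add: weyl_section_0 weyl_act_0_left weyl_section_add weyl_act_simps)

text \<open>Linearity of the section over \<open>\<D>\<close>, modulo the box operators, is checked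
  on constants and generators. The support claim is carried along because for a product the
  hypothesis on \<open>P\<close> is applied to the result of \<open>Q\<close>.\<close>

lemma weyl_act_section_mod_box:
  fixes a :: "'v::{finite,linorder} \<Rightarrow> int ^ 'n::finite"
  assumes "r \<in> supported (semigrp a)"
  shows "weyl_act a P r \<in> supported (semigrp a) \<and>
    P * weyl_section a r - weyl_section a (weyl_act a P r) \<in> left_ideal (box_op ` relation_lattice a)"
    (is "?Q P r")
  using assms
proof (induction P arbitrary: r rule: weyl_gen_induct)
  have Q0: "?Q P 0" for P
    by (simp add: weyl_act_0 weyl_section_0 supported_0 left_ideal_0)
  have Qadd: "?Q P (r + s)" if "?Q P r" "?Q P s" for P r s
  proof -
    have "P * weyl_section a (r + s) - weyl_section a (weyl_act a P (r + s)) =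
      (P * weyl_section a r - weyl_section a (weyl_act a P r)) +
      (P * weyl_section a s - weyl_section a (weyl_act a P s))"
      by (simp add: weyl_act_simps weyl_section_add algebra_simps)
    with that left_ideal_add show ?thesis by (auto simp: weyl_act_simps supported_add)
  qed
  {
    case (1 c)
    then show ?case
    proof (induction rule: supported_induct)
      case (single u p)
      have "weyl_act a (weyl_const c) (Poly_Mapping.single u p) = Poly_Mapping.single u (pconst c * p)"
        by (simp add: weyl_act_simps lconst_def mult_single)
      with single show ?case
        by (simp add: supported_single weyl_section_single weyl_poly_const_mult mult.assoc left_ideal_0)
    qed (fact Q0, fact Qadd)
  next
    case (2 j)
    then show ?case
    proof (induction rule: supported_induct)
      case (single u p)
      have "weyl_act a (weyl_lam j) (Poly_Mapping.single u p) = Poly_Mapping.single u (pvar j * p)"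
        by (simp add: weyl_act_simps lam_def mult_single)
      moreover have "weyl_lam j * weyl_section a (Poly_Mapping.single u p) =
          weyl_section a (Poly_Mapping.single u (pvar j * p))"
        unfolding weyl_section_single weyl_poly_var_mult by (rule mult.assoc[symmetric])
      ultimately show ?case using single by (simp add: supported_single left_ideal_0)
    qed (fact Q0, fact Qadd)
  next
    case (3 j)
    then show ?case
    proof (induction rule: supported_induct)
      case (single u p)
      have act: "weyl_act a (weyl_del j) (Poly_Mapping.single u p) =
          Poly_Mapping.single u (lam_deriv j p) + Poly_Mapping.single (u + a j) p"
        by (simp add: weyl_act_simps lpartial_single xmon_def mult_single add.commute)
      \<comment> \<open>Exponents of \<open>\<partial>\<^sub>j\<close> times the monomial chosen for
        \<open>u\<close>. They may differ from those chosen for \<open>u + a j\<close>, and only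
        here do box operators enter.\<close>
      let ?v = "\<lambda>i. (if i = j then 1 else 0) + exponent_rep a u i"
      have uj: "u + a j \<in> semigrp a" using single semigrp_add semigrp_gen by blast
      have "ncomb a ?v = ncomb a (exponent_rep a (u + a j))"
        unfolding ncomb_add ncomb_single using single uj by (simp add: ncomb_exponent_rep)
      then have "weyl_poly p * (del_monom ?v - del_monom (exponent_rep a (u + a j)))
          \<in> left_ideal (box_op ` relation_lattice a)"
        by (intro left_ideal_mult del_monom_diff_in_box_ideal)
      also have "weyl_poly p * (del_monom ?v - del_monom (exponent_rep a (u + a j))) =
        weyl_del j * weyl_section a (Poly_Mapping.single u p) -
        weyl_section a (weyl_act a (weyl_del j) (Poly_Mapping.single u p))"
        unfolding act weyl_section_add weyl_section_single del_monom_add del_monom_single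
          mult.assoc[symmetric] weyl_del_poly
        by (simp add: algebra_simps)
      finally show ?case
        using single uj by (simp add: act supported_add supported_single)
    qed (fact Q0, fact Qadd)
  next
    case (4 P Q)
    have eq: "(P + Q) * weyl_section a r - weyl_section a (weyl_act a (P + Q) r) =
      (P * weyl_section a r - weyl_section a (weyl_act a P r)) +
      (Q * weyl_section a r - weyl_section a (weyl_act a Q r))"
      by (simp add: weyl_act_simps weyl_section_add algebra_simps)
    note IH = 4(1)[OF 4(3)] 4(2)[OF 4(3)]
    have "weyl_act a (P + Q) r \<in> supported (semigrp a)"
      unfolding weyl_act_simps(1) using IH by (blast intro: supported_add)
    moreover have "(P + Q) * weyl_section a r - weyl_section a (weyl_act a (P + Q) r)
        \<in> left_ideal (box_op ` relation_lattice a)"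
      unfolding eq using IH by (blast intro: left_ideal_add)
    ultimately show ?case ..
  next
    case (5 P Q)
    have eq: "(P * Q) * weyl_section a r - weyl_section a (weyl_act a (P * Q) r) =
      P * (Q * weyl_section a r - weyl_section a (weyl_act a Q r)) +
      (P * weyl_section a (weyl_act a Q r) - weyl_section a (weyl_act a P (weyl_act a Q r)))"
      by (simp add: weyl_act_simps algebra_simps)
    note IH = 5(2)[OF 5(3)] 5(1)[of "weyl_act a Q r"]
    have "weyl_act a (P * Q) r \<in> supported (semigrp a)"
      unfolding weyl_act_simps(3) using IH by blast
    moreover have "(P * Q) * weyl_section a r - weyl_section a (weyl_act a (P * Q) r)
        \<in> left_ideal (box_op ` relation_lattice a)"
      unfolding eq using IH by (blast intro: left_ideal_add left_ideal_mult)
    ultimately show ?case ..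
  }
qed

lemma one_supported: "1 \<in> supported (semigrp a)"
  unfolding single_one[symmetric] by (intro supported_single semigrp_zero)

text \<open>By linearity of the section, \<open>P\<close> times the section of \<open>1\<close> lies
  in the ideal. That section may be a nontrivial monomial, since \<open>exponent_rep a 0\<close> is
  only some representation of \<open>0\<close>, but it agrees with \<open>1\<close> modulo the box
  operators.\<close>

lemma weyl_annihilator_one:
  fixes a :: "'v::{finite,linorder} \<Rightarrow> int ^ 'n::finite"
  assumes "weyl_act a P 1 = 0"
  shows "P \<in> left_ideal (box_op ` relation_lattice a)"
proof -
  have sec: "weyl_section a 1 = del_monom (exponent_rep a 0)"
    unfolding single_one[symmetric] weyl_section_single weyl_poly_const weyl_const_1 by simp
  have "P * weyl_section a 1 \<in> left_ideal (box_op ` relation_lattice a)"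
    using weyl_act_section_mod_box[OF one_supported, of a P] assms by (simp add: weyl_section_0)
  moreover have "P * (del_monom (\<lambda>_. 0) - del_monom (exponent_rep a 0)) \<in> left_ideal (box_op ` relation_lattice a)"
    by (intro left_ideal_mult del_monom_diff_in_box_ideal)
      (simp add: ncomb_zero ncomb_exponent_rep semigrp_zero)
  ultimately have "P * weyl_section a 1 + P * (1 - weyl_section a 1) \<in> left_ideal (box_op ` relation_lattice a)"
    unfolding sec del_monom_0 by (rule left_ideal_add)
  then show ?thesis by (simp add: algebra_simps)
qed


section \<open>Comparison of the two modules\<close>

lemma subquotient_coset:
  fixes act :: "'r \<Rightarrow> 'v::ab_group_add \<Rightarrow> 'v"
  assumes act: "\<And>r v w. act r (v + w) = act r v + act r w"
    and B: "0 \<in> B" "\<And>v w. v \<in> B \<Longrightarrow> w \<in> B \<Longrightarrow> v + w \<in> B" "\<And>r v. v \<in> B \<Longrightarrow> act r v \<in> B"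
  shows "(+) v ` B \<oplus>\<^bsub>subquotient act Z B\<^esub> (+) w ` B = (+) (v + w) ` B"
    and "r \<odot>\<^bsub>subquotient act Z B\<^esub> (+) v ` B = (+) (act r v) ` B"
proof -
  have "\<exists>x y. v + w + b = x + y \<and> x \<in> (+) v ` B \<and> y \<in> (+) w ` B" if "b \<in> B" for b
    using that B(1) by (intro exI[of _ "v + b"] exI[of _ "w + 0"]) (auto simp: ac_simps)
  moreover have "(v + b) + (w + b') \<in> (+) (v + w) ` B" if "b \<in> B" "b' \<in> B" for b b'
    using B(2)[OF that] by (intro image_eqI[of _ _ "b + b'"]) (auto simp: ac_simps)
  ultimately show "(+) v ` B \<oplus>\<^bsub>subquotient act Z B\<^esub> (+) w ` B = (+) (v + w) ` B"
    unfolding subquotient_def by (auto simp del: add_0_left add_0_right)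
  have "\<exists>x b'. act r v + b = act r x + b' \<and> x \<in> (+) v ` B \<and> b' \<in> B" if "b \<in> B" for b
    using that B(1) by (intro exI[of _ v] exI[of _ b]) (auto simp: image_iff intro: bexI[of _ 0])
  moreover have "act r (v + b) + b' \<in> (+) (act r v) ` B" if "b \<in> B" "b' \<in> B" for b b'
    using B(2)[OF B(3)[OF that(1)] that(2)]
    by (intro image_eqI[of _ _ "act r b + b'"]) (auto simp: act ac_simps)
  ultimately show "r \<odot>\<^bsub>subquotient act Z B\<^esub> (+) v ` B = (+) (act r v) ` B"
    unfolding subquotient_def by auto
qed

text \<open>The first isomorphism theorem: \<open>B\<close> is the preimage of \<open>B'\<close>
  under \<open>f\<close>, and \<open>f\<close> maps onto \<open>Z\<close> modulo \<open>B'\<close>.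
  Sending \<open>X\<close> to the set \<open>f(X) + B'\<close> avoids choosing
  representatives.\<close>

lemma subquotient_iso:
  fixes act :: "'r::ring_1 \<Rightarrow> 'v::ab_group_add \<Rightarrow> 'v" and act' :: "'r \<Rightarrow> 'w::ab_group_add \<Rightarrow> 'w"
  assumes mods: "left_module (subquotient act UNIV B)" "left_module (subquotient act' Z B')"
    and act: "\<And>r v w. act r (v + w) = act r v + act r w" "\<And>r v w. act' r (v + w) = act' r v + act' r w"
    and B': "0 \<in> B'" "\<And>v w. v \<in> B' \<Longrightarrow> w \<in> B' \<Longrightarrow> v + w \<in> B'" "\<And>v. v \<in> B' \<Longrightarrow> - v \<in> B'"
      "\<And>r v. v \<in> B' \<Longrightarrow> act' r v \<in> B'"
    and f: "\<And>v w. f (v + w) = f v + f w" "\<And>r v. f (act r v) = act' r (f v)" "\<And>v. f v \<in> Z"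
      "\<And>v. f v \<in> B' \<longleftrightarrow> v \<in> B"
      "\<And>w. w \<in> Z \<Longrightarrow> \<exists>v. w - f v \<in> B'"
  shows "left_module_iso (subquotient act UNIV B) (subquotient act' Z B')
    (\<lambda>X. {f x + b | x b. x \<in> X \<and> b \<in> B'})" (is "left_module_iso ?M ?N ?h")
proof -
  have f0: "f 0 = 0" using f(1)[of 0 0] by simp
  have fd: "f (v - w) = f v - f w" for v w using f(1)[of "v - w" w] by simp
  have B: "0 \<in> B" "\<And>v w. v \<in> B \<Longrightarrow> w \<in> B \<Longrightarrow> v + w \<in> B" "\<And>r v. v \<in> B \<Longrightarrow> act r v \<in> B"
    using B' by (auto simp: f(4)[symmetric] f(1,2) f0)
  note coset = subquotient_coset[of act B, OF act(1) B]
  note coset' = subquotient_coset[of act' B', OF act(2) B'(1,2,4)]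
  have h: "?h ((+) v ` B) = (+) (f v) ` B'" for v
  proof (intro equalityI subsetI)
    fix z assume "z \<in> ?h ((+) v ` B)"
    then obtain b b' where b: "b \<in> B" "b' \<in> B'" "z = f (v + b) + b'" by blast
    then have "f b + b' \<in> B'" using f(4) B'(2) by blast
    then show "z \<in> (+) (f v) ` B'" using b(3) by (intro image_eqI[of _ _ "f b + b'"]) (auto simp: f(1) ac_simps)
  next
    fix z assume "z \<in> (+) (f v) ` B'"
    then obtain b where "b \<in> B'" "z = f (v + 0) + b" by auto
    then show "z \<in> ?h ((+) v ` B)" using B(1) by blast
  qed
  have car: "carrier ?M = range (\<lambda>v. (+) v ` B)" "carrier ?N = (\<lambda>v. (+) v ` B') ` Z"
    by (simp_all add: subquotient_def)
  have coset_eq: "(+) v ` C = (+) w ` C" if "v - w \<in> C"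
    and C: "\<And>v w. v \<in> C \<Longrightarrow> w \<in> C \<Longrightarrow> v + w \<in> C" "\<And>v. v \<in> C \<Longrightarrow> - v \<in> C"
    for v w and C :: "'u::ab_group_add set"
  proof -
    have "(+) v ` C \<subseteq> (+) w ` C" if "v - w \<in> C" for v w
    proof
      fix z assume "z \<in> (+) v ` C"
      then obtain c where c: "c \<in> C" "z = v + c" by blast
      then show "z \<in> (+) w ` C"
        using C(1)[OF that c(1)] by (intro image_eqI[of _ _ "v - w + c"]) auto
    qed
    moreover have "w - v \<in> C" using C(2)[OF that(1)] by simp
    ultimately show ?thesis using that(1) by blast
  qed
  have "inj_on ?h (carrier ?M)"
  proof (rule inj_onI)
    fix X Y assume "X \<in> carrier ?M" "Y \<in> carrier ?M" and eq: "?h X = ?h Y"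
    then obtain v w where vw: "X = (+) v ` B" "Y = (+) w ` B" by (auto simp: car)
    have "(+) (f v) ` B' = (+) (f w) ` B'" using eq unfolding vw h .
    moreover have "f v \<in> (+) (f v) ` B'" using B'(1) by (simp add: image_iff bexI[of _ 0])
    ultimately obtain b where "b \<in> B'" "f v = f w + b" by auto
    then have "f (v - w) \<in> B'" by (simp add: fd)
    then have "v - w \<in> B" by (simp add: f(4))
    moreover have "- x \<in> B" if "x \<in> B" for x
      using fd[of 0 x] f0 that B'(3) by (simp add: f(4)[symmetric])
    ultimately show "X = Y" unfolding vw using B(2) by (intro coset_eq)
  qed
  moreover have "?h ` carrier ?M = carrier ?N"
  proof (intro equalityI subsetI)
    fix X assume "X \<in> ?h ` carrier ?M"
    then obtain v where "X = ?h ((+) v ` B)" by (auto simp: car)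
    then show "X \<in> carrier ?N" unfolding h car using f(3) by blast
  next
    fix X assume "X \<in> carrier ?N"
    then obtain w where w: "w \<in> Z" "X = (+) w ` B'" by (auto simp: car)
    obtain v where "w - f v \<in> B'" using f(5)[OF w(1)] by blast
    then have "X = (+) (f v) ` B'" unfolding w using B'(2,3) by (intro coset_eq)
    then have "X = ?h ((+) v ` B)" unfolding h .
    then show "X \<in> ?h ` carrier ?M" unfolding car by blast
  qed
  ultimately have "bij_betw ?h (carrier ?M) (carrier ?N)" by (simp add: bij_betw_def)
  moreover have "?h (X \<oplus>\<^bsub>?M\<^esub> Y) = ?h X \<oplus>\<^bsub>?N\<^esub> ?h Y"
    if XY: "X \<in> carrier ?M" "Y \<in> carrier ?M" for X Y
  proof -
    obtain v w where vw: "X = (+) v ` B" "Y = (+) w ` B" using XY by (auto simp: car)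
    have "?h (X \<oplus>\<^bsub>?M\<^esub> Y) = ?h ((+) (v + w) ` B)"
      unfolding vw by (rule arg_cong[OF coset(1)])
    also have "\<dots> = (+) (f v) ` B' \<oplus>\<^bsub>?N\<^esub> (+) (f w) ` B'"
      unfolding h f(1) by (rule coset'(1)[symmetric])
    also have "\<dots> = ?h X \<oplus>\<^bsub>?N\<^esub> ?h Y"
      unfolding vw h ..
    finally show ?thesis .
  qed
  moreover have "?h (r \<odot>\<^bsub>?M\<^esub> X) = r \<odot>\<^bsub>?N\<^esub> ?h X" if X: "X \<in> carrier ?M" for r X
  proof -
    obtain v where v: "X = (+) v ` B" using X by (auto simp: car)
    have "?h (r \<odot>\<^bsub>?M\<^esub> X) = ?h ((+) (act r v) ` B)"
      unfolding v by (rule arg_cong[OF coset(2)])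
    also have "\<dots> = r \<odot>\<^bsub>?N\<^esub> (+) (f v) ` B'"
      unfolding h f(2) by (rule coset'(2)[symmetric])
    also have "\<dots> = r \<odot>\<^bsub>?N\<^esub> ?h X"
      unfolding v h ..
    finally show ?thesis .
  qed
  ultimately show ?thesis unfolding left_module_iso_def using mods by blast
qed

section \<open>Cohomology in top degree\<close>

lemma nabla_sums_uminus: "x \<in> nabla_sums a \<beta> T \<Longrightarrow> - x \<in> nabla_sums a \<beta> T"
  unfolding nabla_sums_def
  by clarify (rule_tac x="\<lambda>i. - q i" in exI, simp add: nabla_comp_uminus sum_negf supported_iff)

lemma nabla_sums_act:
  fixes a :: "'v::finite \<Rightarrow> int ^ 'n::{finite,linorder}"
  shows "x \<in> nabla_sums a \<beta> UNIV \<Longrightarrow> weyl_act a P x \<in> nabla_sums a \<beta> UNIV"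
  unfolding nabla_sums_def
  by clarify (rule_tac x="\<lambda>i. weyl_act a P (q i)" in exI, simp add: weyl_act_sum nabla_comp_act supported_UNIV)

lemma axis_add: "axis k (x + y) = axis k x + (axis k y :: 'a::comm_monoid_add ^ 'n)"
  by (simp add: vec_eq_iff axis_def)

lemma axis_uminus: "axis k (- x) = - (axis k x :: 'a::ab_group_add ^ 'n)"
  by (simp add: vec_eq_iff axis_def)

lemma axis_diff: "axis k (x - y) = axis k x - (axis k y :: 'a::ab_group_add ^ 'n)"
  by (simp add: vec_eq_iff axis_def)

lemma form_act_axis: "form_act a P (axis I r) = axis I (weyl_act a P r)"
  by (simp add: vec_eq_iff axis_def form_act_def weyl_act_0)

lemma forms_top: "(\<omega> :: ('v, 'n::finite) form) \<in> forms CARD('n) \<longleftrightarrow> (\<exists>r. \<omega> = axis UNIV r)"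
proof
  assume \<omega>: "\<omega> \<in> forms CARD('n)"
  have "\<omega> $ I = 0" if "I \<noteq> UNIV" for I
    using \<omega> that card_subset_eq[of UNIV I] by (auto simp: forms_def)
  then show "\<exists>r. \<omega> = axis UNIV r"
    by (intro exI[of _ "\<omega> $ UNIV"]) (simp add: vec_eq_iff axis_def)
qed (auto simp: forms_def axis_def)

text \<open>No index set has more than \<open>n\<close> elements, so forms of degree
  \<open>n + 1\<close> vanish and every top form is closed.\<close>

lemma cocycles_top:
  fixes a :: "'v::finite \<Rightarrow> int ^ 'n::{finite,linorder}"
  shows "cocycles a \<beta> CARD('n) = range (axis UNIV)"
proof -
  have "\<omega> = 0" if "\<omega> \<in> forms (Suc CARD('n))" for \<omega> :: "('v, 'n) form"
  proof -
    have "\<omega> $ I = 0" for I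
      using that card_mono[of UNIV I] by (auto simp: forms_def)
    then show ?thesis by (simp add: vec_eq_iff)
  qed
  then have "cocycles a \<beta> CARD('n) = forms CARD('n)"
    using nabla_forms[of _ "CARD('n)" a \<beta>] by (auto simp: cocycles_def)
  then show ?thesis using forms_top by blast
qed

text \<open>A form of degree \<open>n - 1\<close> has one coefficient for each omitted index
  \<open>i\<close>, to which \<open>\<nabla>\<close> applies \<open>D\<^sub>i\<close> up to a sign.
  The signs are absorbed into the coefficients.\<close>

lemma coboundaries_top:
  fixes a :: "'v::finite \<Rightarrow> int ^ 'n::{finite,linorder}"
  shows "coboundaries a \<beta> CARD('n) = axis UNIV ` nabla_sums a \<beta> UNIV"
proof -
  define s :: "'n \<Rightarrow> ('v, 'n) laurent" where "s i = shuffle_sign {i} (UNIV - {i})" for i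
  have s1: "s i = 1 \<or> s i = - 1" for i
    unfolding s_def shuffle_sign_def by (rule minus_one_power_iff[THEN ssubst]) simp
  have ss: "s i * s i = 1" for i using s1[of i] by auto
  have snabla: "s i * nabla_comp a \<beta> i r = nabla_comp a \<beta> i (s i * r)" for i r
    using s1[of i] by (auto simp: nabla_comp_uminus)
  have top: "nabla a \<beta> \<omega> $ UNIV = (\<Sum>i\<in>UNIV. nabla_comp a \<beta> i (s i * \<omega> $ (UNIV - {i})))" for \<omega>
    by (simp add: nabla_alt dlog_wedge s_def[symmetric] snabla)
  have N: "nabla a \<beta> \<omega> = axis UNIV (\<Sum>i\<in>UNIV. nabla_comp a \<beta> i (s i * \<omega> $ (UNIV - {i})))"
    if "\<omega> \<in> forms (CARD('n) - 1)" for \<omega>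
  proof -
    have "nabla a \<beta> \<omega> \<in> forms CARD('n)" using nabla_forms[OF that, of a \<beta>] by simp
    then obtain r where r: "nabla a \<beta> \<omega> = axis UNIV r" using forms_top by blast
    moreover have "r = nabla a \<beta> \<omega> $ UNIV" unfolding r by simp
    ultimately show ?thesis by (simp add: top)
  qed
  \<comment> \<open>The index type is nonempty, so the special case of degree \<open>0\<close> does
    not occur.\<close>
  have "coboundaries a \<beta> CARD('n) = nabla a \<beta> ` forms (CARD('n) - 1)"
    by (simp add: coboundaries_def)
  also have "\<dots> = axis UNIV ` nabla_sums a \<beta> UNIV"
  proof (intro equalityI subsetI)
    fix \<eta> assume "\<eta> \<in> nabla a \<beta> ` forms (CARD('n) - 1)"
    then obtain \<omega> where "\<omega> \<in> forms (CARD('n) - 1)" "\<eta> = nabla a \<beta> \<omega>" by blast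
    then have "\<eta> = axis UNIV (\<Sum>i\<in>UNIV. nabla_comp a \<beta> i (s i * \<omega> $ (UNIV - {i})))" using N by simp
    then show "\<eta> \<in> axis UNIV ` nabla_sums a \<beta> UNIV"
      unfolding nabla_sums_def supported_UNIV
      by (intro image_eqI CollectI exI[of _ "\<lambda>i. s i * \<omega> $ (UNIV - {i})"] conjI refl) auto
  next
    fix \<eta> :: "('v, 'n) form" assume "\<eta> \<in> axis UNIV ` nabla_sums a \<beta> UNIV"
    then obtain q where \<eta>: "\<eta> = axis UNIV (\<Sum>i\<in>UNIV. nabla_comp a \<beta> i (q i))"
      unfolding nabla_sums_def by blast
    \<comment> \<open>At most one \<open>i\<close> satisfies the condition for a given
      \<open>I\<close>. The sign \<open>s i\<close> cancels the one produced by
      \<open>\<nabla>\<close>, since its square is \<open>1\<close>.\<close>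
    define \<omega> :: "('v, 'n) form" where "\<omega> = (\<chi> I. \<Sum>i\<in>UNIV. if I = UNIV - {i} then s i * q i else 0)"
    have "I \<noteq> UNIV - {i}" if "card I \<noteq> CARD('n) - 1" for I and i :: 'n
      using that by (auto simp: card_Diff_singleton)
    then have "\<omega> \<in> forms (CARD('n) - 1)" by (simp add: forms_def \<omega>_def)
    moreover have "UNIV - {i} = UNIV - {k} \<longleftrightarrow> i = k" for i k :: 'n by blast
    then have "\<omega> $ (UNIV - {i}) = s i * q i" for i by (simp add: \<omega>_def)
    then have "s i * \<omega> $ (UNIV - {i}) = q i" for i by (simp add: ss flip: mult.assoc)
    ultimately have "\<eta> = nabla a \<beta> \<omega>" unfolding \<eta> by (subst N) simp_all
    with \<open>\<omega> \<in> forms (CARD('n) - 1)\<close> show "\<eta> \<in> nabla a \<beta> ` forms (CARD('n) - 1)" by blast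
  qed
  finally show ?thesis .
qed

section \<open>The kernel of the comparison map\<close>

lemma weyl_act_box_op:
  assumes "l \<in> relation_lattice a"
  shows "weyl_act a (box_op l) 1 = 0"
proof -
  have "ncomb a (\<lambda>j. nat (l j)) - ncomb a (\<lambda>j. nat (- l j)) = (\<Sum>j\<in>UNIV. l j *s a j)"
    by (auto simp: vec_eq_iff ncomb_def simp flip: sum_subtractf left_diff_distrib intro!: sum.cong)
  then have "ncomb a (\<lambda>j. nat (l j)) = ncomb a (\<lambda>j. nat (- l j))"
    using assms by (simp add: relation_lattice_def)
  then show ?thesis
    using weyl_act_del_monom[of a _ 0] by (simp add: box_op_def weyl_act_diff xmon_def)
qed

text \<open>For the direction from left to right, \<open>nabla_exact\<close> allows the preimages
  under the \<open>D\<^sub>i\<close> to be taken in \<open>R\<^sub>S\<close>, where they lift along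
  the section. Subtracting the lifts times the Euler operators leaves an annihilator of
  \<open>1\<close>.\<close>

lemma hypergeometric_ideal_iff:
  fixes a :: "'v::{finite,linorder} \<Rightarrow> int ^ 'n::{finite,linorder}"
  assumes gen: "group_closure (range a) = UNIV" and nonres: "nonresonant a \<alpha>"
  shows "weyl_act a P 1 \<in> nabla_sums a (- \<alpha>) UNIV \<longleftrightarrow>
    P \<in> left_ideal (box_op ` relation_lattice a \<union> range (euler_op a \<alpha>))"
    (is "_ \<longleftrightarrow> P \<in> left_ideal ?G")
proof
  \<comment> \<open>The Euler operator acts on \<open>1\<close> first, where it equals
    \<open>D\<^sub>i\<close>, and \<open>D\<^sub>i\<close> then commutes with
    \<open>Q\<close>.\<close>
  have euler: "weyl_act a (Q * euler_op a \<alpha> i) 1 = nabla_comp a (- \<alpha>) i (weyl_act a Q 1)" for Q i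
    using euler_sign[of a "- \<alpha>" i] by (simp add: weyl_act_simps(3) nabla_comp_act)
  show "weyl_act a P 1 \<in> nabla_sums a (- \<alpha>) UNIV" if "P \<in> left_ideal ?G"
    using that
  proof (induction rule: left_ideal_induct)
    case (mult r s)
    then consider l where "l \<in> relation_lattice a" "s = box_op l" | i where "s = euler_op a \<alpha> i" by blast
    then show ?case
    proof cases
      case 1
      then show ?thesis by (simp add: weyl_act_simps(3) weyl_act_box_op weyl_act_0 nabla_sums_0)
    next
      case 2
      then show ?thesis by (simp add: euler nabla_sums_comp supported_UNIV)
    qed
  qed (simp_all add: weyl_act_0_left nabla_sums_0 weyl_act_simps nabla_sums_add)
  assume "weyl_act a P 1 \<in> nabla_sums a (- \<alpha>) UNIV"
  moreover have "weyl_act a P 1 \<in> supported (semigrp a)"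
    using weyl_act_section_mod_box[OF one_supported] by blast
  ultimately have "weyl_act a P 1 \<in> nabla_sums a (- \<alpha>) (semigrp a)"
    using nabla_exact(2)[OF gen, of "- \<alpha>"] nonres by simp
  then obtain q where q: "\<And>i. q i \<in> supported (semigrp a)"
      "weyl_act a P 1 = (\<Sum>i\<in>UNIV. nabla_comp a (- \<alpha>) i (q i))"
    unfolding nabla_sums_def by blast
  let ?E = "\<Sum>i\<in>UNIV. weyl_section a (q i) * euler_op a \<alpha> i"
  have "weyl_act a (P - ?E) 1 = 0"
    using q by (simp add: weyl_act_diff weyl_act_sum_left euler weyl_act_weyl_section)
  then have "P - ?E \<in> left_ideal (box_op ` relation_lattice a)"
    by (rule weyl_annihilator_one)
  moreover have "left_ideal (box_op ` relation_lattice a) \<subseteq> left_ideal ?G"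
    by (rule left_ideal_mono) blast
  moreover have "?E \<in> left_ideal ?G"
    by (intro left_ideal_sum left_ideal_mult left_ideal_gen) blast
  ultimately show "P \<in> left_ideal ?G"
    using left_ideal_add[of "P - ?E" ?G ?E] by auto
qed

text \<open>The isomorphism is induced by sending \<open>P\<close> to the top form with coefficient
  \<open>P \<cdot> 1\<close>. By \<open>euler_sign\<close>, the Euler operator with parameter
  \<open>\<alpha>\<close> acts on \<open>1\<close> as \<open>D\<^sub>i\<close> with parameter
  \<open>- \<alpha>\<close>, whence the parameter of the cohomology.\<close>

theorem theorem1p4:
  fixes a :: "'N::{finite,linorder} \<Rightarrow> int ^ 'n::{finite,linorder}"
    and \<alpha> :: "complex ^ 'n::{finite,linorder}"
  assumes "group_closure (range a) = UNIV"
    and "nonresonant a \<alpha>"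
  shows "\<exists>h. left_module_iso (hypergeometric_module a \<alpha>) (cohomology a (- \<alpha>) CARD('n)) h"
proof -
  let ?G = "box_op ` relation_lattice a \<union> range (euler_op a \<alpha>)"
  let ?N = "nabla_sums a (- \<alpha>) UNIV"
  define f :: "'N weyl \<Rightarrow> ('N, 'n) form" where "f P = axis UNIV (weyl_act a P 1)" for P
  have M: "hypergeometric_module a \<alpha> = subquotient (*) UNIV (left_ideal ?G)"
    by (rule hypergeometric_module_def)
  have N: "cohomology a (- \<alpha>) CARD('n) = subquotient (form_act a) (range (axis UNIV)) (axis UNIV ` ?N)"
    unfolding cohomology_def cocycles_top coboundaries_top ..
  have axis_in: "axis UNIV r \<in> axis UNIV ` ?N \<longleftrightarrow> r \<in> ?N" for r
    by (auto simp: axis_eq_axis)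
  show ?thesis
    unfolding M N
  proof (rule exI, rule subquotient_iso[where f = f])
    show "left_module (subquotient (*) UNIV (left_ideal ?G))"
      using left_module_hyper[of a \<alpha>] unfolding M .
    show "left_module (subquotient (form_act a) (range (axis UNIV)) (axis UNIV ` ?N))"
      using left_module_cohomology[of a "- \<alpha>" "CARD('n)"] unfolding N .
    show "r * (v + w) = r * v + r * w" for r v w :: "'N weyl" by (rule distrib_left)
    show "form_act a r (v + w) = form_act a r v + form_act a r w" for r and v w :: "('N, 'n) form"
      by (simp add: form_act_def vec_eq_iff weyl_act_simps)
    show "0 \<in> axis UNIV ` ?N"
      using nabla_sums_0[of a "- \<alpha>" UNIV] by (intro image_eqI[of _ _ 0]) (simp_all add: vec_eq_iff axis_def)
    show "v + w \<in> axis UNIV ` ?N" if "v \<in> axis UNIV ` ?N" "w \<in> axis UNIV ` ?N" for v w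
      using that by (auto simp: nabla_sums_add simp flip: axis_add)
    show "- v \<in> axis UNIV ` ?N" if "v \<in> axis UNIV ` ?N" for v
      using that by (auto simp: nabla_sums_uminus simp flip: axis_uminus)
    show "form_act a r v \<in> axis UNIV ` ?N" if "v \<in> axis UNIV ` ?N" for r v
      using that by (auto simp: form_act_axis nabla_sums_act)
    show "f (v + w) = f v + f w" for v w by (simp add: f_def weyl_act_simps axis_add)
    show "f (r * v) = form_act a r (f v)" for r v by (simp add: f_def weyl_act_simps form_act_axis)
    show "f v \<in> range (axis UNIV)" for v by (simp add: f_def)
    show "f v \<in> axis UNIV ` ?N \<longleftrightarrow> v \<in> left_ideal ?G" for v
      unfolding f_def axis_in by (rule hypergeometric_ideal_iff[OF assms])
    fix w :: "('N, 'n) form" assume "w \<in> range (axis UNIV)"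
    then obtain r where w: "w = axis UNIV r" by blast
    \<comment> \<open>Every top form is cohomologous to one with coefficient in
      \<open>R\<^sub>S\<close>, and there the section supplies a preimage.\<close>
    obtain s where s: "s \<in> supported (semigrp a)" "r - s \<in> ?N"
      using nabla_exact(1)[OF assms(1), of "- \<alpha>" r] assms(2) by auto
    have "w - f (weyl_section a s) = axis UNIV (r - s)"
      using s(1) by (simp add: f_def w weyl_act_weyl_section axis_diff)
    then show "\<exists>v. w - f v \<in> axis UNIV ` ?N" using s(2) by blast
  qed
qed

end
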